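(* Let $\rho$ be a strictly positive excessive function on $E$, let $\mu\in\mathcal{M}_\rho$, and let $f$ be such that $y\mapsto f(x,y)$ is nonincreasing for every $x\in E$ and $f(\cdot,0)\in L^1(E;\rho\cdot m)$. If $u$ is a solution of $-Au=f(x,u)+\mu$, then, with $f_u(x)=f(x,u(x))$, $$\|f_u\|_{L^1(E;\rho\cdot m)}\le 2\|f(\cdot,0)\|_{L^1(E;\rho\cdot m)}+\|\mu\|_\rho.$$
   Context: Setting. $E$ is a locally compact separable metric space, $m$ is a positive Radon measure on $E$ with $\mathrm{supp}[m]=E$, and $(\mathcal{E},D[\mathcal{E}])$ is a symmetric regular Dirichlet form on $L^2(E;m)$, assumed transient: there is a strictly positive function $g$ on $E$ with $\int_E|u|g\,dm\le\sqrt{\mathcal{E}(u,u)}$ for $u\in D[\mathcal{E}]$. $A$ is the associated negative definite self-adjoint operator: $D(A)\subset D[\mathcal{E}]$, $\mathcal{E}(u,v)=(-Au,v)$ for $u\in D(A)$, $v\in D[\mathcal{E}]$. $\mathbb{X}=((X_t)_{t\ge0},(P_x)_{x\in E},(\mathcal{F}_t)_{t\ge0},\zeta)$ is the associated symmetric Hunt process with life time $\zeta$; $E_x$ is expectation under $P_x$. For $\alpha\ge0$, $R_\alpha h(x)=E_x\int_0^\zeta e^{-\alpha t}h(X_t)\,dt$, and $R=R_0$. It is assumed that $R_\alpha(x,\cdot)\ll m$ for all $x\in E$, $\alpha>0$. Hence for every $\alpha\ge0$ there is a symmetric Borel kernel $r_\alpha:E\times E\to[0,\infty]$, $\alpha$-excessive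 in each variable, with $R_\alpha h(x)=\int_E h(y)r_\alpha(x,y)\,m(dy)$; put $r=r_0$. For a Borel measure $\mu$, $R\mu(x)=\int_E r(x,y)\,\mu(dy)$ (with the convention that this is $0$ if the integrals with respect to $\mu^+$ and $\mu^-$ are both infinite). "Measurable" functions on $E$ are universally measurable. Capacity: $\mathrm{Cap}(U)=\inf\{\mathcal{E}(u,u):u\in D[\mathcal{E}],\,u\ge\mathbf{1}_U\ m\text{-a.e.}\}$ for open $U$, and $\mathrm{Cap}(B)=\inf\{\mathrm{Cap}(U):B\subset U,\ U\text{ open}\}$ for arbitrary $B\subset E$; "q.e." means outside a set of capacity zero. Borel measures are signed and possibly unbounded, $|\mu|=\mu^++\mu^-$. $\mathbb{M}$ is the class of Borel measures $\mu$ on $E$ with $R|\mu|(x)<\infty$ for q.e. $x\in E$. An excessive function is a positive measurable $\rho$ on $E$ with $\alpha R_\alpha\rho\le\rho$ for every $\alpha>0$ and $\alpha R_\alpha\rho\nearrow\rho$ as $\alpha\to\infty$. $\mathcal{M}_\rho=\{\mu\in\mathbb{M}:\|\mu\|_\rho<\infty\}$, where $\|\mu\|_\rho=\|\rho\cdot\mu\|_{TV}=\int_E\rho\,d|\mu|$. Equation. $f:E\times\mathbb{R}\to\mathbb{R}$ is such that $y\mapsto f(x,y)$ is continuous for every $x$ and $x\mapsto f(x,y)$ is measurable for every $y$. For $\mu\in\mathbb{M}$, a measurable numerical ($[-\infty,\infty]$-valued) function $u$ on $E$ is a solution of $-Au=f(x,u)+\mu$ if $f(\cdot,u)\cdot m\in\mathbb{M}$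 and $u(x)=R(f(\cdot,u))(x)+R\mu(x)$ for q.e. $x\in E$. *)

theory Defs
  imports "HOL-Probability.Probability"
begin

section \<open>Measurability and signed Borel measures\<close>

text \<open>
  The sigma-algebra of universally measurable sets.  Functions that are measurable only in this
  sense are integrated below with \<^const>\<open>nn_integral\<close>, against Borel measures: this gives the
  intended value, because \<^const>\<open>nn_integral\<close> does not change when the measure is completed
  (\<open>nn_integral_completion\<close>).
\<close>

definition universal_borel :: "'a::topological_space measure" where
  "universal_borel =
     sigma UNIV (\<Inter>\<mu>\<in>{\<mu>. sets \<mu> = sets borel \<and> finite_measure \<mu>}. sets (completion \<mu>))"

text \<open>
  A signed, possibly unbounded, Borel measure is given by its Jordan decomposition: a pair of
  mutually singular positive Borel measures, both of which may be infinite.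
\<close>

type_synonym 'a smeasure = "'a measure \<times> 'a measure"

definition signed_borel_measure :: "'a::topological_space smeasure \<Rightarrow> bool" where
  "signed_borel_measure \<mu> \<longleftrightarrow>
     sets (fst \<mu>) = sets borel \<and> sets (snd \<mu>) = sets borel \<and>
     (\<exists>A\<in>sets borel. emeasure (fst \<mu>) (- A) = 0 \<and> emeasure (snd \<mu>) A = 0)"

definition total_variation :: "'a::topological_space smeasure \<Rightarrow> 'a measure" where
  "total_variation \<mu> =
     measure_of UNIV (sets borel) (\<lambda>A. emeasure (fst \<mu>) A + emeasure (snd \<mu>) A)"

text \<open>The measure \<open>h \<cdot> m\<close>; note that \<^const>\<open>ennreal\<close> truncates negative numbers to \<open>0\<close>.\<close>

definition signed_density :: "'a::topological_space measure \<Rightarrow> ('a \<Rightarrow> real) \<Rightarrow> 'a smeasure" where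
  "signed_density m h = (density m (\<lambda>x. ennreal (h x)), density m (\<lambda>x. ennreal (- h x)))"

text \<open>The difference of two integrals, with the convention \<open>\<infinity> - \<infinity> = 0\<close>.\<close>

definition integral_diff :: "ennreal \<Rightarrow> ennreal \<Rightarrow> ereal" where
  "integral_diff a b = (if a = \<infinity> \<and> b = \<infinity> then 0 else enn2ereal a - enn2ereal b)"


section \<open>Symmetric Dirichlet forms\<close>

text \<open>
  Elements of \<open>L\<^sup>2(E;m)\<close> are represented by Borel functions; the domain of a form is saturated with
  respect to equality \<open>m\<close>-almost everywhere, and the form respects that equality.
\<close>

definition L2 :: "'a measure \<Rightarrow> ('a \<Rightarrow> real) set" where
  "L2 m = {u \<in> borel_measurable m. integrable m (\<lambda>x. (u x)\<^sup>2)}"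

definition form1 ::
    "'a measure \<Rightarrow> (('a \<Rightarrow> real) \<Rightarrow> ('a \<Rightarrow> real) \<Rightarrow> real) \<Rightarrow> ('a \<Rightarrow> real) \<Rightarrow> ('a \<Rightarrow> real) \<Rightarrow> real"
  where "form1 m \<E> u v = \<E> u v + (\<integral>x. u x * v x \<partial>m)"

definition Cc :: "('a::topological_space \<Rightarrow> real) set" where
  "Cc = {u. continuous_on UNIV u \<and> compact (closure {x. u x \<noteq> 0})}"

locale radon_space =
  fixes m :: "'a::{metric_space, second_countable_topology} measure"
  assumes locally_compact: "locally_compact_space (euclidean :: 'a topology)"
    and sets_m: "sets m = sets borel"
    and finite_on_compact: "compact K \<Longrightarrow> emeasure m K < \<infinity>"
    and full_support: "open U \<Longrightarrow> U \<noteq> {} \<Longrightarrow> emeasure m U > 0"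

locale dirichlet_form = radon_space m
  for m :: "'a::{metric_space, second_countable_topology} measure" +
  fixes D :: "('a \<Rightarrow> real) set"
    and \<E> :: "('a \<Rightarrow> real) \<Rightarrow> ('a \<Rightarrow> real) \<Rightarrow> real"
  assumes domain_L2: "D \<subseteq> L2 m"
    and domain_zero: "(\<lambda>x. 0) \<in> D"
    and domain_add: "u \<in> D \<Longrightarrow> v \<in> D \<Longrightarrow> (\<lambda>x. u x + v x) \<in> D"
    and domain_scale: "u \<in> D \<Longrightarrow> (\<lambda>x. c * u x) \<in> D"
    and domain_AE:
      "u \<in> D \<Longrightarrow> v \<in> borel_measurable m \<Longrightarrow> (AE x in m. u x = v x) \<Longrightarrow> v \<in> D"
    and domain_dense:
      "h \<in> L2 m \<Longrightarrow> 0 < e \<Longrightarrow> \<exists>u\<in>D. (\<integral>x. (h x - u x)\<^sup>2 \<partial>m) < e"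
    and form_AE:
      "u \<in> D \<Longrightarrow> v \<in> D \<Longrightarrow> w \<in> D \<Longrightarrow> (AE x in m. u x = v x) \<Longrightarrow> \<E> u w = \<E> v w"
    and form_sym: "u \<in> D \<Longrightarrow> v \<in> D \<Longrightarrow> \<E> u v = \<E> v u"
    and form_add:
      "u \<in> D \<Longrightarrow> v \<in> D \<Longrightarrow> w \<in> D \<Longrightarrow> \<E> (\<lambda>x. u x + v x) w = \<E> u w + \<E> v w"
    and form_scale: "u \<in> D \<Longrightarrow> w \<in> D \<Longrightarrow> \<E> (\<lambda>x. c * u x) w = c * \<E> u w"
    and form_nonneg: "u \<in> D \<Longrightarrow> 0 \<le> \<E> u u"
    and form_closed:
      "(\<And>n. U n \<in> D) \<Longrightarrow>
       (\<And>e. 0 < e \<Longrightarrow> \<exists>N. \<forall>i\<ge>N. \<forall>j\<ge>N.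
          form1 m \<E> (\<lambda>x. U i x - U j x) (\<lambda>x. U i x - U j x) < e) \<Longrightarrow>
       \<exists>u\<in>D. (\<lambda>n. form1 m \<E> (\<lambda>x. U n x - u x) (\<lambda>x. U n x - u x)) \<longlonglongrightarrow> 0"
    and form_markov:
      "u \<in> D \<Longrightarrow> (\<lambda>x. min (max (u x) 0) 1) \<in> D \<and>
         \<E> (\<lambda>x. min (max (u x) 0) 1) (\<lambda>x. min (max (u x) 0) 1) \<le> \<E> u u"

locale regular_dirichlet_form = dirichlet_form m D \<E>
  for m :: "'a::{metric_space, second_countable_topology} measure" and D \<E> +
  assumes core_dense_domain:
      "u \<in> D \<Longrightarrow> 0 < e \<Longrightarrow> \<exists>v\<in>D \<inter> Cc. form1 m \<E> (\<lambda>x. u x - v x) (\<lambda>x. u x - v x) < e"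
    and core_dense_Cc:
      "w \<in> Cc \<Longrightarrow> 0 < e \<Longrightarrow> \<exists>v\<in>D \<inter> Cc. \<forall>x. \<bar>w x - v x\<bar> < e"

locale transient_regular_dirichlet_form = regular_dirichlet_form m D \<E>
  for m :: "'a::{metric_space, second_countable_topology} measure" and D \<E> +
  assumes transient:
    "\<exists>g\<in>borel_measurable universal_borel. (\<forall>x. 0 < g x) \<and>
       (\<forall>u\<in>D. (\<integral>\<^sup>+x. ennreal (\<bar>u x\<bar> * g x) \<partial>m) \<le> ennreal (sqrt (\<E> u u)))"

text \<open>\<open>is_generator m D \<E> u w\<close> says that \<open>u \<in> D(A)\<close> and \<open>A u = w\<close>.\<close>

definition is_generator ::
    "'a measure \<Rightarrow> ('a \<Rightarrow> real) set \<Rightarrow> (('a \<Rightarrow> real) \<Rightarrow> ('a \<Rightarrow> real) \<Rightarrow> real) \<Rightarrow>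
     ('a \<Rightarrow> real) \<Rightarrow> ('a \<Rightarrow> real) \<Rightarrow> bool"
  where
  "is_generator m D \<E> u w \<longleftrightarrow>
     u \<in> D \<and> w \<in> L2 m \<and> (\<forall>v\<in>D. \<E> u v = (\<integral>x. - w x * v x \<partial>m))"

text \<open>The capacity of an open set is \<open>\<infinity>\<close> if no admissible function exists.\<close>

definition cap_open ::
    "'a::topological_space measure \<Rightarrow> ('a \<Rightarrow> real) set \<Rightarrow>
     (('a \<Rightarrow> real) \<Rightarrow> ('a \<Rightarrow> real) \<Rightarrow> real) \<Rightarrow> 'a set \<Rightarrow> ennreal"
  where
  "cap_open m D \<E> U = (INF u\<in>{u\<in>D. AE x in m. indicator U x \<le> u x}. ennreal (\<E> u u))"

definition cap ::
    "'a::topological_space measure \<Rightarrow> ('a \<Rightarrow> real) set \<Rightarrow>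
     (('a \<Rightarrow> real) \<Rightarrow> ('a \<Rightarrow> real) \<Rightarrow> real) \<Rightarrow> 'a set \<Rightarrow> ennreal"
  where
  "cap m D \<E> B = (INF U\<in>{U. open U \<and> B \<subseteq> U}. cap_open m D \<E> U)"

definition quasi_everywhere ::
    "'a::topological_space measure \<Rightarrow> ('a \<Rightarrow> real) set \<Rightarrow>
     (('a \<Rightarrow> real) \<Rightarrow> ('a \<Rightarrow> real) \<Rightarrow> real) \<Rightarrow> ('a \<Rightarrow> bool) \<Rightarrow> bool"
  where
  "quasi_everywhere m D \<E> Q \<longleftrightarrow> cap m D \<E> {x. \<not> Q x} = 0"


section \<open>Hunt processes\<close>

text \<open>
  The state space is enlarged by a cemetery point, represented by \<^const>\<open>None\<close>, to the one-point
  compactification of \<open>E\<close> (with an isolated cemetery if \<open>E\<close> is compact).  Time runs through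
  \<open>[0,\<infinity>]\<close>, with the process in the cemetery at time \<open>\<infinity>\<close>.
\<close>

abbreviation cemetery_topology :: "'a::topological_space option topology" where
  "cemetery_topology \<equiv> Alexandroff_compactification euclidean"

definition cemetery_borel :: "'a::topological_space option measure" where
  "cemetery_borel = sigma UNIV {B. Some -` B \<in> sets borel}"

definition lifetime :: "(ennreal \<Rightarrow> 'w \<Rightarrow> 'a option) \<Rightarrow> 'w \<Rightarrow> ennreal" where
  "lifetime X \<omega> = Inf {t. X t \<omega> = None}"

text \<open>
  The strong Markov property is the identity \<open>P\<^sub>x(X\<^bsub>\<sigma>+s\<^esub> \<in> B | F\<^sub>\<sigma>) = P\<^bsub>X\<^sub>\<sigma>\<^esub>(X\<^sub>s \<in> B)\<close>, integrated over
  an arbitrary event of \<open>F\<^sub>\<sigma>\<close>.  Constant times are stopping times, so the simple Markov property is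
  a special case; general initial laws are mixtures of the \<open>P\<^sub>x\<close>.
\<close>

locale hunt_process =
  fixes M :: "'w measure"
    and F :: "ennreal \<Rightarrow> 'w measure"
    and X :: "ennreal \<Rightarrow> 'w \<Rightarrow> 'a::topological_space option"
    and P :: "'a option \<Rightarrow> 'w measure"
  assumes prob: "prob_space (P x)"
    and sets_P: "sets (P x) = sets M"
    and filtration: "filtration (space M) F"
    and filtration_sub: "sets (F t) \<subseteq> sets M"
    and filtration_right_continuous: "t < \<infinity> \<Longrightarrow> sets (F t) = (\<Inter>s\<in>{t<..}. sets (F s))"
    and adapted: "X t \<in> F t \<rightarrow>\<^sub>M cemetery_borel"
    and transition_measurable:
      "B \<in> sets cemetery_borel \<Longrightarrow>
       (\<lambda>x. emeasure (P x) {\<omega>\<in>space M. X t \<omega> \<in> B}) \<in> borel_measurable cemetery_borel"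
    and normal: "AE \<omega> in P x. X 0 \<omega> = x"
    and cemetery_trap: "AE \<omega> in P None. X t \<omega> = None"
    and at_infinity_None: "\<omega> \<in> space M \<Longrightarrow> X \<infinity> \<omega> = None"
    and after_lifetime: "\<omega> \<in> space M \<Longrightarrow> lifetime X \<omega> \<le> t \<Longrightarrow> X t \<omega> = None"
    and shift:
      "\<exists>\<theta>. \<forall>t<\<infinity>. \<forall>\<omega>\<in>space M. \<theta> t \<omega> \<in> space M \<and> (\<forall>s. X s (\<theta> t \<omega>) = X (t + s) \<omega>)"
    and paths_right_continuous:
      "\<omega> \<in> space M \<Longrightarrow> t < \<infinity> \<Longrightarrow>
       limitin cemetery_topology (\<lambda>s. X s \<omega>) (X t \<omega>) (at_right t)"
    and paths_left_limits:
      "\<omega> \<in> space M \<Longrightarrow> 0 < t \<Longrightarrow> t < \<infinity> \<Longrightarrow>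
       \<exists>l. limitin cemetery_topology (\<lambda>s. X s \<omega>) l (at_left t)"
    and strong_markov:
      "stopping_time F \<sigma> \<Longrightarrow> \<Lambda> \<in> sets (filtration.pre_sigma (space M) F \<sigma>) \<Longrightarrow>
       B \<in> sets cemetery_borel \<Longrightarrow>
       emeasure (P x) {\<omega>\<in>\<Lambda>. X (\<sigma> \<omega> + s) \<omega> \<in> B} =
       (\<integral>\<^sup>+\<omega>. emeasure (P (X (\<sigma> \<omega>) \<omega>)) {\<omega>'\<in>space M. X s \<omega>' \<in> B} * indicator \<Lambda> \<omega> \<partial>P x)"
    and quasi_left_continuous:
      "(\<And>n. stopping_time F (\<tau> n)) \<Longrightarrow> stopping_time F \<sigma> \<Longrightarrow>
       (\<And>\<omega>. \<omega> \<in> space M \<Longrightarrow> incseq (\<lambda>n. \<tau> n \<omega>) \<and> (\<lambda>n. \<tau> n \<omega>) \<longlonglongrightarrow> \<sigma> \<omega>) \<Longrightarrow>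
       AE \<omega> in P x. \<sigma> \<omega> < \<infinity> \<longrightarrow>
         limitin cemetery_topology (\<lambda>n. X (\<tau> n \<omega>) \<omega>) (X (\<sigma> \<omega>) \<omega>) sequentially"

definition resolvent ::
    "(ennreal \<Rightarrow> 'w \<Rightarrow> 'a option) \<Rightarrow> ('a option \<Rightarrow> 'w measure) \<Rightarrow>
     real \<Rightarrow> ('a \<Rightarrow> ennreal) \<Rightarrow> 'a \<Rightarrow> ennreal"
  where
  "resolvent X P \<alpha> h x =
     (\<integral>\<^sup>+\<omega>. (\<integral>\<^sup>+t. ennreal (exp (- \<alpha> * t)) * h (the (X (ennreal t) \<omega>)) *
        indicator {t. 0 \<le> t \<and> ennreal t < lifetime X \<omega>} t \<partial>lborel) \<partial>P (Some x))"

definition signed_resolvent ::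
    "(ennreal \<Rightarrow> 'w \<Rightarrow> 'a option) \<Rightarrow> ('a option \<Rightarrow> 'w measure) \<Rightarrow>
     real \<Rightarrow> ('a \<Rightarrow> real) \<Rightarrow> 'a \<Rightarrow> ereal"
  where
  "signed_resolvent X P \<alpha> h x =
     integral_diff (resolvent X P \<alpha> (\<lambda>y. ennreal (h y)) x)
       (resolvent X P \<alpha> (\<lambda>y. ennreal (- h y)) x)"

text \<open>\<open>\<alpha>\<close>-excessive functions; the excessive functions are the case \<open>\<alpha> = 0\<close>.\<close>

definition excessive ::
    "(ennreal \<Rightarrow> 'w \<Rightarrow> 'a::topological_space option) \<Rightarrow> ('a option \<Rightarrow> 'w measure) \<Rightarrow>
     real \<Rightarrow> ('a \<Rightarrow> ennreal) \<Rightarrow> bool"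
  where
  "excessive X P \<alpha> h \<longleftrightarrow>
     h \<in> borel_measurable universal_borel \<and>
     (\<forall>\<beta>>0. \<forall>x. ennreal \<beta> * resolvent X P (\<alpha> + \<beta>) h x \<le> h x) \<and>
     (\<forall>x. mono_on {0<..} (\<lambda>\<beta>. ennreal \<beta> * resolvent X P (\<alpha> + \<beta>) h x)) \<and>
     (\<forall>x. ((\<lambda>\<beta>. ennreal \<beta> * resolvent X P (\<alpha> + \<beta>) h x) \<longlongrightarrow> h x) at_top)"


section \<open>The setting\<close>

text \<open>
  The process is associated with the form when \<open>R\<^sub>\<alpha> h\<close> is a version of \<open>(\<alpha> - A)\<^sup>-\<^sup>1 h\<close>, that is, when
  \<open>A (R\<^sub>\<alpha> h) = \<alpha> R\<^sub>\<alpha> h - h\<close>.  The kernels \<open>r \<alpha>\<close> exist, and are unique, under absolute continuity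
  of the resolvent; they are carried as a parameter with their defining properties.
\<close>

locale dirichlet_hunt_setting =
  transient_regular_dirichlet_form m D \<E> + hunt_process M F X P
  for m :: "'a::{metric_space, second_countable_topology} measure"
    and D :: "('a \<Rightarrow> real) set"
    and \<E> :: "('a \<Rightarrow> real) \<Rightarrow> ('a \<Rightarrow> real) \<Rightarrow> real"
    and M :: "'w measure"
    and F :: "ennreal \<Rightarrow> 'w measure"
    and X :: "ennreal \<Rightarrow> 'w \<Rightarrow> 'a option"
    and P :: "'a option \<Rightarrow> 'w measure" +
  fixes r :: "real \<Rightarrow> 'a \<Rightarrow> 'a \<Rightarrow> ennreal"
  assumes associated:
      "0 < \<alpha> \<Longrightarrow> h \<in> L2 m \<Longrightarrow> (\<And>x. 0 \<le> h x) \<Longrightarrow>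
       \<exists>v. is_generator m D \<E> v (\<lambda>x. \<alpha> * v x - h x) \<and>
           (AE x in m. 0 \<le> v x \<and> resolvent X P \<alpha> (\<lambda>y. ennreal (h y)) x = ennreal (v x))"
    and resolvent_absolutely_continuous:
      "0 < \<alpha> \<Longrightarrow> B \<in> null_sets m \<Longrightarrow> resolvent X P \<alpha> (indicator B) x = 0"
    and kernel_measurable:
      "0 \<le> \<alpha> \<Longrightarrow> (\<lambda>(x, y). r \<alpha> x y) \<in> borel_measurable (borel \<Otimes>\<^sub>M borel)"
    and kernel_symmetric: "0 \<le> \<alpha> \<Longrightarrow> r \<alpha> x y = r \<alpha> y x"
    and kernel_excessive_left: "0 \<le> \<alpha> \<Longrightarrow> excessive X P \<alpha> (\<lambda>x. r \<alpha> x y)"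
    and kernel_excessive_right: "0 \<le> \<alpha> \<Longrightarrow> excessive X P \<alpha> (\<lambda>y. r \<alpha> x y)"
    and kernel_resolvent:
      "0 \<le> \<alpha> \<Longrightarrow> h \<in> borel_measurable universal_borel \<Longrightarrow>
       resolvent X P \<alpha> h x = (\<integral>\<^sup>+y. h y * r \<alpha> x y \<partial>m)"

definition potential ::
    "(real \<Rightarrow> 'a \<Rightarrow> 'a \<Rightarrow> ennreal) \<Rightarrow> 'a smeasure \<Rightarrow> 'a \<Rightarrow> ereal"
  where
  "potential r \<mu> x = integral_diff (\<integral>\<^sup>+y. r 0 x y \<partial>fst \<mu>) (\<integral>\<^sup>+y. r 0 x y \<partial>snd \<mu>)"

text \<open>The class \<open>\<MM>\<close> of Borel measures whose total variation has a q.e. finite potential.\<close>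

definition potential_class ::
    "'a::topological_space measure \<Rightarrow> ('a \<Rightarrow> real) set \<Rightarrow>
     (('a \<Rightarrow> real) \<Rightarrow> ('a \<Rightarrow> real) \<Rightarrow> real) \<Rightarrow> (real \<Rightarrow> 'a \<Rightarrow> 'a \<Rightarrow> ennreal) \<Rightarrow> 'a smeasure set"
  where
  "potential_class m D \<E> r =
     {\<mu>. signed_borel_measure \<mu> \<and>
         quasi_everywhere m D \<E> (\<lambda>x. (\<integral>\<^sup>+y. r 0 x y \<partial>total_variation \<mu>) < \<infinity>)}"

definition weighted_tv_norm :: "('a::topological_space \<Rightarrow> ennreal) \<Rightarrow> 'a smeasure \<Rightarrow> ennreal" where
  "weighted_tv_norm \<rho> \<mu> = (\<integral>\<^sup>+x. \<rho> x \<partial>total_variation \<mu>)"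

definition weighted_class ::
    "'a::topological_space measure \<Rightarrow> ('a \<Rightarrow> real) set \<Rightarrow>
     (('a \<Rightarrow> real) \<Rightarrow> ('a \<Rightarrow> real) \<Rightarrow> real) \<Rightarrow> (real \<Rightarrow> 'a \<Rightarrow> 'a \<Rightarrow> ennreal) \<Rightarrow>
     ('a \<Rightarrow> ennreal) \<Rightarrow> 'a smeasure set"
  where
  "weighted_class m D \<E> r \<rho> = {\<mu> \<in> potential_class m D \<E> r. weighted_tv_norm \<rho> \<mu> < \<infinity>}"

text \<open>The norm of \<open>L\<^sup>1(E; \<rho> \<cdot> m)\<close>, with value \<open>\<infinity>\<close> for functions outside that space.\<close>

definition weighted_L1_norm ::
    "'a measure \<Rightarrow> ('a \<Rightarrow> ennreal) \<Rightarrow> ('a \<Rightarrow> real) \<Rightarrow> ennreal"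
  where
  "weighted_L1_norm m \<rho> h = (\<integral>\<^sup>+x. \<rho> x * ennreal \<bar>h x\<bar> \<partial>m)"

definition weighted_L1 ::
    "'a::topological_space measure \<Rightarrow> ('a \<Rightarrow> ennreal) \<Rightarrow> ('a \<Rightarrow> real) set"
  where
  "weighted_L1 m \<rho> = {h \<in> borel_measurable universal_borel. weighted_L1_norm m \<rho> h < \<infinity>}"

definition caratheodory :: "('a::topological_space \<Rightarrow> real \<Rightarrow> real) \<Rightarrow> bool" where
  "caratheodory f \<longleftrightarrow>
     (\<forall>x. continuous_on UNIV (f x)) \<and> (\<forall>y. (\<lambda>x. f x y) \<in> borel_measurable universal_borel)"

text \<open>
  The function \<open>f\<^sub>u(x) = f(x, u(x))\<close>.  A solution is finite quasi-everywhere, hence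
  \<open>m\<close>-almost everywhere, so the value used where \<open>u\<close> is infinite is immaterial.
\<close>

definition composed :: "('a \<Rightarrow> real \<Rightarrow> real) \<Rightarrow> ('a \<Rightarrow> ereal) \<Rightarrow> 'a \<Rightarrow> real" where
  "composed f u x = f x (real_of_ereal (u x))"

definition is_solution ::
    "'a::topological_space measure \<Rightarrow> ('a \<Rightarrow> real) set \<Rightarrow>
     (('a \<Rightarrow> real) \<Rightarrow> ('a \<Rightarrow> real) \<Rightarrow> real) \<Rightarrow>
     (ennreal \<Rightarrow> 'w \<Rightarrow> 'a option) \<Rightarrow> ('a option \<Rightarrow> 'w measure) \<Rightarrow>
     (real \<Rightarrow> 'a \<Rightarrow> 'a \<Rightarrow> ennreal) \<Rightarrow>
     ('a \<Rightarrow> real \<Rightarrow> real) \<Rightarrow> 'a smeasure \<Rightarrow> ('a \<Rightarrow> ereal) \<Rightarrow> bool"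
  where
  "is_solution m D \<E> X P r f \<mu> u \<longleftrightarrow>
     u \<in> borel_measurable universal_borel \<and>
     signed_density m (composed f u) \<in> potential_class m D \<E> r \<and>
     quasi_everywhere m D \<E>
       (\<lambda>x. u x = signed_resolvent X P 0 (composed f u) x + potential r \<mu> x)"

end

theory Submission
  imports Defs
begin

text \<open>
  Write \<open>g = f\<^sub>u\<close>, so that \<open>u = R(g m + \<mu>)\<close>.  By monotonicity of \<open>f\<close>, \<open>\<bar>g\<bar> \<le> - g sgn(u) + 2 \<bar>f(\<cdot>, 0)\<bar>\<close>, and it
  remains to show \<open>- \<integral> \<eta> g sgn(u) dm \<le> \<integral> \<rho> d\<bar>\<mu>\<bar>\<close> for weights \<open>\<eta>\<close> increasing to \<open>\<rho>\<close>.  The resolvent equation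
  gives \<open>u = R\<^sub>\<gamma>(g m + \<mu>) + \<gamma> R\<^sub>\<gamma> u\<close> with \<open>\<gamma> = \<beta> + a\<close>, hence Kato's inequality
  \<open>sgn(u) R\<^sub>\<gamma>(g m + \<mu>) \<ge> \<bar>u\<bar> - \<gamma> R\<^sub>\<gamma> \<bar>u\<bar>\<close>.  Integrated against \<open>a \<eta>\<close>, where \<open>\<eta> = min \<rho> (R\<^sub>\<beta> k)\<close> satisfies
  \<open>a R\<^sub>\<gamma> \<eta> \<le> \<eta>\<close>, the right-hand side is at least \<open>- \<beta> \<integral> \<eta> \<bar>u\<bar> dm\<close>.  By symmetry of the kernel the resolvent can be
  moved to \<open>\<eta> sgn(u)\<close>: the \<open>\<mu>\<close>-part is bounded by \<open>\<integral> \<rho> d\<bar>\<mu>\<bar>\<close> because \<open>\<rho>\<close> is excessive, and the \<open>g\<close>-part converges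
  as \<open>a \<rightarrow> \<infinity>\<close> by strong continuity of the resolvent in \<open>L\<^sup>2\<close>.  Finally \<open>\<beta> \<integral> \<eta> \<bar>u\<bar> dm \<rightarrow> 0\<close> as \<open>\<beta> \<rightarrow> 0\<close>, and replacing
  \<open>k\<close> by \<open>n k\<close> lets \<open>\<eta>\<close> increase to \<open>\<rho>\<close>.
\<close>

section \<open>Universally measurable functions and total variation\<close>

lemma density_cong_AE:
  assumes "AE x in N. h x = h' x"
  shows "density N h = density N h'"
  unfolding density_def using assms
  by (intro arg_cong2[where f="measure_of (space N)"] refl ext nn_integral_cong_AE)
    (auto elim!: eventually_mono)

lemma sigma_finite_measure_if_positive_integrable:
  fixes h :: "'b \<Rightarrow> ennreal"
  assumes h[measurable]: "h \<in> borel_measurable N" and pos: "\<And>x. x \<in> space N \<Longrightarrow> 0 < h x"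
    and fin: "(\<integral>\<^sup>+x. h x \<partial>N) < \<infinity>"
  shows "sigma_finite_measure N"
proof -
  define S where "S n = {x\<in>space N. 1 \<le> of_nat (Suc n) * h x}" for n
  have S[measurable]: "S n \<in> sets N" for n
    unfolding S_def by measurable
  have fin_S: "emeasure N (S n) \<noteq> \<infinity>" for n
  proof -
    have "emeasure N (S n) = (\<integral>\<^sup>+x. indicator (S n) x \<partial>N)" by simp
    also have "\<dots> \<le> (\<integral>\<^sup>+x. of_nat (Suc n) * h x \<partial>N)"
      by (intro nn_integral_mono) (auto simp: S_def split: split_indicator)
    also have "\<dots> = of_nat (Suc n) * (\<integral>\<^sup>+x. h x \<partial>N)"
      by (rule nn_integral_cmult) simp
    also have "\<dots> < \<infinity>"
      using fin by (simp add: ennreal_mult_less_top of_nat_less_top)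
    finally show ?thesis by simp
  qed
  have "x \<in> (\<Union>n. S n)" if x: "x \<in> space N" for x
  proof (cases "h x = \<infinity>")
    case True
    then show ?thesis using x by (auto simp: S_def ennreal_mult_top)
  next
    case False
    then obtain a where a: "h x = ennreal a" "0 < a"
      using pos[OF x] by (cases "h x") auto
    obtain n where "1 / a < real n" using reals_Archimedean2 by blast
    then have "1 \<le> real (Suc n) * a" using a by (simp add: field_simps)
    then have "1 \<le> of_nat (Suc n) * h x"
      using a by (simp add: ennreal_of_nat_eq_real_of_nat ennreal_mult[symmetric] del: of_nat_Suc)
    then show ?thesis using x by (auto simp: S_def)
  qed
  then have "(\<Union>n. S n) = space N"
    by (auto simp: S_def)
  then show ?thesis
    using fin_S S
    by (intro sigma_finite_measure.intro exI[of _ "range S"]) auto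
qed

lemma sets_borel_subset_universal_borel: "sets borel \<subseteq> sets universal_borel"
proof -
  have "A \<in> sets (completion \<mu>)" if "A \<in> sets borel" "sets \<mu> = sets borel" for A :: "'a set" and \<mu>
    using that by (auto intro: sets_completionI_sets)
  then show ?thesis
    unfolding universal_borel_def by (subst sets_measure_of) (auto intro!: sigma_sets.Basic)
qed

lemma borel_measurable_universal_borel:
  assumes "h \<in> borel_measurable borel"
  shows "h \<in> borel_measurable universal_borel"
  using assms sets_borel_subset_universal_borel
  by (auto simp: measurable_def universal_borel_def)

lemma universal_borel_AE_eq_borel_finite:
  fixes h :: "'a::topological_space \<Rightarrow> ennreal"
  assumes h: "h \<in> borel_measurable universal_borel"
    and N: "finite_measure N" "sets N = sets borel"
  shows "\<exists>h'\<in>borel_measurable borel. AE x in N. h x = h' x"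
proof -
  have sp: "space N = UNIV" using sets_eq_imp_space_eq[OF N(2)] by simp
  have "sets universal_borel \<subseteq> sets (completion N)"
  proof -
    have "(\<Inter>\<mu>\<in>{\<mu>. sets \<mu> = sets borel \<and> finite_measure \<mu>}. sets (completion \<mu>)) \<subseteq> sets (completion N)"
      using N by blast
    from sets.sigma_sets_subset[OF this] show ?thesis
      unfolding universal_borel_def using sp by (subst sets_measure_of) auto
  qed
  then have "h \<in> borel_measurable (completion N)"
    using h sp by (auto simp: measurable_def universal_borel_def)
  from completion_ex_borel_measurable[OF this] show ?thesis
    using measurable_cong_sets[OF N(2) refl] by auto
qed

lemma universal_borel_AE_eq_borel:
  fixes h :: "'a::topological_space \<Rightarrow> ennreal"
  assumes h: "h \<in> borel_measurable universal_borel"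
    and N: "sigma_finite_measure N" "sets N = sets borel"
  obtains h' where "h' \<in> borel_measurable borel" "AE x in N. h x = h' x"
proof -
  obtain k where k[measurable]: "k \<in> borel_measurable N" "integral\<^sup>N N k \<noteq> \<infinity>" "\<And>x. x \<in> space N \<Longrightarrow> 0 < k x"
    using sigma_finite_measure.Ex_finite_integrable_function[OF N(1)] by blast
  have "finite_measure (density N k)"
    using k by (intro finite_measureI) (simp add: emeasure_density cong: nn_integral_cong)
  from universal_borel_AE_eq_borel_finite[OF h this] N(2)
  obtain h' where "h' \<in> borel_measurable borel" "AE x in density N k. h x = h' x"
    by auto
  moreover from this(2) have "AE x in N. h x = h' x"
    using k(3) by (simp add: AE_density)
  ultimately show ?thesis using that by blast
qed

lemma caratheodory_comp_measurable:
  fixes f :: "'a \<Rightarrow> real \<Rightarrow> real"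
  assumes cont: "\<And>x. continuous_on UNIV (f x)"
    and meas: "\<And>y. (\<lambda>x. f x y) \<in> borel_measurable N"
    and v[measurable]: "v \<in> borel_measurable N"
  shows "(\<lambda>x. f x (v x)) \<in> borel_measurable N"
proof (rule borel_measurable_LIMSEQ_real)
  define a where "a n x = real_of_int \<lfloor>v x * real (Suc n)\<rfloor> / real (Suc n)" for n x
  show "(\<lambda>n. f x (a n x)) \<longlonglongrightarrow> f x (v x)" for x
  proof -
    have "(\<lambda>n. a n x) \<longlonglongrightarrow> v x"
    proof (rule real_tendsto_sandwich)
      show "\<forall>\<^sub>F n in sequentially. v x - 1 / real (Suc n) \<le> a n x"
      proof (intro always_eventually allI)
        fix n
        have "v x * real (Suc n) - 1 \<le> real_of_int \<lfloor>v x * real (Suc n)\<rfloor>" by linarith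
        then show "v x - 1 / real (Suc n) \<le> a n x"
          unfolding a_def by (subst le_divide_eq) (simp add: left_diff_distrib del: of_nat_Suc)
      qed
      show "\<forall>\<^sub>F n in sequentially. a n x \<le> v x"
        unfolding a_def by (intro always_eventually allI) (simp add: divide_le_eq del: of_nat_Suc)
      show "(\<lambda>n. v x - 1 / real (Suc n)) \<longlonglongrightarrow> v x"
        using tendsto_diff[OF tendsto_const[of "v x"] LIMSEQ_inverse_real_of_nat]
        by (simp add: inverse_eq_divide)
    qed simp
    then show ?thesis
      using cont[of x] by (auto intro: continuous_on_tendsto_compose)
  qed
  show "(\<lambda>x. f x (a n x)) \<in> borel_measurable N" for n
    unfolding a_def
    by (rule measurable_compose_countable[where g="\<lambda>x. \<lfloor>v x * real (Suc n)\<rfloor>"])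
      (use meas in measurable)
qed

lemma
  fixes a b :: "'a::topological_space measure"
  assumes a: "sets a = sets borel" and b: "sets b = sets borel"
  shows sets_total_variation: "sets (total_variation (a, b)) = sets borel"
    and emeasure_total_variation:
      "A \<in> sets borel \<Longrightarrow> emeasure (total_variation (a, b)) A = emeasure a A + emeasure b A"
proof -
  show s: "sets (total_variation (a, b)) = sets borel"
    unfolding total_variation_def using sets.sigma_sets_eq[of "borel :: 'a measure"] by simp
  assume A: "A \<in> sets borel"
  have "countably_additive (sets borel) (\<lambda>A. emeasure a A + emeasure b A)"
  proof (rule countably_additiveI)
    fix S :: "nat \<Rightarrow> 'a set" assume S: "range S \<subseteq> sets borel" "disjoint_family S"
    have "(\<Sum>i. emeasure a (S i) + emeasure b (S i)) = (\<Sum>i. emeasure a (S i)) + (\<Sum>i. emeasure b (S i))"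
      by (rule suminf_add[symmetric]) auto
    then show "(\<Sum>i. emeasure a (S i) + emeasure b (S i)) = emeasure a (\<Union> (range S)) + emeasure b (\<Union> (range S))"
      using S a b by (simp add: suminf_emeasure)
  qed
  then show "emeasure (total_variation (a, b)) A = emeasure a A + emeasure b A"
    unfolding total_variation_def
    using A sets.sigma_algebra_axioms[of "borel :: 'a measure"]
    by (subst emeasure_measure_of_sigma) (auto simp: positive_def)
qed

lemma nn_integral_total_variation:
  fixes a b :: "'a::topological_space measure"
  assumes a: "sets a = sets borel" and b: "sets b = sets borel"
    and h: "h \<in> borel_measurable borel"
  shows "(\<integral>\<^sup>+x. h x \<partial>total_variation (a, b)) = (\<integral>\<^sup>+x. h x \<partial>a) + (\<integral>\<^sup>+x. h x \<partial>b)"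
proof -
  note s = sets_total_variation[OF a b]
  have ba: "borel_measurable a = borel_measurable borel" for u :: "'a \<Rightarrow> ennreal"
    using a by (rule measurable_cong_sets) simp
  have bb: "borel_measurable b = borel_measurable borel" for u :: "'a \<Rightarrow> ennreal"
    using b by (rule measurable_cong_sets) simp
  have bt: "borel_measurable (total_variation (a, b)) = borel_measurable borel" for u :: "'a \<Rightarrow> ennreal"
    using s by (rule measurable_cong_sets) simp
  show ?thesis using h
  proof (induction rule: borel_measurable_induct)
    case (cong f g)
    then have "f = g" by auto
    then show ?case using cong by simp
  next
    case (set A)
    then show ?case using a b s by (simp add: emeasure_total_variation)
  next
    case (mult u c)
    then show ?case by (simp add: nn_integral_cmult ba bb bt distrib_left)
  next
    case (add u v)
    then show ?case by (simp add: nn_integral_add ba bb bt ac_simps)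
  next
    case (seq U)
    have "(SUP i. integral\<^sup>N a (U i) + integral\<^sup>N b (U i)) = (SUP i. integral\<^sup>N a (U i)) + (SUP i. integral\<^sup>N b (U i))"
      using seq by (intro ennreal_SUP_add) (auto simp: incseq_def le_fun_def intro!: nn_integral_mono)
    then show ?case
      using seq by (simp add: nn_integral_monotone_convergence_SUP ba bb bt image_comp)
  qed
qed

lemma sigma_finite_total_variation:
  fixes a b :: "'a::topological_space measure"
  assumes a: "sets a = sets borel" "sigma_finite_measure a"
    and b: "sets b = sets borel" "sigma_finite_measure b"
  shows "sigma_finite_measure (total_variation (a, b))"
proof -
  have sp: "space a = UNIV" "space b = UNIV"
    using sets_eq_imp_space_eq[OF a(1)] sets_eq_imp_space_eq[OF b(1)] by auto
  obtain h where h: "h \<in> borel_measurable a" "integral\<^sup>N a h \<noteq> \<infinity>" "\<And>x. 0 < h x"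
    using sigma_finite_measure.Ex_finite_integrable_function[OF a(2)] sp by auto
  obtain k where k: "k \<in> borel_measurable b" "integral\<^sup>N b k \<noteq> \<infinity>" "\<And>x. 0 < k x"
    using sigma_finite_measure.Ex_finite_integrable_function[OF b(2)] sp by auto
  have hb[measurable]: "h \<in> borel_measurable borel" "k \<in> borel_measurable borel"
    using h(1) k(1) measurable_cong_sets[OF a(1) refl] measurable_cong_sets[OF b(1) refl] by auto
  have le: "(\<integral>\<^sup>+x. min (h x) (k x) \<partial>a) \<le> integral\<^sup>N a h" "(\<integral>\<^sup>+x. min (h x) (k x) \<partial>b) \<le> integral\<^sup>N b k"
    by (auto intro!: nn_integral_mono)
  show ?thesis
  proof (rule sigma_finite_measure_if_positive_integrable[of "\<lambda>x. min (h x) (k x)"])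
    show "(\<lambda>x. min (h x) (k x)) \<in> borel_measurable (total_variation (a, b))"
      by (simp add: measurable_cong_sets[OF sets_total_variation[OF a(1) b(1)] refl])
    show "(\<integral>\<^sup>+x. min (h x) (k x) \<partial>total_variation (a, b)) < \<infinity>"
      using le h(2) k(2)
      by (subst nn_integral_total_variation[OF a(1) b(1)])
        (auto simp: less_top[symmetric] top_unique)
  qed (use h k in auto)
qed

section \<open>Radon spaces and capacity\<close>

context radon_space
begin

lemma compact_neighbourhood:
  fixes x :: 'a
  assumes "open U" "x \<in> U"
  obtains V K where "open V" "x \<in> V" "V \<subseteq> K" "compact K" "K \<subseteq> U"
proof -
  obtain W L where W: "open W" "compact L" "x \<in> W" "W \<subseteq> L"
    using locally_compact unfolding locally_compact_space_def by simp blast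
  obtain e where e: "0 < e" "cball x e \<subseteq> U"
    using assms open_contains_cball by blast
  show ?thesis
  proof (rule that[of "W \<inter> ball x e" "L \<inter> cball x e"])
    show "compact (L \<inter> cball x e)" using W by (intro compact_Int_closed) auto
  qed (use W e in auto)
qed

lemma sigma_finite_m: "sigma_finite_measure m"
proof -
  obtain B :: "'a set set" where B: "countable B" "topological_basis B"
    using ex_countable_basis by blast
  define C where "C = {V\<in>B. \<exists>K. compact K \<and> V \<subseteq> K}"
  have sp: "space m = UNIV" using sets_eq_imp_space_eq[OF sets_m] by simp
  have "x \<in> \<Union>C" for x
  proof -
    obtain V K where V: "open V" "x \<in> V" "V \<subseteq> K" "compact K"
      using compact_neighbourhood[of UNIV x] by auto
    obtain V' where "V' \<in> B" "x \<in> V'" "V' \<subseteq> V"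
      using topological_basisE[OF B(2) V(1,2)] by blast
    then show ?thesis using V by (auto simp: C_def)
  qed
  moreover have "emeasure m V \<noteq> \<infinity>" if V: "V \<in> C" for V
  proof -
    obtain K where K: "compact K" "V \<subseteq> K" using V by (auto simp: C_def)
    have "emeasure m V \<le> emeasure m K"
      using K sets_m by (intro emeasure_mono) (auto intro: borel_compact)
    then show ?thesis using finite_on_compact[OF K(1)] by (auto simp: top_unique)
  qed
  moreover have "C \<subseteq> sets m"
    using topological_basis_open[OF B(2)] sets_m by (auto simp: C_def)
  moreover have "countable C" using B(1) by (auto simp: C_def)
  ultimately show ?thesis
    using sp by (intro sigma_finite_measure.intro exI[of _ C]) auto
qed

lemma universal_borel_AE_eq:
  fixes h :: "'a \<Rightarrow> ennreal"
  assumes "h \<in> borel_measurable universal_borel"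
  obtains h' where "h' \<in> borel_measurable borel" "AE x in m. h x = h' x"
  using universal_borel_AE_eq_borel[OF assms sigma_finite_m sets_m] .

lemma borel_measurable_m: "borel_measurable m = borel_measurable borel"
  by (rule measurable_cong_sets[OF sets_m refl])

lemma total_variation_density:
  assumes g: "g \<in> borel_measurable borel" "AE x in m. g x < \<infinity>"
    and \<mu>: "sigma_finite_measure \<mu>" "sets \<mu> = sets borel"
  shows "sigma_finite_measure (total_variation (density m g, \<mu>))"
    and "sets (total_variation (density m g, \<mu>)) = sets borel"
proof -
  have dens: "sets (density m g) = sets borel" by (simp add: sets_m)
  have "sigma_finite_measure (density m g)"
    using g sigma_finite_measure.sigma_finite_iff_density_finite[OF sigma_finite_m]
    by (auto simp: borel_measurable_m less_top elim!: eventually_mono)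
  then show "sigma_finite_measure (total_variation (density m g, \<mu>))"
    by (rule sigma_finite_total_variation[OF dens _ \<mu>(2,1)])
  show "sets (total_variation (density m g, \<mu>)) = sets borel"
    by (rule sets_total_variation[OF dens \<mu>(2)])
qed

end

lemma (in transient_regular_dirichlet_form) quasi_everywhere_imp_AE:
  assumes "quasi_everywhere m D \<E> Q"
  shows "AE x in m. Q x"
proof -
  obtain g :: "'a \<Rightarrow> real" where g: "g \<in> borel_measurable universal_borel" "\<And>x. 0 < g x"
    "\<And>u. u \<in> D \<Longrightarrow> (\<integral>\<^sup>+x. ennreal (\<bar>u x\<bar> * g x) \<partial>m) \<le> ennreal (sqrt (\<E> u u))"
    using transient by blast
  from g(1) have "(\<lambda>x. ennreal (g x)) \<in> borel_measurable universal_borel" by measurable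
  then obtain g' where g': "g' \<in> borel_measurable borel" "AE x in m. ennreal (g x) = g' x"
    by (rule universal_borel_AE_eq)
  have "\<exists>U. open U \<and> {x. \<not> Q x} \<subseteq> U \<and> (\<integral>\<^sup>+x. indicator U x * g' x \<partial>m) \<le> ennreal (sqrt (1 / real (Suc n)))" for n
  proof -
    have "cap m D \<E> {x. \<not> Q x} < ennreal (1 / real (Suc n))"
      using assms by (simp add: quasi_everywhere_def)
    then obtain U where U: "open U" "{x. \<not> Q x} \<subseteq> U" "cap_open m D \<E> U < ennreal (1 / real (Suc n))"
      unfolding cap_def INF_less_iff by auto
    then obtain u where u: "u \<in> D" "AE x in m. indicator U x \<le> u x" "ennreal (\<E> u u) < ennreal (1 / real (Suc n))"
      unfolding cap_open_def INF_less_iff by auto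
    from u(2) g'(2) have "AE x in m. indicator U x * g' x \<le> ennreal (\<bar>u x\<bar> * g x)"
    proof eventually_elim
      case (elim x)
      have "indicator U x * g' x = ennreal (indicator U x * g x)"
        using elim(2) by (auto simp: indicator_def)
      also have "\<dots> \<le> ennreal (\<bar>u x\<bar> * g x)"
        using elim(1) g(2)[of x] by (intro ennreal_leI mult_right_mono) auto
      finally show ?case .
    qed
    then have "(\<integral>\<^sup>+x. indicator U x * g' x \<partial>m) \<le> (\<integral>\<^sup>+x. ennreal (\<bar>u x\<bar> * g x) \<partial>m)"
      by (rule nn_integral_mono_AE)
    also have "\<dots> \<le> ennreal (sqrt (\<E> u u))" by (rule g(3)[OF u(1)])
    also have "\<dots> \<le> ennreal (sqrt (1 / real (Suc n)))"
      using u(3) by (intro ennreal_leI real_sqrt_le_mono) (simp add: ennreal_less_iff form_nonneg u)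
    finally show ?thesis using U by blast
  qed
  then obtain U where U: "\<And>n. open (U n)" "\<And>n. {x. \<not> Q x} \<subseteq> U n"
    "\<And>n. (\<integral>\<^sup>+x. indicator (U n) x * g' x \<partial>m) \<le> ennreal (sqrt (1 / real (Suc n)))" by metis
  define G where "G = (\<Inter>n. U n)"
  have G: "G \<in> sets borel" unfolding G_def using U(1) by auto
  have le: "(\<integral>\<^sup>+x. indicator G x * g' x \<partial>m) \<le> ennreal (sqrt (1 / real (Suc n)))" for n
    by (rule order_trans[OF nn_integral_mono U(3)]) (auto simp: G_def split: split_indicator)
  have "(\<lambda>n. ennreal (sqrt (1 / real (Suc n)))) \<longlonglongrightarrow> ennreal (sqrt 0)"
    using LIMSEQ_inverse_real_of_nat
    by (intro tendsto_ennrealI tendsto_real_sqrt) (simp add: inverse_eq_divide)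
  then have "(\<integral>\<^sup>+x. indicator G x * g' x \<partial>m) \<le> ennreal (sqrt 0)"
    by (rule tendsto_lowerbound) (intro always_eventually allI le, simp)
  then have "(\<integral>\<^sup>+x. indicator G x * g' x \<partial>m) = 0" by simp
  moreover have "(\<lambda>x. indicator G x * g' x) \<in> borel_measurable m"
    unfolding borel_measurable_m using G g'(1) by measurable
  ultimately have "AE x in m. indicator G x * g' x = 0"
    by (simp add: nn_integral_0_iff_AE)
  with g'(2) show ?thesis
  proof eventually_elim
    case (elim x)
    have "0 < g' x" using g(2)[of x] elim(1) by (metis ennreal_less_zero_iff)
    then have "x \<notin> G" using elim(2) by (auto simp: indicator_def split: if_splits)
    then show ?case using U(2) by (auto simp: G_def)
  qed
qed

section \<open>Joint measurability of the process\<close>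

context dirichlet_hunt_setting
begin

lemma space_P: "space (P x) = space M"
  by (rule sets_eq_imp_space_eq[OF sets_P])

lemma Some_image_cemetery_borel: "B \<in> sets borel \<Longrightarrow> Some ` B \<in> sets cemetery_borel"
  unfolding cemetery_borel_def
  by (subst sets_measure_of) (auto intro!: sigma_sets.Basic simp: inj_vimage_image_eq)

lemma measurable_X: "X t \<in> M \<rightarrow>\<^sub>M cemetery_borel"
proof -
  have "space (F t) = space M"
    using filtration by (rule filtration.space_F)
  then show ?thesis
    using adapted[of t] filtration_sub[of t] by (auto simp: measurable_def)
qed

lemma path_stays_in_open:
  assumes "\<omega> \<in> space M" "t < \<infinity>" "open U" "X t \<omega> \<in> Some ` U"
  shows "\<forall>\<^sub>F s in at_right t. X s \<omega> \<in> Some ` U"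
  using paths_right_continuous[OF assms(1,2)] assms(3,4)
  unfolding limitin_def openin_Alexandroff_compactification by auto

lemma path_avoids_compact:
  assumes "\<omega> \<in> space M" "t < \<infinity>" "compact K" "X t \<omega> \<notin> Some ` K"
  shows "\<forall>\<^sub>F s in at_right t. X s \<omega> \<notin> Some ` K"
proof -
  have "openin cemetery_topology (insert None (Some ` (UNIV - K)))"
    using assms(3) unfolding openin_Alexandroff_compactification
    by (auto simp: compact_imp_closed)
  moreover have "X t \<omega> \<in> insert None (Some ` (UNIV - K))"
    using assms(4) by (cases "X t \<omega>") auto
  ultimately have "\<forall>\<^sub>F s in at_right t. X s \<omega> \<in> insert None (Some ` (UNIV - K))"
    using paths_right_continuous[OF assms(1,2)] unfolding limitin_def by auto
  then show ?thesis
    by eventually_elim auto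
qed

definition right_approx :: "nat \<Rightarrow> real \<Rightarrow> ennreal" where
  "right_approx n t = ennreal ((real_of_int \<lfloor>max t 0 * real (Suc n)\<rfloor> + 1) / real (Suc n))"

lemma right_approx_at_right: "filterlim (\<lambda>n. right_approx n t) (at_right (ennreal t)) sequentially"
proof -
  define b where "b n = (real_of_int \<lfloor>max t 0 * real (Suc n)\<rfloor> + 1) / real (Suc n)" for n
  have t: "ennreal t = ennreal (max t 0)"
    by (cases "0 \<le> t") (auto simp: max_def ennreal_neg)
  have lower: "max t 0 < b n" for n
    unfolding b_def by (subst less_divide_eq) (simp del: of_nat_Suc; linarith)
  have upper: "b n \<le> max t 0 + 1 / real (Suc n)" for n
    unfolding b_def by (subst divide_le_eq) (simp add: distrib_right del: of_nat_Suc)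
  have "b \<longlonglongrightarrow> max t 0"
  proof (rule real_tendsto_sandwich[of "\<lambda>_. max t 0" _ _ "\<lambda>n. max t 0 + 1 / real (Suc n)"])
    show "(\<lambda>n. max t 0 + 1 / real (Suc n)) \<longlonglongrightarrow> max t 0"
      using tendsto_add[OF tendsto_const[of "max t 0"] LIMSEQ_inverse_real_of_nat]
      by (simp add: inverse_eq_divide)
  qed (use lower upper in \<open>auto intro!: always_eventually less_imp_le\<close>)
  then have "(\<lambda>n. ennreal (b n)) \<longlonglongrightarrow> ennreal t"
    unfolding t by (rule tendsto_ennrealI)
  moreover have "ennreal t < ennreal (b n)" for n
    using lower[of n] by (intro ennreal_lessI) auto
  ultimately show ?thesis
    unfolding right_approx_def b_def[symmetric]
    by (simp add: filterlim_at less_imp_neq[symmetric] always_eventually)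
qed

lemma measurable_X_right_approx:
  "(\<lambda>z. X (right_approx n (fst z)) (snd z)) \<in> lborel \<Otimes>\<^sub>M M \<rightarrow>\<^sub>M cemetery_borel"
proof -
  have "(\<lambda>z. X (ennreal ((real_of_int i + 1) / real (Suc n))) (snd z)) \<in> lborel \<Otimes>\<^sub>M M \<rightarrow>\<^sub>M cemetery_borel" for i
    by (rule measurable_compose[OF measurable_snd measurable_X])
  then show ?thesis
    unfolding right_approx_def
    by (rule measurable_compose_countable[where g="\<lambda>z. \<lfloor>max (fst z) 0 * real (Suc n)\<rfloor>"]) measurable
qed

lemma path_in_open_measurable:
  assumes "open U"
  shows "{z\<in>space (lborel \<Otimes>\<^sub>M M). X (ennreal (fst z)) (snd z) \<in> Some ` U} \<in> sets (lborel \<Otimes>\<^sub>M M)"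
proof -
  obtain B :: "'a set set" where B: "countable B" "topological_basis B"
    using ex_countable_basis by blast
  define C where "C = {V\<in>B. \<exists>K. compact K \<and> V \<subseteq> K \<and> K \<subseteq> U}"
  have "\<forall>V\<in>C. \<exists>K. compact K \<and> V \<subseteq> K \<and> K \<subseteq> U" by (auto simp: C_def)
  then obtain K where K: "\<And>V. V \<in> C \<Longrightarrow> compact (K V) \<and> V \<subseteq> K V \<and> K V \<subseteq> U" by metis
  have C: "countable C" "\<And>V. V \<in> C \<Longrightarrow> open V"
    using B topological_basis_open[OF B(2)] by (auto simp: C_def)
  have cover: "\<exists>V\<in>C. x \<in> V" if x: "x \<in> U" for x
  proof -
    obtain V K where V: "open V" "x \<in> V" "V \<subseteq> K" "compact K" "K \<subseteq> U"
      using compact_neighbourhood[OF assms x] .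
    obtain V' where "V' \<in> B" "x \<in> V'" "V' \<subseteq> V"
      using topological_basisE[OF B(2) V(1,2)] by blast
    then show ?thesis using V by (auto simp: C_def)
  qed
  have iff: "X (ennreal t) \<omega> \<in> Some ` U \<longleftrightarrow>
      (\<exists>V\<in>C. \<exists>n. \<forall>j\<ge>n. X (right_approx j t) \<omega> \<in> Some ` K V)" if \<omega>: "\<omega> \<in> space M" for t \<omega>
  proof
    assume "X (ennreal t) \<omega> \<in> Some ` U"
    then obtain V where V: "V \<in> C" "X (ennreal t) \<omega> \<in> Some ` V" using cover by blast
    have "\<forall>\<^sub>F j in sequentially. X (right_approx j t) \<omega> \<in> Some ` V"
      using path_stays_in_open[OF \<omega> _ C(2)[OF V(1)] V(2)] right_approx_at_right[of t]
      by (auto simp: filterlim_iff)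
    then obtain n where "\<forall>j\<ge>n. X (right_approx j t) \<omega> \<in> Some ` V"
      by (auto simp: eventually_sequentially)
    then have "\<forall>j\<ge>n. X (right_approx j t) \<omega> \<in> Some ` K V"
      using K[OF V(1)] by blast
    then show "\<exists>V\<in>C. \<exists>n. \<forall>j\<ge>n. X (right_approx j t) \<omega> \<in> Some ` K V"
      using V(1) by blast
  next
    assume "\<exists>V\<in>C. \<exists>n. \<forall>j\<ge>n. X (right_approx j t) \<omega> \<in> Some ` K V"
    then obtain V n where V: "V \<in> C" "\<And>j. j \<ge> n \<Longrightarrow> X (right_approx j t) \<omega> \<in> Some ` K V" by blast
    have "X (ennreal t) \<omega> \<in> Some ` K V"
    proof (rule ccontr)
      assume "X (ennreal t) \<omega> \<notin> Some ` K V"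
      then have "\<forall>\<^sub>F j in sequentially. X (right_approx j t) \<omega> \<notin> Some ` K V"
        using path_avoids_compact[OF \<omega>, of "ennreal t" "K V"] K[OF V(1)] right_approx_at_right[of t]
        by (auto simp: filterlim_iff)
      then obtain k where "\<And>j. j \<ge> k \<Longrightarrow> X (right_approx j t) \<omega> \<notin> Some ` K V"
        by (auto simp: eventually_sequentially)
      from this[of "max n k"] V(2)[of "max n k"] show False by simp
    qed
    then show "X (ennreal t) \<omega> \<in> Some ` U" using K[OF V(1)] by blast
  qed
  define S where "S V j = {z\<in>space (lborel \<Otimes>\<^sub>M M). X (right_approx j (fst z)) (snd z) \<in> Some ` K V}" for V j
  have S: "S V j \<in> sets (lborel \<Otimes>\<^sub>M M)" if "V \<in> C" for V j
    using measurable_sets[OF measurable_X_right_approx Some_image_cemetery_borel[OF borel_compact], of "K V" j] K[OF that]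
    by (simp add: S_def vimage_def Int_def conj_commute)
  have "{z\<in>space (lborel \<Otimes>\<^sub>M M). X (ennreal (fst z)) (snd z) \<in> Some ` U}
      = {z\<in>space (lborel \<Otimes>\<^sub>M M). \<exists>V\<in>C. \<exists>n. \<forall>j\<ge>n. X (right_approx j (fst z)) (snd z) \<in> Some ` K V}"
    by (rule Collect_cong, rule conj_cong[OF refl], rule iff) (auto simp: space_pair_measure)
  also have "\<dots> = (\<Union>V\<in>C. \<Union>n. \<Inter>j\<in>{n..}. S V j)"
    unfolding S_def by blast
  also have "\<dots> \<in> sets (lborel \<Otimes>\<^sub>M M)"
    using S C(1) by (intro sets.countable_UN'' sets.countable_INT') auto
  finally show ?thesis .
qed

lemma path_in_borel_measurable:
  assumes "B \<in> sets borel"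
  shows "{z\<in>space (lborel \<Otimes>\<^sub>M M). X (ennreal (fst z)) (snd z) \<in> Some ` B} \<in> sets (lborel \<Otimes>\<^sub>M M)"
    (is "?A B \<in> ?S")
proof -
  have "B \<in> sigma_sets UNIV {S. open S}" using assms by (simp add: borel_def)
  then show ?thesis
  proof induction
    case (Basic a)
    then show ?case using path_in_open_measurable by auto
  next
    case (Compl a)
    have "?A (UNIV - a) = ?A UNIV - ?A a" by auto
    then show ?case using Compl path_in_open_measurable[of UNIV] by (auto intro: sets.Diff)
  next
    case (Union a)
    have "?A (\<Union>i. a i) = (\<Union>i. ?A (a i))" by auto
    then show ?case using Union by (auto intro!: sets.countable_UN)
  qed simp
qed

definition at_path :: "('a \<Rightarrow> ennreal) \<Rightarrow> real \<Rightarrow> 'w \<Rightarrow> ennreal" where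
  "at_path h t \<omega> = (case X (ennreal t) \<omega> of None \<Rightarrow> 0 | Some y \<Rightarrow> h y)"

lemma at_path_measurable:
  assumes h[measurable]: "h \<in> borel_measurable borel"
  shows "(\<lambda>z. at_path h (fst z) (snd z)) \<in> borel_measurable (lborel \<Otimes>\<^sub>M M)"
proof (rule borel_measurableI_greater)
  fix c :: ennreal
  have "{z\<in>space (lborel \<Otimes>\<^sub>M M). c < at_path h (fst z) (snd z)}
      = {z\<in>space (lborel \<Otimes>\<^sub>M M). X (ennreal (fst z)) (snd z) \<in> Some ` {y. c < h y}}"
    by (auto simp: at_path_def split: option.splits)
  also have "\<dots> \<in> sets (lborel \<Otimes>\<^sub>M M)"
    by (rule path_in_borel_measurable) measurable
  finally show "{z\<in>space (lborel \<Otimes>\<^sub>M M). c < at_path h (fst z) (snd z)} \<in> sets (lborel \<Otimes>\<^sub>M M)" .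
qed

lemma resolvent_at_path:
  "resolvent X P \<alpha> h x =
     (\<integral>\<^sup>+\<omega>. (\<integral>\<^sup>+t. ennreal (exp (- \<alpha> * t)) * (indicator {0..} t * at_path h t \<omega>) \<partial>lborel) \<partial>P (Some x))"
  unfolding resolvent_def
proof (intro nn_integral_cong)
  fix \<omega> t assume "\<omega> \<in> space (P (Some x))"
  then have \<omega>: "\<omega> \<in> space M" by (simp add: space_P)
  have "ennreal t < lifetime X \<omega> \<longleftrightarrow> X (ennreal t) \<omega> \<noteq> None"
  proof
    assume "ennreal t < lifetime X \<omega>"
    then show "X (ennreal t) \<omega> \<noteq> None"
      using Inf_lower[of "ennreal t" "{s. X s \<omega> = None}"]
      unfolding lifetime_def by (metis leD mem_Collect_eq)
  next
    assume "X (ennreal t) \<omega> \<noteq> None"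
    then show "ennreal t < lifetime X \<omega>"
      using after_lifetime[OF \<omega>, of "ennreal t"] by (meson not_le)
  qed
  then show "ennreal (exp (- \<alpha> * t)) * h (the (X (ennreal t) \<omega>)) *
      indicator {t. 0 \<le> t \<and> ennreal t < lifetime X \<omega>} t =
      ennreal (exp (- \<alpha> * t)) * (indicator {0..} t * at_path h t \<omega>)"
    by (auto simp: at_path_def split: split_indicator option.splits)
qed

lemma resolvent_antimono:
  assumes "\<alpha> \<le> \<beta>"
  shows "resolvent X P \<beta> h x \<le> resolvent X P \<alpha> h x"
  unfolding resolvent_at_path
proof (intro nn_integral_mono)
  fix \<omega> and t :: real
  show "ennreal (exp (- \<beta> * t)) * (indicator {0..} t * at_path h t \<omega>)
      \<le> ennreal (exp (- \<alpha> * t)) * (indicator {0..} t * at_path h t \<omega>)"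
    using assms by (cases "0 \<le> t") (auto intro!: mult_right_mono ennreal_leI simp: mult_right_mono)
qed

lemma resolvent_eq_product_integral:
  assumes h: "h \<in> borel_measurable borel"
  defines "G \<equiv> \<lambda>\<alpha> z. ennreal (exp (- \<alpha> * snd z)) * (indicator {0..} (snd z) * at_path h (snd z) (fst z))"
  shows "resolvent X P \<alpha> h x = (\<integral>\<^sup>+z. G \<alpha> z \<partial>(P (Some x) \<Otimes>\<^sub>M lborel))"
    and "G \<alpha> \<in> borel_measurable (P (Some x) \<Otimes>\<^sub>M lborel)"
proof -
  have sets_eq: "sets (P (Some x) \<Otimes>\<^sub>M lborel) = sets (M \<Otimes>\<^sub>M lborel)"
    by (intro sets_pair_measure_cong refl sets_P)
  have [measurable]: "(\<lambda>z. at_path h (snd z) (fst z)) \<in> borel_measurable (M \<Otimes>\<^sub>M lborel)"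
    using measurable_pair_swap[OF at_path_measurable[OF h]] by (simp add: case_prod_beta')
  have "G \<alpha> \<in> borel_measurable (M \<Otimes>\<^sub>M lborel)"
    unfolding G_def by measurable
  then show meas: "G \<alpha> \<in> borel_measurable (P (Some x) \<Otimes>\<^sub>M lborel)"
    by (subst measurable_cong_sets[OF sets_eq refl])
  show "resolvent X P \<alpha> h x = (\<integral>\<^sup>+z. G \<alpha> z \<partial>(P (Some x) \<Otimes>\<^sub>M lborel))"
    unfolding lborel.nn_integral_fst[OF meas, symmetric] resolvent_at_path by (simp add: G_def)
qed

lemma resolvent_zero_eq_SUP:
  assumes h: "h \<in> borel_measurable borel"
  shows "resolvent X P 0 h x = (SUP n. resolvent X P (1 / real (Suc n)) h x)"
proof -
  define G where "G \<alpha> z = ennreal (exp (- \<alpha> * snd z)) * (indicator {0..} (snd z) * at_path h (snd z) (fst z))" for \<alpha> z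
  note G = resolvent_eq_product_integral[OF h, folded G_def]
  have mono: "incseq (\<lambda>n. G (1 / real (Suc n)) z)" for z
  proof (rule incseq_SucI)
    fix n
    show "G (1 / real (Suc n)) z \<le> G (1 / real (Suc (Suc n))) z"
    proof (cases "0 \<le> snd z")
      case True
      then have "snd z / real (Suc (Suc n)) \<le> snd z / real (Suc n)" by (intro divide_left_mono) auto
      then show ?thesis
        unfolding G_def by (intro mult_right_mono ennreal_leI) (auto simp del: of_nat_Suc)
    qed (simp add: G_def)
  qed
  have lim: "(SUP n. G (1 / real (Suc n)) z) = G 0 z" for z
  proof (rule LIMSEQ_unique[OF LIMSEQ_SUP[OF mono]])
    have "(\<lambda>n. ennreal (exp (- (1 / real (Suc n)) * snd z))) \<longlonglongrightarrow> ennreal (exp (- 0 * snd z))"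
      using LIMSEQ_inverse_real_of_nat
      by (intro tendsto_ennrealI tendsto_exp tendsto_mult tendsto_minus tendsto_const) (simp add: inverse_eq_divide)
    then show "(\<lambda>n. G (1 / real (Suc n)) z) \<longlonglongrightarrow> G 0 z"
      unfolding G_def by (intro tendsto_mult_ennreal tendsto_const) auto
  qed
  show ?thesis
    unfolding G(1) lim[symmetric]
    by (rule nn_integral_monotone_convergence_SUP) (use mono G(2) in \<open>auto simp: incseq_def le_fun_def\<close>)
qed

lemma resolvent_mono:
  assumes "\<And>y. h y \<le> h' y"
  shows "resolvent X P \<alpha> h x \<le> resolvent X P \<alpha> h' x"
  unfolding resolvent_def by (intro nn_integral_mono mult_right_mono mult_left_mono assms) auto

lemma resolvent_eq_kernel_borel:
  assumes \<alpha>: "0 \<le> \<alpha>" and h[measurable]: "h \<in> borel_measurable borel"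
  shows "resolvent X P \<alpha> h x = (\<integral>\<^sup>+y. h y * r \<alpha> x y \<partial>m)"
proof -
  define k where "k n y = min (h y) (of_nat n)" for n y
  have k[measurable]: "k n \<in> borel_measurable borel" for n unfolding k_def by measurable
  have inc: "incseq (\<lambda>n. k n y)" for y
    unfolding k_def by (auto simp: incseq_def intro: min.coboundedI2)
  have lim: "(SUP n. k n y) = h y" for y
  proof (rule LIMSEQ_unique[OF LIMSEQ_SUP[OF inc]])
    have "(\<lambda>n. min (h y) (of_nat n)) \<longlonglongrightarrow> min (h y) top"
      by (intro tendsto_min tendsto_const of_nat_tendsto_top_ennreal)
    then show "(\<lambda>n. k n y) \<longlonglongrightarrow> h y" by (simp add: k_def)
  qed
  have fin: "ennreal (enn2real (k n y)) = k n y" for n y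
    unfolding k_def by (simp add: min_less_iff_disj of_nat_less_top)
  have eq: "resolvent X P \<alpha> (k n) x = (\<integral>\<^sup>+y. k n y * r \<alpha> x y \<partial>m)" for n
    using kernel_resolvent[OF \<alpha> borel_measurable_universal_borel, of "\<lambda>y. enn2real (k n y)" x]
    by (simp add: fin)
  define G where "G h z = ennreal (exp (- \<alpha> * snd z)) * (indicator {0..} (snd z) * at_path h (snd z) (fst z))" for h z
  have G: "resolvent X P \<alpha> h x = (\<integral>\<^sup>+z. G h z \<partial>(P (Some x) \<Otimes>\<^sub>M lborel))"
      "G h \<in> borel_measurable (P (Some x) \<Otimes>\<^sub>M lborel)" if "h \<in> borel_measurable borel" for h
    using resolvent_eq_product_integral[OF that, of \<alpha> x] unfolding G_def by auto
  have path: "incseq (\<lambda>n. at_path (k n) t \<omega>)" "(SUP n. at_path (k n) t \<omega>) = at_path h t \<omega>" for t \<omega>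
    using inc lim by (auto simp: at_path_def incseq_def split: option.splits)
  have incG: "incseq (\<lambda>n. G (k n) z)" for z
    using path(1) unfolding G_def by (auto simp: incseq_def intro!: mult_left_mono)
  have "(SUP n. G (k n) z) = G h z" for z
    unfolding G_def path(2)[symmetric] by (simp add: SUP_mult_left_ennreal)
  then have "resolvent X P \<alpha> h x = (\<integral>\<^sup>+z. (SUP n. G (k n) z) \<partial>(P (Some x) \<Otimes>\<^sub>M lborel))"
    by (simp only: G(1)[OF h])
  also have "\<dots> = (SUP n. resolvent X P \<alpha> (k n) x)"
    unfolding G(1)[OF k]
    by (rule nn_integral_monotone_convergence_SUP) (use incG G(2)[OF k] in \<open>auto simp: incseq_def le_fun_def\<close>)
  also have "\<dots> = (SUP n. \<integral>\<^sup>+y. k n y * r \<alpha> x y \<partial>m)"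
    by (simp add: eq)
  also have "\<dots> = (\<integral>\<^sup>+y. (SUP n. k n y * r \<alpha> x y) \<partial>m)"
  proof (rule nn_integral_monotone_convergence_SUP[symmetric])
    have "(\<lambda>y. r \<alpha> x y) \<in> borel_measurable borel"
      using measurable_compose[OF measurable_Pair1' kernel_measurable[OF \<alpha>], of x] by simp
    then show "(\<lambda>y. k n y * r \<alpha> x y) \<in> borel_measurable m" for n
      unfolding borel_measurable_m by measurable
  qed (use inc in \<open>auto simp: incseq_def le_fun_def intro!: mult_right_mono\<close>)
  also have "\<dots> = (\<integral>\<^sup>+y. h y * r \<alpha> x y \<partial>m)"
    by (simp add: SUP_mult_right_ennreal[symmetric] lim)
  finally show ?thesis .
qed

text \<open>
  Universally measurable functions are not known to be measurable along the paths, so \<open>h\<close> is squeezed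
  between Borel functions that agree with it outside an \<open>m\<close>-null set.
\<close>

lemma resolvent_eq_kernel:
  assumes \<alpha>: "0 \<le> \<alpha>" and h: "h \<in> borel_measurable universal_borel"
  shows "resolvent X P \<alpha> h x = (\<integral>\<^sup>+y. h y * r \<alpha> x y \<partial>m)"
proof -
  obtain h' where h'[measurable]: "h' \<in> borel_measurable borel" and AE: "AE y in m. h y = h' y"
    by (rule universal_borel_AE_eq[OF h])
  obtain N where N: "{y\<in>space m. h y \<noteq> h' y} \<subseteq> N" "emeasure m N = 0" "N \<in> sets m"
    using AE by (rule AE_E)
  have [measurable]: "N \<in> sets borel" using N(3) sets_m by simp
  have eqN: "h y = h' y" if "y \<notin> N" for y
    using N(1) that sets_eq_imp_space_eq[OF sets_m] by auto
  have notN: "AE y in m. y \<notin> N" using N(2,3) by (intro AE_not_in null_setsI)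
  define lo where "lo y = h' y * indicator (- N) y" for y
  define hi where "hi y = h' y + top * indicator N y" for y
  have [measurable]: "lo \<in> borel_measurable borel" "hi \<in> borel_measurable borel"
    unfolding lo_def hi_def by measurable
  have "resolvent X P \<alpha> h x \<le> resolvent X P \<alpha> hi x"
    by (rule resolvent_mono) (auto simp: hi_def eqN split: split_indicator)
  also have "\<dots> = (\<integral>\<^sup>+y. hi y * r \<alpha> x y \<partial>m)"
    using \<alpha> by (rule resolvent_eq_kernel_borel) measurable
  also have "\<dots> = (\<integral>\<^sup>+y. h y * r \<alpha> x y \<partial>m)"
    using notN by (intro nn_integral_cong_AE) (auto elim!: eventually_mono simp: hi_def eqN)
  finally have upper: "resolvent X P \<alpha> h x \<le> (\<integral>\<^sup>+y. h y * r \<alpha> x y \<partial>m)" .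
  have "(\<integral>\<^sup>+y. h y * r \<alpha> x y \<partial>m) = (\<integral>\<^sup>+y. lo y * r \<alpha> x y \<partial>m)"
    using notN by (intro nn_integral_cong_AE) (auto elim!: eventually_mono simp: lo_def eqN)
  also have "\<dots> = resolvent X P \<alpha> lo x"
    using \<alpha> by (rule resolvent_eq_kernel_borel[symmetric]) measurable
  also have "\<dots> \<le> resolvent X P \<alpha> h x"
    by (rule resolvent_mono) (auto simp: lo_def eqN split: split_indicator)
  finally show ?thesis using upper by (rule antisym[rotated])
qed

subsection \<open>The resolvent equation\<close>

definition green :: "real \<Rightarrow> ('a \<Rightarrow> ennreal) \<Rightarrow> 'a \<Rightarrow> ennreal" where
  "green \<alpha> h x = (\<integral>\<^sup>+y. h y * r \<alpha> x y \<partial>m)"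

definition pot :: "real \<Rightarrow> 'a measure \<Rightarrow> 'a \<Rightarrow> ennreal" where
  "pot \<alpha> \<nu> x = (\<integral>\<^sup>+y. r \<alpha> x y \<partial>\<nu>)"

lemma kernel_measurable_comp [measurable (raw)]:
  assumes "0 \<le> \<alpha>" "f \<in> N \<rightarrow>\<^sub>M borel" "g \<in> N \<rightarrow>\<^sub>M borel"
  shows "(\<lambda>z. r \<alpha> (f z) (g z)) \<in> borel_measurable N"
proof -
  have "(\<lambda>z. (f z, g z)) \<in> N \<rightarrow>\<^sub>M borel \<Otimes>\<^sub>M borel"
    using assms(2,3) by (rule measurable_Pair)
  from measurable_compose[OF this kernel_measurable[OF assms(1)]] show ?thesis
    by simp
qed

lemma nn_integral_measurable_m:
  assumes "case_prod f \<in> borel_measurable (N \<Otimes>\<^sub>M borel)"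
    and \<nu>: "sigma_finite_measure \<nu>" "sets \<nu> = sets borel"
  shows "(\<lambda>x. \<integral>\<^sup>+y. f x y \<partial>\<nu>) \<in> borel_measurable N"
proof -
  have "sets (N \<Otimes>\<^sub>M \<nu>) = sets (N \<Otimes>\<^sub>M borel)"
    by (intro sets_pair_measure_cong refl \<nu>)
  then have "case_prod f \<in> borel_measurable (N \<Otimes>\<^sub>M \<nu>)"
    using assms(1) by (subst measurable_cong_sets[OF _ refl])
  then show ?thesis by (rule sigma_finite_measure.borel_measurable_nn_integral[OF \<nu>(1)])
qed

lemma green_measurable:
  assumes "0 \<le> \<alpha>" and [measurable]: "h \<in> borel_measurable borel"
  shows "green \<alpha> h \<in> borel_measurable borel"
  unfolding green_def
  by (rule nn_integral_measurable_m[OF _ sigma_finite_m sets_m]) (use assms in measurable)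

lemma pot_measurable:
  assumes "0 \<le> \<alpha>" "sigma_finite_measure \<nu>" "sets \<nu> = sets borel"
  shows "pot \<alpha> \<nu> \<in> borel_measurable borel"
  unfolding pot_def
  by (rule nn_integral_measurable_m[OF _ assms(2,3)]) (use assms in measurable)

lemma tonelli:
  assumes f: "case_prod f \<in> borel_measurable (borel \<Otimes>\<^sub>M borel)"
    and \<nu>: "sigma_finite_measure \<nu>" "sets \<nu> = sets borel"
  shows "(\<integral>\<^sup>+x. (\<integral>\<^sup>+y. f x y \<partial>\<nu>) \<partial>m) = (\<integral>\<^sup>+y. (\<integral>\<^sup>+x. f x y \<partial>m) \<partial>\<nu>)"
proof -
  interpret pair_sigma_finite m \<nu>
    by (intro pair_sigma_finite.intro sigma_finite_m \<nu>)
  have "sets (m \<Otimes>\<^sub>M \<nu>) = sets (borel \<Otimes>\<^sub>M borel)"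
    by (intro sets_pair_measure_cong sets_m \<nu>)
  then have "case_prod f \<in> borel_measurable (m \<Otimes>\<^sub>M \<nu>)"
    using f by (subst measurable_cong_sets[OF _ refl])
  then show ?thesis by (rule Fubini'[symmetric])
qed

lemma resolvent_eq_green:
  "0 \<le> \<alpha> \<Longrightarrow> h \<in> borel_measurable universal_borel \<Longrightarrow> resolvent X P \<alpha> h x = green \<alpha> h x"
  unfolding green_def by (rule resolvent_eq_kernel)

lemma green_cong_AE: "AE y in m. h y = h' y \<Longrightarrow> green \<alpha> h x = green \<alpha> h' x"
  unfolding green_def by (intro nn_integral_cong_AE) auto

lemma green_mono: "(\<And>y. h y \<le> h' y) \<Longrightarrow> green \<alpha> h x \<le> green \<alpha> h' x"
  unfolding green_def by (intro nn_integral_mono mult_right_mono) auto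

lemma green_add:
  assumes \<alpha>: "0 \<le> \<alpha>" and [measurable]: "h \<in> borel_measurable borel" "h' \<in> borel_measurable borel"
  shows "green \<alpha> (\<lambda>y. h y + h' y) x = green \<alpha> h x + green \<alpha> h' x"
proof -
  have [measurable]: "(\<lambda>y. r \<alpha> x y) \<in> borel_measurable borel" using \<alpha> by measurable
  show ?thesis
    unfolding green_def distrib_right
    by (rule nn_integral_add) (simp_all add: borel_measurable_m)
qed

lemma green_cmult:
  assumes \<alpha>: "0 \<le> \<alpha>" and [measurable]: "h \<in> borel_measurable borel"
  shows "green \<alpha> (\<lambda>y. c * h y) x = c * green \<alpha> h x"
proof -
  have [measurable]: "(\<lambda>y. r \<alpha> x y) \<in> borel_measurable borel" using \<alpha> by measurable
  show ?thesis
    unfolding green_def mult.assoc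
    by (rule nn_integral_cmult) (simp add: borel_measurable_m)
qed

lemma green_antimono:
  assumes "0 \<le> \<alpha>" "\<alpha> \<le> \<beta>" "h \<in> borel_measurable borel"
  shows "green \<beta> h x \<le> green \<alpha> h x"
  using resolvent_antimono[OF assms(2), of h x] assms
  by (simp add: resolvent_eq_green borel_measurable_universal_borel)

lemma green_LIMSEQ:
  assumes \<alpha>: "0 \<le> \<alpha>" and "incseq h" and [measurable]: "\<And>n. h n \<in> borel_measurable borel"
    and lim: "\<And>y. (\<lambda>n. h n y) \<longlonglongrightarrow> h' y"
  shows "(\<lambda>n. green \<alpha> (h n) x) \<longlonglongrightarrow> green \<alpha> h' x"
  unfolding green_def
proof (rule nn_integral_LIMSEQ)
  have [measurable]: "(\<lambda>y. r \<alpha> x y) \<in> borel_measurable borel" using \<alpha> by measurable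
  show "(\<lambda>y. h n y * r \<alpha> x y) \<in> borel_measurable m" for n
    unfolding borel_measurable_m by measurable
  show "incseq (\<lambda>n y. h n y * r \<alpha> x y)"
    using assms(2) by (auto simp: incseq_def le_fun_def intro!: mult_right_mono)
  fix y
  have sup: "h' y = (SUP n. h n y)"
    using LIMSEQ_unique[OF lim LIMSEQ_SUP[of "\<lambda>n. h n y"]] assms(2) by (auto simp: incseq_def le_fun_def)
  have "(\<lambda>n. h n y * r \<alpha> x y) \<longlonglongrightarrow> (SUP n. h n y * r \<alpha> x y)"
    using assms(2) by (intro LIMSEQ_SUP) (auto simp: incseq_def le_fun_def intro!: mult_right_mono)
  also have "(SUP n. h n y * r \<alpha> x y) = h' y * r \<alpha> x y"
    unfolding sup by (rule SUP_mult_right_ennreal[symmetric])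
  finally show "(\<lambda>n. h n y * r \<alpha> x y) \<longlonglongrightarrow> h' y * r \<alpha> x y" .
qed

lemma green_zero_LIMSEQ:
  assumes h: "h \<in> borel_measurable borel"
  shows "(\<lambda>n. green (1 / real (Suc n)) h x) \<longlonglongrightarrow> green 0 h x"
proof -
  have "incseq (\<lambda>n. green (1 / real (Suc n)) h x)"
    using h by (intro incseq_SucI green_antimono) (auto intro!: divide_left_mono)
  from LIMSEQ_SUP[OF this] show ?thesis
    using resolvent_zero_eq_SUP[OF h, of x] h
    by (simp add: resolvent_eq_green borel_measurable_universal_borel del: of_nat_Suc)
qed

lemma L2_integrable_mult:
  assumes "u \<in> L2 m" "v \<in> L2 m"
  shows "integrable m (\<lambda>x. u x * v x)"
proof (rule Bochner_Integration.integrable_bound)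
  show "integrable m (\<lambda>x. (u x)\<^sup>2 + (v x)\<^sup>2)"
    using assms by (auto simp: L2_def)
  show "(\<lambda>x. u x * v x) \<in> borel_measurable m"
    using assms by (auto simp: L2_def)
  have "\<bar>a * b\<bar> \<le> a\<^sup>2 + b\<^sup>2" for a b :: real
    using sum_squares_bound[of "\<bar>a\<bar>" "\<bar>b\<bar>"] abs_ge_zero[of "a * b"]
    unfolding abs_mult power2_abs by linarith
  then show "AE x in m. norm (u x * v x) \<le> norm ((u x)\<^sup>2 + (v x)\<^sup>2)"
    by (intro AE_I2) simp
qed

lemma L2_diff:
  assumes "u \<in> L2 m" "v \<in> L2 m"
  shows "(\<lambda>x. u x - v x) \<in> L2 m"
proof -
  have "integrable m (\<lambda>x. (u x)\<^sup>2 + (v x)\<^sup>2 - 2 * (u x * v x))"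
    using assms L2_integrable_mult[OF assms] by (auto simp: L2_def)
  then show ?thesis
    using assms by (auto simp: L2_def power2_diff algebra_simps)
qed

lemma L2_AE_bound:
  assumes "v \<in> L2 m" "h \<in> borel_measurable borel" "AE x in m. \<bar>h x\<bar> \<le> \<bar>v x\<bar>"
  shows "h \<in> L2 m"
proof -
  have "integrable m (\<lambda>x. (h x)\<^sup>2)"
  proof (rule Bochner_Integration.integrable_bound[of _ "\<lambda>x. (v x)\<^sup>2"])
    show "AE x in m. norm ((h x)\<^sup>2) \<le> norm ((v x)\<^sup>2)"
      using assms(3) by eventually_elim (simp add: abs_le_square_iff)
  qed (use assms in \<open>auto simp: L2_def borel_measurable_m\<close>)
  then show ?thesis using assms(2) by (simp add: L2_def borel_measurable_m)
qed

lemma green_L2: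
  assumes \<alpha>: "0 < \<alpha>" and h: "h \<in> L2 m" "\<And>x. 0 \<le> h x"
  obtains v where "v \<in> D" "\<And>x. 0 \<le> v x" "AE x in m. green \<alpha> (\<lambda>y. ennreal (h y)) x = ennreal (v x)"
    "\<And>w. w \<in> D \<Longrightarrow> \<E> v w = (\<integral>x. h x * w x \<partial>m) - \<alpha> * (\<integral>x. v x * w x \<partial>m)"
proof -
  obtain v where v: "is_generator m D \<E> v (\<lambda>x. \<alpha> * v x - h x)"
    "AE x in m. 0 \<le> v x \<and> resolvent X P \<alpha> (\<lambda>y. ennreal (h y)) x = ennreal (v x)"
    using associated[OF \<alpha> h] by blast
  have vD: "v \<in> D" using v(1) by (simp add: is_generator_def)
  define v' where "v' x = max 0 (v x)" for x
  have eq: "AE x in m. v x = v' x" using v(2) by eventually_elim (simp add: v'_def)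
  have L2v: "v \<in> L2 m" using vD domain_L2 by auto
  have v'D: "v' \<in> D"
    using L2v by (intro domain_AE[OF vD _ eq]) (auto simp: L2_def v'_def)
  have L2v': "v' \<in> L2 m" using v'D domain_L2 by auto
  have hb: "(\<lambda>y. ennreal (h y)) \<in> borel_measurable borel"
    using h by (auto simp: L2_def borel_measurable_m)
  show ?thesis
  proof
    show "v' \<in> D" by (rule v'D)
    show "0 \<le> v' x" for x by (simp add: v'_def)
    show "AE x in m. green \<alpha> (\<lambda>y. ennreal (h y)) x = ennreal (v' x)"
      using v(2) eq
      by eventually_elim (use \<alpha> hb in \<open>simp add: resolvent_eq_green borel_measurable_universal_borel\<close>)
    fix w assume w: "w \<in> D"
    then have L2w: "w \<in> L2 m" using domain_L2 by auto
    have "\<E> v' w = \<E> v w" using eq by (intro form_AE v'D vD w) auto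
    also have "\<dots> = (\<integral>x. h x * w x - \<alpha> * (v x * w x) \<partial>m)"
      using v(1) w by (simp add: is_generator_def algebra_simps)
    also have "\<dots> = (\<integral>x. h x * w x \<partial>m) - \<alpha> * (\<integral>x. v x * w x \<partial>m)"
      using L2_integrable_mult[OF h(1) L2w] L2_integrable_mult[OF L2v L2w] by simp
    also have "(\<integral>x. v x * w x \<partial>m) = (\<integral>x. v' x * w x \<partial>m)"
      using eq L2v L2v' L2w by (intro integral_cong_AE) (auto simp: L2_def)
    finally show "\<E> v' w = (\<integral>x. h x * w x \<partial>m) - \<alpha> * (\<integral>x. v' x * w x \<partial>m)" .
  qed
qed

lemma form_eq_zero_imp_AE_zero:
  assumes q: "q \<in> D" and "0 < \<beta>" and eq: "\<And>w. w \<in> D \<Longrightarrow> \<E> q w + \<beta> * (\<integral>x. q x * w x \<partial>m) = 0"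
  shows "AE x in m. q x = 0"
proof -
  have q2: "integrable m (\<lambda>x. (q x)\<^sup>2)" using q domain_L2 by (auto simp: L2_def)
  have "\<beta> * (\<integral>x. (q x)\<^sup>2 \<partial>m) \<le> 0"
    using eq[OF q] form_nonneg[OF q] by (simp add: power2_eq_square)
  moreover have "0 \<le> (\<integral>x. (q x)\<^sup>2 \<partial>m)" by simp
  ultimately have "(\<integral>x. (q x)\<^sup>2 \<partial>m) = 0"
    using \<open>0 < \<beta>\<close> by (simp add: mult_le_0_iff)
  then show ?thesis using q2 by (simp add: integral_nonneg_eq_0_iff_AE)
qed

lemma resolvent_equation_L2:
  assumes \<alpha>: "0 < \<alpha>" "\<alpha> \<le> \<beta>" and h: "h \<in> L2 m" "\<And>x. 0 \<le> h x"
  defines "H \<equiv> \<lambda>y. ennreal (h y)"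
  shows "AE x in m. green \<alpha> H x = green \<beta> H x + ennreal (\<beta> - \<alpha>) * green \<beta> (green \<alpha> H) x"
proof -
  have \<beta>: "0 < \<beta>" using \<alpha> by simp
  obtain z where z: "z \<in> D" "\<And>x. 0 \<le> z x" "AE x in m. green \<alpha> H x = ennreal (z x)"
    "\<And>w. w \<in> D \<Longrightarrow> \<E> z w = (\<integral>x. h x * w x \<partial>m) - \<alpha> * (\<integral>x. z x * w x \<partial>m)"
    using green_L2[OF \<alpha>(1) h] unfolding H_def by blast
  obtain v where v: "v \<in> D" "\<And>x. 0 \<le> v x" "AE x in m. green \<beta> H x = ennreal (v x)"
    "\<And>w. w \<in> D \<Longrightarrow> \<E> v w = (\<integral>x. h x * w x \<partial>m) - \<beta> * (\<integral>x. v x * w x \<partial>m)"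
    using green_L2[OF \<beta> h] unfolding H_def by blast
  have L2z: "z \<in> L2 m" using z(1) domain_L2 by auto
  obtain y where y: "y \<in> D" "\<And>x. 0 \<le> y x" "AE x in m. green \<beta> (\<lambda>x. ennreal (z x)) x = ennreal (y x)"
    "\<And>w. w \<in> D \<Longrightarrow> \<E> y w = (\<integral>x. z x * w x \<partial>m) - \<beta> * (\<integral>x. y x * w x \<partial>m)"
    using green_L2[OF \<beta> L2z z(2)] by blast
  define q where "q x = z x + (-1 * v x + (-(\<beta> - \<alpha>)) * y x)" for x
  have part: "(\<lambda>x. (-(\<beta> - \<alpha>)) * y x) \<in> D" "(\<lambda>x. -1 * v x) \<in> D"
    by (rule domain_scale, fact)+
  have sum: "(\<lambda>x. -1 * v x + (-(\<beta> - \<alpha>)) * y x) \<in> D"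
    by (rule domain_add[OF part(2) part(1)])
  have q: "q \<in> D" unfolding q_def by (rule domain_add[OF z(1) sum])
  have q0: "AE x in m. q x = 0"
  proof (rule form_eq_zero_imp_AE_zero[OF q \<beta>])
    fix w assume w: "w \<in> D"
    have L2s: "w \<in> L2 m" "v \<in> L2 m" "y \<in> L2 m" using w v(1) y(1) domain_L2 by auto
    have int: "integrable m (\<lambda>x. z x * w x)" "integrable m (\<lambda>x. v x * w x)" "integrable m (\<lambda>x. y x * w x)"
      by (intro L2_integrable_mult L2s L2z)+
    have "(\<integral>x. q x * w x \<partial>m) = (\<integral>x. z x * w x - v x * w x - (\<beta> - \<alpha>) * (y x * w x) \<partial>m)"
      by (rule Bochner_Integration.integral_cong) (auto simp: q_def algebra_simps)
    also have "\<dots> = (\<integral>x. z x * w x \<partial>m) - (\<integral>x. v x * w x \<partial>m) - (\<beta> - \<alpha>) * (\<integral>x. y x * w x \<partial>m)"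
      using int by simp
    finally have I: "(\<integral>x. q x * w x \<partial>m) = \<dots>" .
    have "\<E> q w = \<E> z w + (-1 * \<E> v w + (-(\<beta> - \<alpha>)) * \<E> y w)"
      unfolding q_def form_add[OF z(1) sum w] form_add[OF part(2) part(1) w]
        form_scale[OF v(1) w] form_scale[OF y(1) w] ..
    then show "\<E> q w + \<beta> * (\<integral>x. q x * w x \<partial>m) = 0"
      unfolding I z(4)[OF w] v(4)[OF w] y(4)[OF w] by (simp add: algebra_simps)
  qed
  have gg: "green \<beta> (green \<alpha> H) x = green \<beta> (\<lambda>x. ennreal (z x)) x" for x
    using z(3) by (rule green_cong_AE)
  from q0 z(3) v(3) y(3) show ?thesis
  proof eventually_elim
    case (elim x)
    have "z x = v x + (\<beta> - \<alpha>) * y x" using elim(1) by (simp add: q_def algebra_simps)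
    then show ?case
      using elim v(2)[of x] y(2)[of x] \<alpha> by (simp add: gg ennreal_plus ennreal_mult)
  qed
qed

lemma ennreal_L2_approximation:
  fixes h :: "'a \<Rightarrow> ennreal"
  assumes h[measurable]: "h \<in> borel_measurable borel"
  obtains k where "\<And>n. k n \<in> L2 m" "\<And>n x. 0 \<le> k n x" "incseq (\<lambda>n x. ennreal (k n x))"
    "\<And>n. k n \<in> borel_measurable borel"
    "\<And>x. (\<lambda>n. ennreal (k n x)) \<longlonglongrightarrow> h x"
proof -
  obtain A :: "nat \<Rightarrow> 'a set" where A: "range A \<subseteq> sets m" "\<Union> (range A) = space m"
    "\<And>i. emeasure m (A i) \<noteq> \<infinity>" "incseq A"
    using sigma_finite_measure.sigma_finite_incseq[OF sigma_finite_m] by blast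
  have Ab[measurable]: "A n \<in> sets borel" for n using A(1) sets_m by auto
  define k where "k n x = enn2real (min (h x) (of_nat n)) * indicator (A n) x" for n x
  have fin: "min (h x) (of_nat n) < top" for n x by (simp add: min_less_iff_disj of_nat_less_top)
  have ek: "ennreal (k n x) = min (h x) (of_nat n) * indicator (A n) x" for n x
    using fin[of x n] by (auto simp: k_def indicator_def)
  have kb[measurable]: "k n \<in> borel_measurable borel" for n unfolding k_def by measurable
  have kn: "0 \<le> k n x" for n x by (simp add: k_def)
  have inc: "incseq (\<lambda>n. ennreal (k n x))" for x
  proof (rule incseq_SucI)
    fix n
    have "A n \<subseteq> A (Suc n)" using A(4) by (simp add: incseq_SucD)
    then show "ennreal (k n x) \<le> ennreal (k (Suc n) x)"
      unfolding ek by (intro mult_mono min.mono) (auto simp: indicator_def)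
  qed
  show ?thesis
  proof
    fix n x
    show "0 \<le> k n x" by (rule kn)
    show "k n \<in> borel_measurable borel" by (rule kb)
    show "k n \<in> L2 m"
    proof -
      have le: "k n y \<le> real n" for y
      proof -
        have "ennreal (k n y) \<le> ennreal (real n)"
          unfolding ek by (auto simp: indicator_def ennreal_of_nat_eq_real_of_nat)
        then show ?thesis by (simp add: ennreal_le_iff)
      qed
      have "integrable m (\<lambda>y. (real n)\<^sup>2 * indicator (A n) y)"
        using A(1) A(3)[of n] by (intro integrable_real_mult_indicator integrable_real_indicator integrable_mult_right) (auto simp: less_top)
      then have "integrable m (\<lambda>y. (k n y)\<^sup>2)"
      proof (rule Bochner_Integration.integrable_bound)
        show "(\<lambda>y. (k n y)\<^sup>2) \<in> borel_measurable m" unfolding borel_measurable_m by measurable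
        show "AE y in m. norm ((k n y)\<^sup>2) \<le> norm ((real n)\<^sup>2 * indicator (A n) y)"
        proof (intro AE_I2)
          fix y
          show "norm ((k n y)\<^sup>2) \<le> norm ((real n)\<^sup>2 * indicator (A n) y)"
            using power_mono[OF le[of y] kn[of n y], of 2] by (cases "y \<in> A n") (auto simp: k_def)
        qed
      qed
      then show ?thesis by (simp add: L2_def borel_measurable_m)
    qed
    show "incseq (\<lambda>n x. ennreal (k n x))"
      using inc by (auto simp: incseq_def le_fun_def)
    show "(\<lambda>n. ennreal (k n x)) \<longlonglongrightarrow> h x"
    proof -
      have "x \<in> \<Union> (range A)" using A(2) sets_eq_imp_space_eq[OF sets_m] by simp
      then obtain N where N: "x \<in> A N" by blast
      have eq: "eventually (\<lambda>n. min (h x) (of_nat n) = ennreal (k n x)) sequentially"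
        using eventually_ge_at_top[of N]
      proof eventually_elim
        case (elim n)
        have "x \<in> A n" using N A(4) elim by (auto simp: incseq_def)
        then show ?case by (simp add: ek)
      qed
      have "(\<lambda>n. min (h x) (of_nat n)) \<longlonglongrightarrow> min (h x) top"
        by (intro tendsto_min tendsto_const of_nat_tendsto_top_ennreal)
      then show ?thesis
        using eq by (simp add: tendsto_cong)
    qed
  qed
qed

lemma resolvent_equation_pos:
  assumes \<alpha>: "0 < \<alpha>" "\<alpha> \<le> \<beta>" and h: "h \<in> borel_measurable borel"
  shows "AE x in m. green \<alpha> h x = green \<beta> h x + ennreal (\<beta> - \<alpha>) * green \<beta> (green \<alpha> h) x"
proof -
  obtain k where k: "\<And>n. k n \<in> L2 m" "\<And>n x. 0 \<le> k n x" "incseq (\<lambda>n x. ennreal (k n x))"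
    "\<And>n. k n \<in> borel_measurable borel"
    "\<And>x. (\<lambda>n. ennreal (k n x)) \<longlonglongrightarrow> h x"
    using ennreal_L2_approximation[OF h] by blast
  have kb: "(\<lambda>x. ennreal (k n x)) \<in> borel_measurable borel" for n using k(4) by measurable
  define H where "H n x = ennreal (k n x)" for n x
  have lim: "(\<lambda>n. green \<gamma> (H n) x) \<longlonglongrightarrow> green \<gamma> h x" if "0 \<le> \<gamma>" for \<gamma> x
    unfolding H_def using that k kb by (intro green_LIMSEQ) auto
  have gH: "green \<alpha> (H n) \<in> borel_measurable borel" for n
    unfolding H_def using \<alpha> kb by (intro green_measurable) auto
  have lim2: "(\<lambda>n. green \<beta> (green \<alpha> (H n)) x) \<longlonglongrightarrow> green \<beta> (green \<alpha> h) x" for x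
  proof (rule green_LIMSEQ)
    show "incseq (\<lambda>n. green \<alpha> (H n))"
      using k(3) by (auto simp: H_def incseq_def le_fun_def intro!: green_mono)

  qed (use \<alpha> lim gH in auto)
  have "AE x in m. \<forall>n. green \<alpha> (H n) x = green \<beta> (H n) x + ennreal (\<beta> - \<alpha>) * green \<beta> (green \<alpha> (H n)) x"
    unfolding AE_all_countable H_def using resolvent_equation_L2[OF \<alpha> k(1,2)] by auto
  then show ?thesis
  proof eventually_elim
    case (elim x)
    have "(\<lambda>n. green \<beta> (H n) x + ennreal (\<beta> - \<alpha>) * green \<beta> (green \<alpha> (H n)) x)
        \<longlonglongrightarrow> green \<beta> h x + ennreal (\<beta> - \<alpha>) * green \<beta> (green \<alpha> h) x"
      using \<alpha> by (intro tendsto_add ennreal_tendsto_cmult lim lim2) auto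
    then show ?case
      using elim lim[of \<alpha> x] \<alpha> by (auto intro: LIMSEQ_unique)
  qed
qed

lemma resolvent_equation:
  assumes \<gamma>: "0 < \<gamma>" and h: "h \<in> borel_measurable borel"
  shows "AE x in m. green 0 h x = green \<gamma> h x + ennreal \<gamma> * green \<gamma> (green 0 h) x"
proof -
  obtain N where N: "1 / real (Suc N) < \<gamma>"
    using reals_Archimedean[OF \<gamma>] by (auto simp: inverse_eq_divide)
  define a where "a n = 1 / real (Suc (n + N))" for n
  have a: "0 < a n" "a n \<le> \<gamma>" for n
  proof -
    have "a n \<le> 1 / real (Suc N)" unfolding a_def by (intro divide_left_mono) auto
    then show "a n \<le> \<gamma>" using N by simp
  qed (simp add: a_def)
  have lim: "(\<lambda>n. green (a n) h x) \<longlonglongrightarrow> green 0 h x" for x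
    unfolding a_def using green_zero_LIMSEQ[OF h, of x, THEN LIMSEQ_ignore_initial_segment, of N] by simp
  have lim2: "(\<lambda>n. green \<gamma> (green (a n) h) x) \<longlonglongrightarrow> green \<gamma> (green 0 h) x" for x
  proof (rule green_LIMSEQ)
    have "a n \<le> a k" if "k \<le> n" for k n
      unfolding a_def using that by (intro divide_left_mono) auto
    then have "green (a k) h x \<le> green (a n) h x" if "k \<le> n" for k n x
      using h a(1)[of n] that by (intro green_antimono) auto
    then show "incseq (\<lambda>n. green (a n) h)"
      by (simp add: incseq_def le_fun_def)

    show "green (a n) h \<in> borel_measurable borel" for n
      using a[of n] h by (intro green_measurable) auto
  qed (use \<gamma> lim in auto)
  have "a \<longlonglongrightarrow> 0"
    unfolding a_def using LIMSEQ_inverse_real_of_nat[THEN LIMSEQ_ignore_initial_segment, of N]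
    by (simp add: inverse_eq_divide)
  then have lim3: "(\<lambda>n. ennreal (\<gamma> - a n)) \<longlonglongrightarrow> ennreal (\<gamma> - 0)"
    by (intro tendsto_ennrealI tendsto_diff tendsto_const)
  have "AE x in m. \<forall>n. green (a n) h x = green \<gamma> h x + ennreal (\<gamma> - a n) * green \<gamma> (green (a n) h) x"
    unfolding AE_all_countable using resolvent_equation_pos[OF a h] by auto
  then show ?thesis
  proof eventually_elim
    case (elim x)
    have "(\<lambda>n. green \<gamma> h x + ennreal (\<gamma> - a n) * green \<gamma> (green (a n) h) x)
        \<longlonglongrightarrow> green \<gamma> h x + ennreal (\<gamma> - 0) * green \<gamma> (green 0 h) x"
      using \<gamma> by (intro tendsto_add tendsto_const tendsto_mult_ennreal lim2 lim3) auto
    then show ?case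
      using elim lim[of x] by (auto intro: LIMSEQ_unique)
  qed
qed

subsection \<open>Potentials of measures and strong continuity\<close>

lemma kernel_section_measurable: "0 \<le> \<alpha> \<Longrightarrow> (\<lambda>y. r \<alpha> x y) \<in> borel_measurable borel"
  by measurable

lemma integral_mult_pot:
  assumes \<alpha>: "0 \<le> \<alpha>" and [measurable]: "h \<in> borel_measurable borel"
    and \<nu>: "sigma_finite_measure \<nu>" "sets \<nu> = sets borel"
  shows "(\<integral>\<^sup>+x. h x * pot \<alpha> \<nu> x \<partial>m) = (\<integral>\<^sup>+y. green \<alpha> h y \<partial>\<nu>)"
proof -
  have meas: "(\<lambda>y. r \<alpha> x y) \<in> borel_measurable \<nu>" for x
    using kernel_section_measurable[OF \<alpha>] by (subst measurable_cong_sets[OF \<nu>(2) refl])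
  have "(\<integral>\<^sup>+x. h x * pot \<alpha> \<nu> x \<partial>m) = (\<integral>\<^sup>+x. \<integral>\<^sup>+y. h x * r \<alpha> x y \<partial>\<nu> \<partial>m)"
    unfolding pot_def by (simp add: nn_integral_cmult meas)
  also have "\<dots> = (\<integral>\<^sup>+y. \<integral>\<^sup>+x. h x * r \<alpha> x y \<partial>m \<partial>\<nu>)"
    by (rule tonelli[OF _ \<nu>]) (use \<alpha> in measurable)
  also have "\<dots> = (\<integral>\<^sup>+y. green \<alpha> h y \<partial>\<nu>)"
    unfolding green_def by (simp add: kernel_symmetric[OF \<alpha>, of _ _])
  finally show ?thesis .
qed

lemma green_eq_pot_density:
  assumes \<alpha>: "0 \<le> \<alpha>" and h: "h \<in> borel_measurable borel"
  shows "pot \<alpha> (density m h) x = green \<alpha> h x"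
  unfolding pot_def green_def
  by (rule nn_integral_density) (use h kernel_section_measurable[OF \<alpha>] in \<open>simp_all add: borel_measurable_m\<close>)

lemma green_symmetric:
  assumes \<alpha>: "0 \<le> \<alpha>" and [measurable]: "h \<in> borel_measurable borel" "k \<in> borel_measurable borel"
  shows "(\<integral>\<^sup>+x. h x * green \<alpha> k x \<partial>m) = (\<integral>\<^sup>+x. green \<alpha> h x * k x \<partial>m)"
proof -
  have meas: "(\<lambda>y. k y * r \<alpha> x y) \<in> borel_measurable m" "(\<lambda>y. h y * r \<alpha> x y) \<in> borel_measurable m" for x
    unfolding borel_measurable_m using kernel_section_measurable[OF \<alpha>] by auto
  have "(\<integral>\<^sup>+x. h x * green \<alpha> k x \<partial>m) = (\<integral>\<^sup>+x. \<integral>\<^sup>+y. h x * (k y * r \<alpha> x y) \<partial>m \<partial>m)"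
    unfolding green_def by (simp add: nn_integral_cmult meas)
  also have "\<dots> = (\<integral>\<^sup>+y. \<integral>\<^sup>+x. h x * (k y * r \<alpha> x y) \<partial>m \<partial>m)"
    by (rule tonelli[OF _ sigma_finite_m sets_m]) (use \<alpha> in measurable)
  also have "\<dots> = (\<integral>\<^sup>+y. green \<alpha> h y * k y \<partial>m)"
  proof (rule nn_integral_cong)
    fix y
    have "(\<integral>\<^sup>+x. h x * (k y * r \<alpha> x y) \<partial>m) = (\<integral>\<^sup>+x. h x * r \<alpha> y x * k y \<partial>m)"
      by (simp add: kernel_symmetric[OF \<alpha>, of _ y] mult_ac)
    then show "(\<integral>\<^sup>+x. h x * (k y * r \<alpha> x y) \<partial>m) = green \<alpha> h y * k y"
      unfolding green_def by (simp add: nn_integral_multc meas)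
  qed
  finally show ?thesis .
qed

lemma kernel_approximation:
  fixes \<gamma> \<kappa> :: real
  assumes \<gamma>: "0 < \<gamma>" "0 \<le> \<kappa>" "\<kappa> \<le> \<gamma>"
  defines "K \<equiv> \<lambda>n x y. ennreal (real (Suc n)) * (\<integral>\<^sup>+z. r \<kappa> x z * r (\<gamma> + real (Suc n)) z y \<partial>m)"
  shows "incseq (\<lambda>n. K n x y)" and "(\<lambda>n. K n x y) \<longlonglongrightarrow> r \<kappa> x y"
proof -
  define b where "b n = \<gamma> - \<kappa> + real (Suc n)" for n
  have b: "0 < b n" "real (Suc n) \<le> b n" for n using \<gamma> by (auto simp: b_def)
  have ex: "excessive X P \<kappa> (r \<kappa> x)" by (rule kernel_excessive_right[OF \<gamma>(2)])
  define e where "e n = ennreal (b n) * resolvent X P (\<kappa> + b n) (r \<kappa> x) y" for n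
  have e_eq: "e n = ennreal (b n) * (\<integral>\<^sup>+z. r \<kappa> x z * r (\<gamma> + real (Suc n)) z y \<partial>m)" for n
  proof -
    have "\<kappa> + b n = \<gamma> + real (Suc n)" by (simp add: b_def)
    then show ?thesis
      using ex \<gamma> unfolding e_def excessive_def
      by (simp add: resolvent_eq_kernel kernel_symmetric[of _ y] del: of_nat_Suc)
  qed
  have "incseq b" by (auto simp: b_def incseq_def)
  then have inc: "incseq e"
    using ex b unfolding e_def excessive_def mono_on_def incseq_def by auto
  have b_top: "filterlim b at_top sequentially"
    unfolding b_def
    by (intro filterlim_tendsto_add_at_top[OF tendsto_const]
      filterlim_compose[OF filterlim_real_sequentially filterlim_Suc])
  have lim: "e \<longlonglongrightarrow> r \<kappa> x y"
  proof -
    have "((\<lambda>\<beta>. ennreal \<beta> * resolvent X P (\<kappa> + \<beta>) (r \<kappa> x) y) \<longlongrightarrow> r \<kappa> x y) at_top"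
      using ex unfolding excessive_def by blast
    from filterlim_compose[OF this b_top] show ?thesis
      unfolding e_def .
  qed
  have K_eq: "K n x y = ennreal (real (Suc n) / b n) * e n" for n
  proof -
    have "ennreal (real (Suc n)) = ennreal (real (Suc n) / b n) * ennreal (b n)"
      using b(1)[of n] by (simp add: ennreal_mult[symmetric] del: of_nat_Suc)
    then show ?thesis unfolding K_def e_eq by (simp add: mult.assoc)
  qed
  show "incseq (\<lambda>n. K n x y)"
  proof (rule incseq_SucI)
    fix n
    have "real (Suc n) / b n \<le> real (Suc (Suc n)) / b (Suc n)"
      using b(1)[of n] b(1)[of "Suc n"] \<gamma> by (simp add: field_simps b_def)
    then show "K n x y \<le> K (Suc n) x y"
      unfolding K_eq using inc by (intro mult_mono ennreal_leI) (auto simp: incseq_SucD)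
  qed
  have "(\<lambda>n. real (Suc n) / b n) \<longlonglongrightarrow> 1"
  proof -
    have "(\<lambda>n. 1 - (\<gamma> - \<kappa>) / b n) \<longlonglongrightarrow> 1 - 0"
      by (intro tendsto_diff tendsto_const real_tendsto_divide_at_top[OF tendsto_const] b_top)
    moreover have "1 - (\<gamma> - \<kappa>) / b n = real (Suc n) / b n" for n
      using b(1)[of n] by (simp add: field_simps b_def)
    ultimately show ?thesis by simp
  qed
  then have "(\<lambda>n. ennreal (real (Suc n) / b n)) \<longlonglongrightarrow> ennreal 1"
    by (rule tendsto_ennrealI)
  then have "(\<lambda>n. ennreal (real (Suc n) / b n) * e n) \<longlonglongrightarrow> ennreal 1 * r \<kappa> x y"
    by (intro tendsto_mult_ennreal lim) auto
  then show "(\<lambda>n. K n x y) \<longlonglongrightarrow> r \<kappa> x y" unfolding K_eq by simp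
qed

text \<open>
  The resolvent equation for measures follows from the one for functions by applying the latter to
  \<open>n R\<^bsub>\<gamma>+n\<^esub> \<nu>\<close>: by excessivity of the kernels in the second variable this increases to \<open>\<nu>\<close> under
  \<open>R\<close> and \<open>R\<^sub>\<gamma>\<close>.
\<close>

lemma pot_equation:
  assumes \<gamma>: "0 < \<gamma>" and \<nu>: "sigma_finite_measure \<nu>" "sets \<nu> = sets borel"
  shows "AE x in m. pot 0 \<nu> x = pot \<gamma> \<nu> x + ennreal \<gamma> * green \<gamma> (pot 0 \<nu>) x"
proof -
  define h where "h n z = ennreal (real (Suc n)) * pot (\<gamma> + real (Suc n)) \<nu> z" for n z
  have hb[measurable]: "h n \<in> borel_measurable borel" for n
  proof -
    have [measurable]: "pot (\<gamma> + real (Suc n)) \<nu> \<in> borel_measurable borel"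
      using \<gamma> by (intro pot_measurable \<nu>) simp
    show ?thesis unfolding h_def by measurable
  qed
  define K where "K \<kappa> n x y = ennreal (real (Suc n)) * (\<integral>\<^sup>+z. r \<kappa> x z * r (\<gamma> + real (Suc n)) z y \<partial>m)" for \<kappa> n x y
  have bn: "borel_measurable \<nu> = borel_measurable borel"
    by (rule measurable_cong_sets[OF \<nu>(2) refl])
  have K_meas: "(\<lambda>y. K \<kappa> n x y) \<in> borel_measurable borel" if "0 \<le> \<kappa>" for \<kappa> n x
  proof -
    have p: "0 \<le> \<gamma> + real (Suc n)" using \<gamma> by simp
    have "(\<lambda>y. \<integral>\<^sup>+z. r \<kappa> x z * r (\<gamma> + real (Suc n)) z y \<partial>m) \<in> borel_measurable borel"
      by (rule nn_integral_measurable_m[OF _ sigma_finite_m sets_m]) (use that p in measurable)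
    then show ?thesis unfolding K_def by measurable
  qed
  have green_h: "green \<kappa> (h n) x = (\<integral>\<^sup>+y. K \<kappa> n x y \<partial>\<nu>)" if \<kappa>: "0 \<le> \<kappa>" for \<kappa> n x
  proof -
    have p: "0 \<le> \<gamma> + real (Suc n)" using \<gamma> by simp
    have "green \<kappa> (h n) x = (\<integral>\<^sup>+z. (ennreal (real (Suc n)) * r \<kappa> x z) * pot (\<gamma> + real (Suc n)) \<nu> z \<partial>m)"
      unfolding green_def h_def by (simp add: mult_ac)
    also have "\<dots> = (\<integral>\<^sup>+y. green (\<gamma> + real (Suc n)) (\<lambda>z. ennreal (real (Suc n)) * r \<kappa> x z) y \<partial>\<nu>)"
      by (rule integral_mult_pot[OF p _ \<nu>]) (use \<kappa> in measurable)
    also have "\<dots> = (\<integral>\<^sup>+y. K \<kappa> n x y \<partial>\<nu>)"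
    proof (rule nn_integral_cong)
      fix y
      have "green (\<gamma> + real (Suc n)) (\<lambda>z. ennreal (real (Suc n)) * r \<kappa> x z) y =
          ennreal (real (Suc n)) * green (\<gamma> + real (Suc n)) (\<lambda>z. r \<kappa> x z) y"
        by (rule green_cmult[OF p]) (use \<kappa> in \<open>auto intro: kernel_section_measurable\<close>)
      then show "green (\<gamma> + real (Suc n)) (\<lambda>z. ennreal (real (Suc n)) * r \<kappa> x z) y = K \<kappa> n x y"
        unfolding K_def green_def kernel_symmetric[OF p, of y] by simp
    qed
    finally show ?thesis .
  qed
  have inc: "green \<kappa> (h n) x \<le> green \<kappa> (h k) x" if "0 \<le> \<kappa>" "\<kappa> \<le> \<gamma>" "n \<le> k" for \<kappa> x n k
    unfolding green_h[OF that(1)]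
    using kernel_approximation(1)[OF \<gamma> that(1,2)] that(3)
    by (intro nn_integral_mono) (auto simp: K_def incseq_def)
  have lim: "(\<lambda>n. green \<kappa> (h n) x) \<longlonglongrightarrow> pot \<kappa> \<nu> x" if "0 \<le> \<kappa>" "\<kappa> \<le> \<gamma>" for \<kappa> x
    unfolding green_h[OF that(1)] pot_def
  proof (rule nn_integral_LIMSEQ)
    show "K \<kappa> n x \<in> borel_measurable \<nu>" for n unfolding bn by (rule K_meas[OF that(1)])
    show "incseq (\<lambda>n. K \<kappa> n x)"
      using kernel_approximation(1)[OF \<gamma> that, of x] by (auto simp: K_def incseq_def le_fun_def)
    show "(\<lambda>n. K \<kappa> n x y) \<longlonglongrightarrow> r \<kappa> x y" for y
      using kernel_approximation(2)[OF \<gamma> that, of x y] by (simp add: K_def)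
  qed
  have lim2: "(\<lambda>n. green \<gamma> (green 0 (h n)) x) \<longlonglongrightarrow> green \<gamma> (pot 0 \<nu>) x" for x
  proof (rule green_LIMSEQ)
    show "incseq (\<lambda>n. green 0 (h n))" using inc[of 0] \<gamma> by (auto simp: incseq_def le_fun_def)
    show "green 0 (h n) \<in> borel_measurable borel" for n by (rule green_measurable) auto
    show "(\<lambda>n. green 0 (h n) y) \<longlonglongrightarrow> pot 0 \<nu> y" for y using \<gamma> by (intro lim) auto

  qed (use \<gamma> in auto)
  have "AE x in m. \<forall>n. green 0 (h n) x = green \<gamma> (h n) x + ennreal \<gamma> * green \<gamma> (green 0 (h n)) x"
    unfolding AE_all_countable using resolvent_equation[OF \<gamma> hb] by auto
  then show ?thesis
  proof eventually_elim
    case (elim x)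
    have "(\<lambda>n. green \<gamma> (h n) x + ennreal \<gamma> * green \<gamma> (green 0 (h n)) x)
        \<longlonglongrightarrow> pot \<gamma> \<nu> x + ennreal \<gamma> * green \<gamma> (pot 0 \<nu>) x"
      using \<gamma> by (intro tendsto_add ennreal_tendsto_cmult lim lim2) auto
    then show ?case
      using elim lim[of 0 x] \<gamma> by (auto intro: LIMSEQ_unique)
  qed
qed

lemma form_square_expand:
  assumes u: "u \<in> D" and w: "w \<in> D"
  shows "\<E> (\<lambda>x. u x + c * w x) (\<lambda>x. u x + c * w x) = \<E> u u + 2 * c * \<E> u w + c\<^sup>2 * \<E> w w"
proof -
  have cw: "(\<lambda>x. c * w x) \<in> D" using w by (rule domain_scale)
  have s: "(\<lambda>x. u x + c * w x) \<in> D" using u cw by (rule domain_add)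
  have "\<E> v (\<lambda>x. u x + c * w x) = \<E> v u + c * \<E> v w" if v: "v \<in> D" for v
  proof -
    have "\<E> v (\<lambda>x. u x + c * w x) = \<E> (\<lambda>x. u x + c * w x) v" using v s by (rule form_sym)
    also have "\<dots> = \<E> u v + c * \<E> w v"
      unfolding form_add[OF u cw v] form_scale[OF w v] ..
    finally show ?thesis using form_sym[OF u v] form_sym[OF w v] by simp
  qed
  from this[OF s] this[OF u] this[OF w] show ?thesis
    unfolding form_add[OF u cw s] form_scale[OF w s] form_sym[OF w u]
    by (simp add: power2_eq_square algebra_simps)
qed

text \<open>
  With \<open>a = c R\<^sub>c \<phi>\<close> and \<open>h \<in> D\<close> close to \<open>\<phi>\<close>, the identity \<open>\<E>(a, a - h) = - c (a - \<phi>, a - h)\<close> and the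
  bound \<open>\<E>(a, a - h) \<ge> - \<E>(h, h) / 4\<close> control \<open>a - \<phi>\<close> in \<open>L\<^sup>2\<close>.
\<close>

lemma green_strongly_continuous:
  assumes \<phi>: "\<phi> \<in> L2 m" "\<And>x. 0 \<le> \<phi> x" and \<epsilon>: "0 < \<epsilon>"
  shows "\<exists>c0>0. \<forall>c\<ge>c0. (\<integral>x. (c * enn2real (green c (\<lambda>y. ennreal (\<phi> y)) x) - \<phi> x)\<^sup>2 \<partial>m) < \<epsilon>"
proof -
  obtain h where h: "h \<in> D" and J: "(\<integral>x. (\<phi> x - h x)\<^sup>2 \<partial>m) < \<epsilon> / 2"
    using domain_dense[OF \<phi>(1), of "\<epsilon> / 2"] \<epsilon> by auto
  have hL2: "h \<in> L2 m" using h domain_L2 by auto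
  define c0 where "c0 = \<E> h h / \<epsilon> + 1"
  have c0: "0 < c0" using form_nonneg[OF h] \<epsilon> by (simp add: c0_def add_nonneg_pos)
  have "(\<integral>x. (c * enn2real (green c (\<lambda>y. ennreal (\<phi> y)) x) - \<phi> x)\<^sup>2 \<partial>m) < \<epsilon>" if c: "c0 \<le> c" for c
  proof -
    have cpos: "0 < c" using c c0 by simp
    obtain v where v: "v \<in> D" "\<And>x. 0 \<le> v x" "AE x in m. green c (\<lambda>y. ennreal (\<phi> y)) x = ennreal (v x)"
      "\<And>w. w \<in> D \<Longrightarrow> \<E> v w = (\<integral>x. \<phi> x * w x \<partial>m) - c * (\<integral>x. v x * w x \<partial>m)"
      using green_L2[OF cpos \<phi>] by blast
    define a where "a x = c * v x" for x
    have aD: "a \<in> D" unfolding a_def by (rule domain_scale[OF v(1)])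
    have aL2: "a \<in> L2 m" using aD domain_L2 by auto
    define w where "w x = a x + (-1) * h x" for x
    have wD: "w \<in> D" unfolding w_def by (rule domain_add[OF aD domain_scale[OF h]])
    have wL2: "w \<in> L2 m" using wD domain_L2 by auto
    have pL2: "(\<lambda>x. a x - \<phi> x) \<in> L2 m" "(\<lambda>x. \<phi> x - h x) \<in> L2 m"
      by (intro L2_diff aL2 \<phi> hL2)+
    define I where "I = (\<integral>x. (a x - \<phi> x)\<^sup>2 \<partial>m)"
    define J where "J = (\<integral>x. (\<phi> x - h x)\<^sup>2 \<partial>m)"
    have ints: "integrable m (\<lambda>x. \<phi> x * w x)" "integrable m (\<lambda>x. v x * w x)" "integrable m (\<lambda>x. a x * w x)"
      "integrable m (\<lambda>x. (a x - \<phi> x)\<^sup>2)" "integrable m (\<lambda>x. (\<phi> x - h x)\<^sup>2)" "integrable m (\<lambda>x. (a x - \<phi> x) * w x)"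
      using L2_integrable_mult[OF \<phi>(1) wL2] L2_integrable_mult[OF _ wL2, of v] v(1) domain_L2 L2_integrable_mult[OF aL2 wL2]
        pL2 L2_integrable_mult[OF pL2(1) wL2] by (auto simp: L2_def)
    have "\<E> a w = c * \<E> v w" unfolding a_def by (rule form_scale[OF v(1) wD])
    also have "\<dots> = c * ((\<integral>x. \<phi> x * w x \<partial>m) - (\<integral>x. a x * w x \<partial>m))"
      unfolding v(4)[OF wD] a_def by (simp add: mult.assoc)
    also have "(\<integral>x. \<phi> x * w x \<partial>m) - (\<integral>x. a x * w x \<partial>m) = - (\<integral>x. (a x - \<phi> x) * w x \<partial>m)"
      using ints by (simp add: left_diff_distrib)
    finally have Eaw: "\<E> a w = - c * (\<integral>x. (a x - \<phi> x) * w x \<partial>m)" by simp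
    have "p\<^sup>2 / 2 - q\<^sup>2 / 2 \<le> p * (p + q)" for p q :: real
      using zero_le_power2[of "p + q"] unfolding power2_sum
      by (simp add: power2_eq_square distrib_left)
    from this[of "a x - \<phi> x" "\<phi> x - h x" for x]
    have "(a x - \<phi> x)\<^sup>2 / 2 - (\<phi> x - h x)\<^sup>2 / 2 \<le> (a x - \<phi> x) * w x" for x
      by (simp add: w_def)
    then have "(\<integral>x. (a x - \<phi> x)\<^sup>2 / 2 - (\<phi> x - h x)\<^sup>2 / 2 \<partial>m) \<le> (\<integral>x. (a x - \<phi> x) * w x \<partial>m)"
      using ints by (intro integral_mono) auto
    then have "I / 2 - J / 2 \<le> (\<integral>x. (a x - \<phi> x) * w x \<partial>m)"
      using ints by (simp add: I_def J_def)
    then have *: "c * (I / 2 - J / 2) \<le> - \<E> a w"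
      unfolding Eaw using cpos by simp
    have "\<E> a w = \<E> a a - \<E> a h"
    proof -
      have "\<E> a w = \<E> w a" by (rule form_sym[OF aD wD])
      also have "\<dots> = \<E> a a + (-1) * \<E> h a"
        unfolding w_def form_add[OF aD domain_scale[OF h] aD] form_scale[OF h aD] ..
      finally show ?thesis using form_sym[OF h aD] by simp
    qed
    moreover have "0 \<le> \<E> a a - \<E> a h + \<E> h h / 4"
      using form_nonneg[OF domain_add[OF aD domain_scale[OF h, of "-1/2"]]] form_square_expand[OF aD h, of "-1/2"]
      by (simp add: power2_eq_square)
    ultimately have "c * (I / 2 - J / 2) \<le> \<E> h h / 4" using * by simp
    then have "I - J \<le> \<E> h h / (2 * c)" using cpos by (simp add: field_simps)
    also have "\<dots> < \<epsilon> / 2"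
    proof -
      have "\<E> h h < \<epsilon> * c0" using \<epsilon> by (simp add: c0_def field_simps)
      also have "\<dots> \<le> \<epsilon> * c" using c \<epsilon> by simp
      finally show ?thesis using cpos by (simp add: field_simps)
    qed
    finally have "I < \<epsilon>" using J unfolding J_def by simp
    moreover have "(\<integral>x. (c * enn2real (green c (\<lambda>y. ennreal (\<phi> y)) x) - \<phi> x)\<^sup>2 \<partial>m) = I"
      unfolding I_def
    proof (rule integral_cong_AE)
      show "AE x in m. (c * enn2real (green c (\<lambda>y. ennreal (\<phi> y)) x) - \<phi> x)\<^sup>2 = (a x - \<phi> x)\<^sup>2"
        using v(3) by eventually_elim (simp add: a_def v(2))
      have [measurable]: "\<phi> \<in> borel_measurable borel" using \<phi>(1) by (simp add: L2_def borel_measurable_m)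
      have "green c (\<lambda>y. ennreal (\<phi> y)) \<in> borel_measurable borel"
        using cpos by (intro green_measurable) auto
      then show "(\<lambda>x. (c * enn2real (green c (\<lambda>y. ennreal (\<phi> y)) x) - \<phi> x)\<^sup>2) \<in> borel_measurable m"
        unfolding borel_measurable_m by measurable
    qed (use ints in auto)
    ultimately show ?thesis by simp
  qed
  then show ?thesis using c0 by blast
qed

lemma green_AE_approximation:
  assumes \<phi>: "\<phi> \<in> L2 m" "\<And>x. 0 \<le> \<phi> x" and \<psi>: "\<psi> \<in> L2 m" "\<And>x. 0 \<le> \<psi> x" and \<beta>: "0 \<le> \<beta>"
  obtains a :: "nat \<Rightarrow> real" where "\<And>n. 0 < a n"
    "AE x in m. (\<lambda>n. ennreal (a n) * green (\<beta> + a n) (\<lambda>y. ennreal (\<phi> y)) x) \<longlonglongrightarrow> ennreal (\<phi> x)"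
    "AE x in m. (\<lambda>n. ennreal (a n) * green (\<beta> + a n) (\<lambda>y. ennreal (\<psi> y)) x) \<longlonglongrightarrow> ennreal (\<psi> x)"
proof -
  define c where "c n = \<beta> + real (Suc n)" for n
  have c: "0 < c n" for n using \<beta> by (simp add: c_def)
  define G where "G f n x = enn2real (green (c n) (\<lambda>y. ennreal (f y)) x)" for f n x
  define d where "d f n x = (c n * G f n x - f x)\<^sup>2" for f n x
  have d_int: "integrable m (d f n)" and d_lim: "(\<lambda>n. \<integral>x. d f n x \<partial>m) \<longlonglongrightarrow> 0"
    and G_fin: "AE x in m. \<forall>n. green (c n) (\<lambda>y. ennreal (f y)) x = ennreal (G f n x)"
    if f: "f \<in> L2 m" "\<And>x. 0 \<le> f x" for f n
  proof -
    have [measurable]: "f \<in> borel_measurable borel" using f(1) by (simp add: L2_def borel_measurable_m)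
    have Gb: "G f n \<in> borel_measurable borel" for n
    proof -
      have [measurable]: "green (c n) (\<lambda>y. ennreal (f y)) \<in> borel_measurable borel"
        using c[of n] by (intro green_measurable) auto
      show ?thesis unfolding G_def by measurable
    qed
    have L: "G f n \<in> L2 m \<and> (AE x in m. green (c n) (\<lambda>y. ennreal (f y)) x = ennreal (G f n x))" for n
    proof -
      obtain v where v: "v \<in> D" "\<And>x. 0 \<le> v x" "AE x in m. green (c n) (\<lambda>y. ennreal (f y)) x = ennreal (v x)"
        using green_L2[OF c f] by blast
      have "AE x in m. \<bar>G f n x\<bar> \<le> \<bar>v x\<bar>"
        using v(3) by eventually_elim (simp add: G_def v(2))
      then have "G f n \<in> L2 m"
        using v(1) domain_L2 by (intro L2_AE_bound[OF _ Gb]) auto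
      moreover have "AE x in m. green (c n) (\<lambda>y. ennreal (f y)) x = ennreal (G f n x)"
        using v(3) by eventually_elim (simp add: G_def v(2))
      ultimately show ?thesis by simp
    qed
    show "AE x in m. \<forall>n. green (c n) (\<lambda>y. ennreal (f y)) x = ennreal (G f n x)"
      unfolding AE_all_countable using L by auto
    have "(\<lambda>x. c n * G f n x) \<in> L2 m" using L[of n] by (auto simp: L2_def power_mult_distrib)
    from L2_diff[OF this f(1)] show "integrable m (d f n)" by (simp add: L2_def d_def[abs_def])
    show "(\<lambda>n. \<integral>x. d f n x \<partial>m) \<longlonglongrightarrow> 0"
    proof (rule LIMSEQ_I)
      fix \<epsilon> :: real assume "0 < \<epsilon>"
      then obtain c0 where c0: "\<And>c. c \<ge> c0 \<Longrightarrow> (\<integral>x. (c * enn2real (green c (\<lambda>y. ennreal (f y)) x) - f x)\<^sup>2 \<partial>m) < \<epsilon>"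
        using green_strongly_continuous[OF f] by blast
      obtain N where N: "c0 \<le> real N" using real_arch_simple by blast
      have "norm ((\<integral>x. d f n x \<partial>m) - 0) < \<epsilon>" if "n \<ge> N" for n
      proof -
        have "c0 \<le> c n" using N that \<beta> by (simp add: c_def)
        from c0[OF this] have "(\<integral>x. d f n x \<partial>m) < \<epsilon>" by (simp add: d_def G_def)
        moreover have "0 \<le> (\<integral>x. d f n x \<partial>m)" by (simp add: d_def)
        ultimately show ?thesis by simp
      qed
      then show "\<exists>N. \<forall>n\<ge>N. norm ((\<integral>x. d f n x \<partial>m) - 0) < \<epsilon>" by blast
    qed
  qed
  have d_nonneg: "0 \<le> d f n x" for f n x by (simp add: d_def)
  have "(\<lambda>n. (\<integral>x. d \<phi> n x \<partial>m) + (\<integral>x. d \<psi> n x \<partial>m)) \<longlonglongrightarrow> 0 + 0"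
    by (intro tendsto_add d_lim \<phi> \<psi>)
  then have "(\<lambda>n. \<integral>x. norm (d \<phi> n x + d \<psi> n x) \<partial>m) \<longlonglongrightarrow> 0"
    using d_int[OF \<phi>] d_int[OF \<psi>] by (simp add: d_nonneg abs_of_nonneg add_nonneg_nonneg)
  from tendsto_L1_AE_subseq[OF _ this] obtain s where s: "strict_mono s"
    "AE x in m. (\<lambda>n. d \<phi> (s n) x + d \<psi> (s n) x) \<longlonglongrightarrow> 0"
    using d_int[OF \<phi>] d_int[OF \<psi>] by auto
  define a where "a n = real (Suc (s n))" for n
  have ca: "c (s n) = \<beta> + a n" for n by (simp add: c_def a_def)
  have apos: "0 < a n" for n by (simp add: a_def)
  have "filterlim (\<lambda>n. c (s n)) at_top sequentially"
    unfolding c_def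
    by (rule filterlim_tendsto_add_at_top[OF tendsto_const filterlim_compose[OF
      filterlim_real_sequentially filterlim_compose[OF filterlim_Suc filterlim_subseq[OF s(1)]]]])
  then have "(\<lambda>n. 1 - \<beta> / c (s n)) \<longlonglongrightarrow> 1 - 0"
    by (intro tendsto_diff tendsto_const real_tendsto_divide_at_top[OF tendsto_const])
  moreover have "1 - \<beta> / c (s n) = a n / c (s n)" for n
    using c[of "s n"] unfolding ca by (simp add: field_simps)
  ultimately have ratio: "(\<lambda>n. a n / c (s n)) \<longlonglongrightarrow> 1" by simp
  have conv: "(\<lambda>n. ennreal (a n) * green (\<beta> + a n) (\<lambda>y. ennreal (f y)) x) \<longlonglongrightarrow> ennreal (f x)"
    if fin: "\<forall>n. green (c n) (\<lambda>y. ennreal (f y)) x = ennreal (G f n x)" and lim: "(\<lambda>n. d f (s n) x) \<longlonglongrightarrow> 0" for f x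
  proof -
    have "(\<lambda>n. sqrt (d f (s n) x)) \<longlonglongrightarrow> sqrt 0" by (intro tendsto_real_sqrt lim)
    then have "(\<lambda>n. \<bar>c (s n) * G f (s n) x - f x\<bar>) \<longlonglongrightarrow> 0" by (simp add: d_def)
    then have "(\<lambda>n. c (s n) * G f (s n) x - f x) \<longlonglongrightarrow> 0" by (rule tendsto_rabs_zero_cancel)
    from tendsto_add[OF this tendsto_const[of "f x"]]
    have "(\<lambda>n. c (s n) * G f (s n) x) \<longlonglongrightarrow> f x" by simp
    from tendsto_mult[OF ratio this]
    have "(\<lambda>n. a n * G f (s n) x) \<longlonglongrightarrow> f x" using c by (simp add: less_imp_neq[symmetric])
    from tendsto_ennrealI[OF this] show ?thesis
      using fin apos by (simp add: ca[symmetric] ennreal_mult' less_imp_le)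
  qed
  have half: "(\<lambda>n. d f (s n) x) \<longlonglongrightarrow> 0" if "(\<lambda>n. d f (s n) x + d g (s n) x) \<longlonglongrightarrow> 0" for f g x
    by (rule tendsto_sandwich[OF _ _ tendsto_const that]) (auto intro!: always_eventually simp: d_nonneg)
  show ?thesis
  proof
    show "0 < a n" for n by (rule apos)
    show "AE x in m. (\<lambda>n. ennreal (a n) * green (\<beta> + a n) (\<lambda>y. ennreal (\<phi> y)) x) \<longlonglongrightarrow> ennreal (\<phi> x)"
      using s(2) G_fin[OF \<phi>] by eventually_elim (intro conv half[of \<phi> _ \<psi>])
    show "AE x in m. (\<lambda>n. ennreal (a n) * green (\<beta> + a n) (\<lambda>y. ennreal (\<psi> y)) x) \<longlonglongrightarrow> ennreal (\<psi> x)"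
      using s(2) G_fin[OF \<psi>] by eventually_elim (intro conv half[of \<psi> _ \<phi>], auto simp: add.commute)
  qed
qed

subsection \<open>Kato's inequality\<close>

lemma excessive_green_le:
  assumes "excessive X P 0 \<rho>" "0 < \<alpha>"
  shows "ennreal \<alpha> * green \<alpha> \<rho> x \<le> \<rho> x"
  using assms unfolding excessive_def by (auto simp: resolvent_eq_green)

lemma excessive_borel:
  assumes \<rho>: "excessive X P 0 \<rho>"
  shows "\<rho> \<in> borel_measurable borel"
proof -
  have u: "\<rho> \<in> borel_measurable universal_borel" using \<rho> by (simp add: excessive_def)
  obtain \<rho>' where \<rho>': "\<rho>' \<in> borel_measurable borel" "AE x in m. \<rho> x = \<rho>' x"
    by (rule universal_borel_AE_eq[OF u])
  show ?thesis
  proof (rule borel_measurable_LIMSEQ_order)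
    show "(\<lambda>x. ennreal (real n) * green (real n) \<rho>' x) \<in> borel_measurable borel" for n
      using green_measurable[OF _ \<rho>'(1), of "real n"] by simp
    fix x
    have "((\<lambda>\<beta>. ennreal \<beta> * resolvent X P (0 + \<beta>) \<rho> x) \<longlongrightarrow> \<rho> x) at_top"
      using \<rho> unfolding excessive_def by blast
    from filterlim_compose[OF this filterlim_real_sequentially]
    show "(\<lambda>n. ennreal (real n) * green (real n) \<rho>' x) \<longlonglongrightarrow> \<rho> x"
      using u by (simp add: resolvent_eq_green green_cong_AE[OF \<rho>'(2)])
  qed
qed

lemma killed_green_pot_tendsto_zero:
  assumes \<nu>: "sigma_finite_measure \<nu>" "sets \<nu> = sets borel"
    and K[measurable]: "K \<in> borel_measurable borel" and fin: "(\<integral>\<^sup>+x. K x * pot 0 \<nu> x \<partial>m) < \<infinity>"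
  defines "b \<equiv> \<lambda>j. 1 / real (Suc j)"
  shows "(\<lambda>j. \<integral>\<^sup>+x. K x * (ennreal (b j) * green (b j) (pot 0 \<nu>) x) \<partial>m) \<longlonglongrightarrow> 0"
proof -
  have b: "0 < b j" for j by (simp add: b_def)
  define T where "T \<beta> = (\<integral>\<^sup>+x. K x * pot \<beta> \<nu> x \<partial>m)" for \<beta>
  have T_eq: "T \<beta> = (\<integral>\<^sup>+y. green \<beta> K y \<partial>\<nu>)" if "0 \<le> \<beta>" for \<beta>
    unfolding T_def by (rule integral_mult_pot[OF that K \<nu>])
  have T_lim: "(\<lambda>j. T (b j)) \<longlonglongrightarrow> T 0"
    unfolding T_eq[OF less_imp_le[OF b]] T_eq[OF order_refl]
  proof (rule nn_integral_LIMSEQ)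
    have "b n \<le> b k" if "k \<le> n" for k n unfolding b_def using that by (intro divide_left_mono) auto
    then have "green (b k) K x \<le> green (b n) K x" if "k \<le> n" for k n x
      using that b[of n] by (intro green_antimono) auto
    then show "incseq (\<lambda>j. green (b j) K)" by (simp add: incseq_def le_fun_def)
    show "green (b j) K \<in> borel_measurable \<nu>" for j
      using green_measurable[OF less_imp_le[OF b] K] by (subst measurable_cong_sets[OF \<nu>(2) refl])
    show "(\<lambda>j. green (b j) K y) \<longlonglongrightarrow> green 0 K y" for y
      unfolding b_def by (rule green_zero_LIMSEQ[OF K])
  qed
  define E where "E j = (\<integral>\<^sup>+x. K x * (ennreal (b j) * green (b j) (pot 0 \<nu>) x) \<partial>m)" for j
  have p[measurable]: "pot \<beta> \<nu> \<in> borel_measurable borel" if "0 \<le> \<beta>" for \<beta>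
    using that by (rule pot_measurable[OF _ \<nu>])
  have split: "T 0 = T (b j) + E j" for j
  proof -
    have [measurable]: "pot (b j) \<nu> \<in> borel_measurable borel" "green (b j) (pot 0 \<nu>) \<in> borel_measurable borel"
      using b[of j] by (auto intro!: green_measurable p)
    have "T 0 = (\<integral>\<^sup>+x. K x * pot (b j) \<nu> x + K x * (ennreal (b j) * green (b j) (pot 0 \<nu>) x) \<partial>m)"
      unfolding T_def using pot_equation[OF b \<nu>, of j]
      by (intro nn_integral_cong_AE) (auto elim!: eventually_mono simp: distrib_left[symmetric])
    also have "\<dots> = T (b j) + E j"
      unfolding T_def E_def by (intro nn_integral_add) (simp_all add: borel_measurable_m)
    finally show ?thesis .
  qed
  have T0: "T 0 \<noteq> top" using fin by (simp add: T_def)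
  have Tj: "T (b j) \<noteq> top" for j using T0 split[of j] by auto
  have "E j = T 0 - T (b j)" for j
    using split[of j] Tj[of j] by (simp add: ennreal_add_diff_cancel_left)
  then have "E = (\<lambda>j. T 0 - T (b j))" ..
  then have "E \<longlonglongrightarrow> T 0 - T 0"
    using tendsto_diff_ennreal[OF tendsto_const T_lim T0 T0] by simp
  then show ?thesis using T0 by (simp add: E_def[abs_def])
qed

lemma killed_green_pot_le:
  assumes \<beta>: "0 < \<beta>" and \<nu>: "sigma_finite_measure \<nu>" "sets \<nu> = sets borel"
  shows "AE x in m. ennreal \<beta> * green \<beta> (pot 0 \<nu>) x \<le> pot 0 \<nu> x"
  using pot_equation[OF \<beta> \<nu>] by eventually_elim simp

text \<open>
  The subtraction-free form of \<open>\<integral> \<eta> sgn(u) a R\<^bsub>\<beta>+a\<^esub>(\<nu>\<^sub>1 - \<nu>\<^sub>2) dm \<ge> - \<beta> \<integral> \<eta> \<bar>u\<bar> dm\<close> for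
  \<open>u = R(\<nu>\<^sub>1 - \<nu>\<^sub>2)\<close>; the function \<open>d\<close> is \<open>\<bar>u\<bar>\<close>, since \<^term>\<open>x - y\<close> is truncated at \<open>0\<close> in \<^typ>\<open>ennreal\<close>.
\<close>

lemma kato_inequality:
  fixes \<beta> a :: real
  assumes \<beta>: "0 \<le> \<beta>" and a: "0 < a"
    and \<nu>1: "sigma_finite_measure \<nu>1" "sets \<nu>1 = sets borel"
    and \<nu>2: "sigma_finite_measure \<nu>2" "sets \<nu>2 = sets borel"
    and fin1: "AE x in m. pot 0 \<nu>1 x < \<infinity>" and fin2: "AE x in m. pot 0 \<nu>2 x < \<infinity>"
    and \<eta>[measurable]: "\<eta> \<in> borel_measurable borel"
    and median: "AE x in m. ennreal a * green (\<beta> + a) \<eta> x \<le> \<eta> x"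
  defines "d \<equiv> \<lambda>x. (pot 0 \<nu>1 x - pot 0 \<nu>2 x) + (pot 0 \<nu>2 x - pot 0 \<nu>1 x)"
    and "A \<equiv> {x. pot 0 \<nu>2 x < pot 0 \<nu>1 x}" and "B \<equiv> {x. pot 0 \<nu>1 x < pot 0 \<nu>2 x}"
  assumes fin: "(\<integral>\<^sup>+x. \<eta> x * d x \<partial>m) < \<infinity>"
  shows "ennreal a * ((\<integral>\<^sup>+x. \<eta> x * indicator A x * pot (\<beta> + a) \<nu>2 x \<partial>m)
        + (\<integral>\<^sup>+x. \<eta> x * indicator B x * pot (\<beta> + a) \<nu>1 x \<partial>m))
    \<le> ennreal a * ((\<integral>\<^sup>+x. \<eta> x * indicator A x * pot (\<beta> + a) \<nu>1 x \<partial>m)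
        + (\<integral>\<^sup>+x. \<eta> x * indicator B x * pot (\<beta> + a) \<nu>2 x \<partial>m)) + ennreal \<beta> * (\<integral>\<^sup>+x. \<eta> x * d x \<partial>m)"
proof -
  define c where "c = \<beta> + a"
  have c: "0 < c" "0 \<le> c" using \<beta> a by (auto simp: c_def)
  define p q where "p = pot 0 \<nu>1" and "q = pot 0 \<nu>2"
  have [measurable]: "p \<in> borel_measurable borel" "q \<in> borel_measurable borel"
    "pot c \<nu>1 \<in> borel_measurable borel" "pot c \<nu>2 \<in> borel_measurable borel"
    unfolding p_def q_def using c by (auto intro!: pot_measurable \<nu>1 \<nu>2)
  have d: "d = (\<lambda>x. (p x - q x) + (q x - p x))" unfolding d_def p_def q_def ..
  have A: "A = {x. q x < p x}" and B: "B = {x. p x < q x}"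
    unfolding A_def B_def p_def q_def by auto
  have [measurable]: "d \<in> borel_measurable borel" "A \<in> sets borel" "B \<in> sets borel"
    unfolding d A B by measurable
  have [measurable]: "green c d \<in> borel_measurable borel" "green c \<eta> \<in> borel_measurable borel"
    using c by (auto intro!: green_measurable)
  have le_d: "p x \<le> q x + d x" "q x \<le> p x + d x" for x
  proof -
    have *: "s \<le> t + (s - t)" for s t :: ennreal
      by (cases "t \<le> s") (simp_all add: add_diff_inverse_ennreal add_increasing2)
    show "p x \<le> q x + d x"
      unfolding d using *[of "p x" "q x"] by (metis add.assoc add_increasing2 zero_le)
    show "q x \<le> p x + d x"
      unfolding d using *[of "q x" "p x"] by (metis add.assoc add.commute add_increasing2 zero_le)
  qed
  have green_le: "green c p x \<le> green c q x + green c d x" "green c q x \<le> green c p x + green c d x" for x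
    using c le_d by (auto simp: green_add[symmetric] intro!: green_mono)
  have sub: "t2 + (s - t) \<le> s1 + c' * g" if eqs: "s = s1 + c' * gs" "t = t2 + c' * gt" "gs \<le> gt + g"
    and "t \<le> s" and "t < top" for s t s1 t2 gs gt g c' :: ennreal
  proof -
    have "c' * gt + (t2 + (s - t)) = t + (s - t)" using eqs by (simp add: ac_simps)
    also have "\<dots> = s" using that by (intro add_diff_inverse_ennreal)
    also have "\<dots> \<le> s1 + c' * (gt + g)" unfolding eqs(1) using eqs(3) by (intro add_left_mono mult_left_mono) auto
    also have "\<dots> = c' * gt + (s1 + c' * g)" by (simp add: distrib_left ac_simps)
    finally show ?thesis using eqs(2) \<open>t < top\<close> by (auto simp: ennreal_add_left_cancel_le)
  qed
  have "AE x in m. \<eta> x * indicator A x * pot c \<nu>2 x + \<eta> x * indicator B x * pot c \<nu>1 x + \<eta> x * d x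
      \<le> \<eta> x * indicator A x * pot c \<nu>1 x + \<eta> x * indicator B x * pot c \<nu>2 x + ennreal c * (\<eta> x * green c d x)"
    using fin1 fin2 pot_equation[OF c(1) \<nu>1] pot_equation[OF c(1) \<nu>2]
  proof eventually_elim
    case (elim x)
    then have e: "p x < top" "q x < top" "p x = pot c \<nu>1 x + ennreal c * green c p x"
        "q x = pot c \<nu>2 x + ennreal c * green c q x"
      by (simp_all add: p_def q_def)
    consider "x \<in> A" "x \<notin> B" "q x < p x" | "x \<notin> A" "x \<in> B" "p x < q x" | "x \<notin> A" "x \<notin> B" "p x = q x"
      unfolding A B using less_linear[of "p x" "q x"] by fastforce
    then show ?case
    proof cases
      case 1
      have "d x = p x - q x" unfolding d using 1(3) e(2) by (simp add: diff_eq_0_iff_ennreal less_imp_le)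
      then have "pot c \<nu>2 x + d x \<le> pot c \<nu>1 x + ennreal c * green c d x"
        using sub[OF e(3,4) green_le(1)] 1 e by simp
      from mult_left_mono[OF this, of "\<eta> x"] 1 show ?thesis by (simp add: distrib_left mult_ac)
    next
      case 2
      have "d x = q x - p x" unfolding d using 2(3) e(1) by (simp add: diff_eq_0_iff_ennreal less_imp_le)
      then have "pot c \<nu>1 x + d x \<le> pot c \<nu>2 x + ennreal c * green c d x"
        using sub[OF e(4,3) green_le(2)] 2 e by simp
      from mult_left_mono[OF this, of "\<eta> x"] 2 show ?thesis by (simp add: distrib_left mult_ac)
    next
      case 3
      then have "d x = 0" unfolding d using e(2) by (simp add: diff_eq_0_iff_ennreal)
      then show ?thesis using 3 by simp
    qed
  qed
  then have int: "(\<integral>\<^sup>+x. \<eta> x * indicator A x * pot c \<nu>2 x + \<eta> x * indicator B x * pot c \<nu>1 x + \<eta> x * d x \<partial>m)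
      \<le> (\<integral>\<^sup>+x. \<eta> x * indicator A x * pot c \<nu>1 x + \<eta> x * indicator B x * pot c \<nu>2 x + ennreal c * (\<eta> x * green c d x) \<partial>m)"
    by (rule nn_integral_mono_AE)
  define S1 where "S1 = (\<integral>\<^sup>+x. \<eta> x * indicator A x * pot c \<nu>2 x \<partial>m) + (\<integral>\<^sup>+x. \<eta> x * indicator B x * pot c \<nu>1 x \<partial>m)"
  define S2 where "S2 = (\<integral>\<^sup>+x. \<eta> x * indicator A x * pot c \<nu>1 x \<partial>m) + (\<integral>\<^sup>+x. \<eta> x * indicator B x * pot c \<nu>2 x \<partial>m)"
  define K where "K = (\<integral>\<^sup>+x. \<eta> x * d x \<partial>m)"
  define L where "L = (\<integral>\<^sup>+x. \<eta> x * green c d x \<partial>m)"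
  from int have main: "S1 + K \<le> S2 + ennreal c * L"
    unfolding S1_def S2_def K_def L_def
    by (simp add: nn_integral_add nn_integral_cmult borel_measurable_m)
  have "ennreal a * L = (\<integral>\<^sup>+x. ennreal a * green c \<eta> x * d x \<partial>m)"
    unfolding L_def using c
    by (simp add: green_symmetric nn_integral_cmult borel_measurable_m mult.assoc)
  also have "\<dots> \<le> K"
    unfolding K_def using median
    by (intro nn_integral_mono_AE) (auto elim!: eventually_mono intro!: mult_right_mono simp: c_def)
  finally have aL: "ennreal a * L \<le> K" .
  have "K + S1 \<le> S2 + (ennreal a * L + ennreal \<beta> * L)"
    using main \<beta> a by (simp add: c_def ennreal_plus distrib_right add.commute)
  also have "\<dots> \<le> S2 + (K + ennreal \<beta> * L)"
    by (intro add_left_mono add_right_mono aL)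
  also have "\<dots> = K + (S2 + ennreal \<beta> * L)"
    by (simp add: ac_simps)
  finally have "S1 \<le> S2 + ennreal \<beta> * L"
    using fin by (auto simp: ennreal_add_left_cancel_le K_def)
  then have "ennreal a * S1 \<le> ennreal a * (S2 + ennreal \<beta> * L)"
    by (rule mult_left_mono) simp
  also have "\<dots> = ennreal a * S2 + ennreal \<beta> * (ennreal a * L)"
    by (simp add: distrib_left mult_ac)
  also have "\<dots> \<le> ennreal a * S2 + ennreal \<beta> * K"
    using aL by (intro add_left_mono mult_left_mono) auto
  finally show ?thesis unfolding S1_def S2_def K_def c_def .
qed

lemma kato_limit:
  fixes \<beta> :: real and e :: "'a \<Rightarrow> real"
  assumes \<beta>: "0 \<le> \<beta>"
    and g1: "g1 \<in> borel_measurable borel" "AE x in m. g1 x < \<infinity>"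
    and g2: "g2 \<in> borel_measurable borel" "AE x in m. g2 x < \<infinity>"
    and \<mu>1: "sigma_finite_measure \<mu>1" "sets \<mu>1 = sets borel"
    and \<mu>2: "sigma_finite_measure \<mu>2" "sets \<mu>2 = sets borel"
    and e: "e \<in> L2 m" "\<And>x. 0 \<le> e x"
    and median: "\<And>a. 0 < a \<Longrightarrow> AE x in m. ennreal a * green (\<beta> + a) (\<lambda>x. ennreal (e x)) x \<le> ennreal (e x)"
    and dominated: "\<And>a y. 0 < a \<Longrightarrow> ennreal a * green (\<beta> + a) (\<lambda>x. ennreal (e x)) y \<le> \<rho> y"
    and eg1: "(\<integral>\<^sup>+x. ennreal (e x) * g1 x \<partial>m) < \<infinity>" and eg2: "(\<integral>\<^sup>+x. ennreal (e x) * g2 x \<partial>m) < \<infinity>"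
  defines "\<nu>1 \<equiv> total_variation (density m g1, \<mu>1)" and "\<nu>2 \<equiv> total_variation (density m g2, \<mu>2)"
  defines "d \<equiv> \<lambda>x. (pot 0 \<nu>1 x - pot 0 \<nu>2 x) + (pot 0 \<nu>2 x - pot 0 \<nu>1 x)"
    and "A \<equiv> {x. pot 0 \<nu>2 x < pot 0 \<nu>1 x}" and "B \<equiv> {x. pot 0 \<nu>1 x < pot 0 \<nu>2 x}"
  assumes fin1: "AE x in m. pot 0 \<nu>1 x < \<infinity>" and fin2: "AE x in m. pot 0 \<nu>2 x < \<infinity>"
    and fin: "(\<integral>\<^sup>+x. ennreal (e x) * d x \<partial>m) < \<infinity>"
  shows "(\<integral>\<^sup>+x. ennreal (e x) * indicator A x * g2 x \<partial>m) + (\<integral>\<^sup>+x. ennreal (e x) * indicator B x * g1 x \<partial>m)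
    \<le> (\<integral>\<^sup>+x. ennreal (e x) * indicator A x * g1 x \<partial>m) + (\<integral>\<^sup>+x. ennreal (e x) * indicator B x * g2 x \<partial>m)
      + ((\<integral>\<^sup>+x. \<rho> x \<partial>\<mu>1) + (\<integral>\<^sup>+x. \<rho> x \<partial>\<mu>2)) + ennreal \<beta> * (\<integral>\<^sup>+x. ennreal (e x) * d x \<partial>m)"
proof -
  note [measurable] = g1(1) g2(1)
  have [measurable]: "e \<in> borel_measurable borel" using e(1) by (simp add: L2_def borel_measurable_m)
  note \<nu>1 = total_variation_density[OF g1 \<mu>1, folded \<nu>1_def]
    and \<nu>2 = total_variation_density[OF g2 \<mu>2, folded \<nu>2_def]
  have [measurable]: "pot 0 \<nu>1 \<in> borel_measurable borel" "pot 0 \<nu>2 \<in> borel_measurable borel"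
    by (auto intro!: pot_measurable \<nu>1 \<nu>2)
  have [measurable]: "A \<in> sets borel" "B \<in> sets borel"
    unfolding A_def B_def by measurable
  define \<phi> where "\<phi> S x = e x * indicator S x" for S x
  have \<phi>: "\<phi> S \<in> L2 m" "\<And>x. 0 \<le> \<phi> S x" "(\<lambda>x. ennreal (\<phi> S x)) \<in> borel_measurable borel"
    if [measurable]: "S \<in> sets borel" for S
  proof -
    have "\<phi> S \<in> borel_measurable borel" unfolding \<phi>_def by measurable
    then show "\<phi> S \<in> L2 m" "(\<lambda>x. ennreal (\<phi> S x)) \<in> borel_measurable borel"
      by (auto intro!: L2_AE_bound[OF e(1)] simp: \<phi>_def indicator_def)
    show "0 \<le> \<phi> S x" for x using e(2) by (simp add: \<phi>_def)
  qed
  have e\<phi>: "ennreal (e x) * indicator S x = ennreal (\<phi> S x)" for S x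
    by (simp add: \<phi>_def indicator_def)
  have \<phi>_le: "ennreal (\<phi> S x) \<le> ennreal (e x)" for S x
    using e(2)[of x] by (auto simp: \<phi>_def indicator_def)
  obtain a :: "nat \<Rightarrow> real" where a: "\<And>n. 0 < a n"
    "AE x in m. (\<lambda>n. ennreal (a n) * green (\<beta> + a n) (\<lambda>y. ennreal (\<phi> A y)) x) \<longlonglongrightarrow> ennreal (\<phi> A x)"
    "AE x in m. (\<lambda>n. ennreal (a n) * green (\<beta> + a n) (\<lambda>y. ennreal (\<phi> B y)) x) \<longlonglongrightarrow> ennreal (\<phi> B x)"
    using green_AE_approximation[OF \<phi>(1,2) \<phi>(1,2) \<beta>, of A B] by auto
  define G where "G S n x = ennreal (a n) * green (\<beta> + a n) (\<lambda>y. ennreal (\<phi> S y)) x" for S n x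
  have G_meas[measurable]: "G S n \<in> borel_measurable borel" if "S \<in> sets borel" for S n
  proof -
    have [measurable]: "green (\<beta> + a n) (\<lambda>y. ennreal (\<phi> S y)) \<in> borel_measurable borel"
      using \<beta> a(1)[of n] that by (intro green_measurable \<phi>) auto
    show ?thesis unfolding G_def by measurable
  qed
  have G_le: "G S n x \<le> ennreal (a n) * green (\<beta> + a n) (\<lambda>x. ennreal (e x)) x" for S n x
    unfolding G_def by (intro mult_left_mono green_mono \<phi>_le) auto
  have G_\<rho>: "G S n x \<le> \<rho> x" for S n x
    using G_le dominated[OF a(1)] by (rule order_trans)
  have G_e: "AE x in m. G S n x \<le> ennreal (e x)" for S n
    using median[OF a(1)] by eventually_elim (rule order_trans[OF G_le])
  have G_lim: "(\<lambda>n. \<integral>\<^sup>+x. G S n x * g x \<partial>m) \<longlonglongrightarrow> (\<integral>\<^sup>+x. ennreal (e x) * indicator S x * g x \<partial>m)"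
    if g[measurable]: "g \<in> borel_measurable borel" and gfin: "AE x in m. g x < \<infinity>"
      and eg: "(\<integral>\<^sup>+x. ennreal (e x) * g x \<partial>m) < \<infinity>"
      and S: "AE x in m. (\<lambda>n. G S n x) \<longlonglongrightarrow> ennreal (\<phi> S x)" and [measurable]: "S \<in> sets borel" for S g
    unfolding e\<phi>
  proof (rule nn_integral_dominated_convergence[where w="\<lambda>x. ennreal (e x) * g x"])
    show "AE x in m. G S n x * g x \<le> ennreal (e x) * g x" for n
      using G_e[of S n] by eventually_elim (rule mult_right_mono, auto)
    show "AE x in m. (\<lambda>n. G S n x * g x) \<longlonglongrightarrow> ennreal (\<phi> S x) * g x"
      using S gfin
    proof eventually_elim
      case (elim x)
      then show ?case by (intro tendsto_mult_ennreal tendsto_const) auto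
    qed
    have "(\<lambda>x. ennreal (\<phi> S x)) \<in> borel_measurable borel" by (rule \<phi>(3)) fact
    then show "(\<lambda>x. ennreal (\<phi> S x) * g x) \<in> borel_measurable m"
      unfolding borel_measurable_m by measurable
  qed (use eg in \<open>simp_all add: borel_measurable_m\<close>)
  have swap: "ennreal (a n) * (\<integral>\<^sup>+x. ennreal (e x) * indicator S x * pot (\<beta> + a n) (total_variation (density m g, \<mu>)) x \<partial>m)
      = (\<integral>\<^sup>+x. G S n x * g x \<partial>m) + (\<integral>\<^sup>+x. G S n x \<partial>\<mu>)"
    if g[measurable]: "g \<in> borel_measurable borel" and \<nu>: "sigma_finite_measure (total_variation (density m g, \<mu>))"
      and \<mu>: "sets \<mu> = sets borel" and S: "S \<in> sets borel" for S g \<mu> n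
  proof -
    have pos: "0 \<le> \<beta> + a n" using \<beta> a(1)[of n] by simp
    have dg: "sets (density m g) = sets borel" by (simp add: sets_m)
    note tv = sets_total_variation[OF dg \<mu>]
    have gm: "green (\<beta> + a n) (\<lambda>x. ennreal (\<phi> S x)) \<in> borel_measurable borel"
      by (intro green_measurable pos \<phi>(3) S)
    have "ennreal (a n) * (\<integral>\<^sup>+x. ennreal (e x) * indicator S x * pot (\<beta> + a n) (total_variation (density m g, \<mu>)) x \<partial>m)
        = ennreal (a n) * (\<integral>\<^sup>+y. green (\<beta> + a n) (\<lambda>x. ennreal (\<phi> S x)) y \<partial>total_variation (density m g, \<mu>))"
      unfolding e\<phi> by (subst integral_mult_pot[OF pos \<phi>(3)[OF S] \<nu> tv]) (rule refl)
    also have "\<dots> = (\<integral>\<^sup>+y. G S n y \<partial>total_variation (density m g, \<mu>))"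
      unfolding G_def using gm
      by (intro nn_integral_cmult[symmetric]) (subst measurable_cong_sets[OF tv refl])
    also have "\<dots> = (\<integral>\<^sup>+y. G S n y \<partial>density m g) + (\<integral>\<^sup>+y. G S n y \<partial>\<mu>)"
      by (rule nn_integral_total_variation[OF dg \<mu> G_meas[OF S]])
    also have "(\<integral>\<^sup>+y. G S n y \<partial>density m g) = (\<integral>\<^sup>+y. G S n y * g y \<partial>m)"
      using G_meas[OF S] g by (subst nn_integral_density) (simp_all add: borel_measurable_m mult.commute)
    finally show ?thesis .
  qed
  have e_b: "(\<lambda>x. ennreal (e x)) \<in> borel_measurable borel" by measurable
  have step: "(\<integral>\<^sup>+x. G A n x * g2 x \<partial>m) + (\<integral>\<^sup>+x. G B n x * g1 x \<partial>m)
      \<le> (\<integral>\<^sup>+x. G A n x * g1 x \<partial>m) + (\<integral>\<^sup>+x. G B n x * g2 x \<partial>m)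
        + ((\<integral>\<^sup>+x. \<rho> x \<partial>\<mu>1) + (\<integral>\<^sup>+x. \<rho> x \<partial>\<mu>2)) + ennreal \<beta> * (\<integral>\<^sup>+x. ennreal (e x) * d x \<partial>m)" for n
  proof -
    let ?T = "ennreal \<beta> * (\<integral>\<^sup>+x. ennreal (e x) * d x \<partial>m)"
    have "(\<integral>\<^sup>+x. G A n x * g2 x \<partial>m) + (\<integral>\<^sup>+x. G B n x * g1 x \<partial>m)
        \<le> ((\<integral>\<^sup>+x. G A n x * g2 x \<partial>m) + (\<integral>\<^sup>+x. G A n x \<partial>\<mu>2)) + ((\<integral>\<^sup>+x. G B n x * g1 x \<partial>m) + (\<integral>\<^sup>+x. G B n x \<partial>\<mu>1))"
      by (intro add_mono) auto
    also have "\<dots> = ennreal (a n) * ((\<integral>\<^sup>+x. ennreal (e x) * indicator A x * pot (\<beta> + a n) \<nu>2 x \<partial>m)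
        + (\<integral>\<^sup>+x. ennreal (e x) * indicator B x * pot (\<beta> + a n) \<nu>1 x \<partial>m))"
      unfolding \<nu>1_def \<nu>2_def distrib_left
      by (simp add: swap \<nu>1[unfolded \<nu>1_def] \<nu>2[unfolded \<nu>2_def] \<mu>1 \<mu>2)
    also have "\<dots> \<le> ennreal (a n) * ((\<integral>\<^sup>+x. ennreal (e x) * indicator A x * pot (\<beta> + a n) \<nu>1 x \<partial>m)
        + (\<integral>\<^sup>+x. ennreal (e x) * indicator B x * pot (\<beta> + a n) \<nu>2 x \<partial>m)) + ?T"
      unfolding A_def B_def d_def
      by (rule kato_inequality[OF \<beta> a(1) \<nu>1 \<nu>2 fin1 fin2 e_b median[OF a(1)]]) (use fin in \<open>simp add: d_def\<close>)
    also have "\<dots> = ((\<integral>\<^sup>+x. G A n x * g1 x \<partial>m) + (\<integral>\<^sup>+x. G A n x \<partial>\<mu>1)) + ((\<integral>\<^sup>+x. G B n x * g2 x \<partial>m) + (\<integral>\<^sup>+x. G B n x \<partial>\<mu>2)) + ?T"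
      unfolding \<nu>1_def \<nu>2_def distrib_left
      by (simp add: swap \<nu>1[unfolded \<nu>1_def] \<nu>2[unfolded \<nu>2_def] \<mu>1 \<mu>2)
    also have "\<dots> \<le> ((\<integral>\<^sup>+x. G A n x * g1 x \<partial>m) + (\<integral>\<^sup>+x. \<rho> x \<partial>\<mu>1)) + ((\<integral>\<^sup>+x. G B n x * g2 x \<partial>m) + (\<integral>\<^sup>+x. \<rho> x \<partial>\<mu>2)) + ?T"
      by (intro add_mono order_refl nn_integral_mono G_\<rho>)
    finally show ?thesis by (simp add: ac_simps)
  qed
  have GA: "AE x in m. (\<lambda>n. G A n x) \<longlonglongrightarrow> ennreal (\<phi> A x)" and GB: "AE x in m. (\<lambda>n. G B n x) \<longlonglongrightarrow> ennreal (\<phi> B x)"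
    using a(2,3) by (simp_all add: G_def)
  show ?thesis
  proof (rule LIMSEQ_le)
    show "(\<lambda>n. (\<integral>\<^sup>+x. G A n x * g2 x \<partial>m) + (\<integral>\<^sup>+x. G B n x * g1 x \<partial>m)) \<longlonglongrightarrow>
        (\<integral>\<^sup>+x. ennreal (e x) * indicator A x * g2 x \<partial>m) + (\<integral>\<^sup>+x. ennreal (e x) * indicator B x * g1 x \<partial>m)"
      by (intro tendsto_add G_lim g1 g2 eg1 eg2 GA GB) measurable
    show "(\<lambda>n. (\<integral>\<^sup>+x. G A n x * g1 x \<partial>m) + (\<integral>\<^sup>+x. G B n x * g2 x \<partial>m)
        + ((\<integral>\<^sup>+x. \<rho> x \<partial>\<mu>1) + (\<integral>\<^sup>+x. \<rho> x \<partial>\<mu>2)) + ennreal \<beta> * (\<integral>\<^sup>+x. ennreal (e x) * d x \<partial>m)) \<longlonglongrightarrow>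
      (\<integral>\<^sup>+x. ennreal (e x) * indicator A x * g1 x \<partial>m) + (\<integral>\<^sup>+x. ennreal (e x) * indicator B x * g2 x \<partial>m)
        + ((\<integral>\<^sup>+x. \<rho> x \<partial>\<mu>1) + (\<integral>\<^sup>+x. \<rho> x \<partial>\<mu>2)) + ennreal \<beta> * (\<integral>\<^sup>+x. ennreal (e x) * d x \<partial>m)"
      by (intro tendsto_add tendsto_const G_lim g1 g2 eg1 eg2 GA GB) measurable
  qed (use step in blast)
qed

subsection \<open>The weighted estimate\<close>

text \<open>
  For \<open>\<beta> > 0\<close> the weight \<open>min \<rho> (R\<^sub>\<beta> k)\<close> makes every integral finite, even though \<open>\<rho> \<bar>u\<bar>\<close> need not be
  integrable; letting \<open>\<beta> \<rightarrow> 0\<close> leaves the weight \<open>min \<rho> (R k)\<close>.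
\<close>

lemma weighted_estimate_potential:
  assumes \<rho>: "excessive X P 0 \<rho>"
    and g1: "g1 \<in> borel_measurable borel" "AE x in m. g1 x < \<infinity>"
    and g2: "g2 \<in> borel_measurable borel" "AE x in m. g2 x < \<infinity>"
    and \<mu>1: "sigma_finite_measure \<mu>1" "sets \<mu>1 = sets borel"
    and \<mu>2: "sigma_finite_measure \<mu>2" "sets \<mu>2 = sets borel"
  defines "\<nu>1 \<equiv> total_variation (density m g1, \<mu>1)" and "\<nu>2 \<equiv> total_variation (density m g2, \<mu>2)"
  defines "A \<equiv> {x. pot 0 \<nu>2 x < pot 0 \<nu>1 x}" and "B \<equiv> {x. pot 0 \<nu>1 x < pot 0 \<nu>2 x}"
  assumes fin1: "AE x in m. pot 0 \<nu>1 x < \<infinity>" and fin2: "AE x in m. pot 0 \<nu>2 x < \<infinity>"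
    and bound: "AE x in m. indicator A x * g1 x + indicator B x * g2 x \<le> H x"
    and k: "k \<in> L2 m" "\<And>x. 0 \<le> k x"
    and k1: "(\<integral>\<^sup>+x. ennreal (k x) * pot 0 \<nu>1 x \<partial>m) < \<infinity>"
    and k2: "(\<integral>\<^sup>+x. ennreal (k x) * pot 0 \<nu>2 x \<partial>m) < \<infinity>"
  shows "(\<integral>\<^sup>+x. min (\<rho> x) (green 0 (\<lambda>y. ennreal (k y)) x) * (indicator A x * g2 x + indicator B x * g1 x) \<partial>m)
    \<le> (\<integral>\<^sup>+x. \<rho> x * H x \<partial>m) + ((\<integral>\<^sup>+x. \<rho> x \<partial>\<mu>1) + (\<integral>\<^sup>+x. \<rho> x \<partial>\<mu>2))"
proof -
  note [measurable] = g1(1) g2(1) excessive_borel[OF \<rho>]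
  have [measurable]: "k \<in> borel_measurable borel" using k(1) by (simp add: L2_def borel_measurable_m)
  define K where "K x = ennreal (k x)" for x
  have [measurable]: "K \<in> borel_measurable borel" unfolding K_def by measurable
  have dens: "sets (density m g1) = sets borel" "sets (density m g2) = sets borel"
    by (simp_all add: sets_m)
  note \<nu>1 = total_variation_density[OF g1 \<mu>1, folded \<nu>1_def]
    and \<nu>2 = total_variation_density[OF g2 \<mu>2, folded \<nu>2_def]
  define p q where "p = pot 0 \<nu>1" and "q = pot 0 \<nu>2"
  have [measurable]: "p \<in> borel_measurable borel" "q \<in> borel_measurable borel"
    unfolding p_def q_def by (auto intro!: pot_measurable \<nu>1 \<nu>2)
  have [measurable]: "A \<in> sets borel" "B \<in> sets borel"
    unfolding A_def B_def p_def[symmetric] q_def[symmetric] by measurable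
  define h where "h x = indicator A x * g2 x + indicator B x * g1 x" for x
  have [measurable]: "h \<in> borel_measurable borel" unfolding h_def by measurable
  define C where "C = (\<integral>\<^sup>+x. \<rho> x * H x \<partial>m) + ((\<integral>\<^sup>+x. \<rho> x \<partial>\<mu>1) + (\<integral>\<^sup>+x. \<rho> x \<partial>\<mu>2))"
  have g_le: "green \<beta> g1 x \<le> p x" "green \<beta> g2 x \<le> q x" if \<beta>: "0 \<le> \<beta>" for \<beta> x
  proof -
    have s: "(\<lambda>y. r 0 x y) \<in> borel_measurable borel" by (rule kernel_section_measurable) simp
    have "green 0 g1 x \<le> p x" "green 0 g2 x \<le> q x"
      unfolding green_eq_pot_density[OF order_refl g1(1), symmetric] green_eq_pot_density[OF order_refl g2(1), symmetric]
        p_def q_def \<nu>1_def \<nu>2_def pot_def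
        nn_integral_total_variation[OF dens(1) \<mu>1(2) s] nn_integral_total_variation[OF dens(2) \<mu>2(2) s]
      by simp_all
    moreover have "green \<beta> g1 x \<le> green 0 g1 x" "green \<beta> g2 x \<le> green 0 g2 x"
      using \<beta> by (auto intro!: green_antimono)
    ultimately show "green \<beta> g1 x \<le> p x" "green \<beta> g2 x \<le> q x" by (auto intro: order_trans)
  qed
  define b where "b j = 1 / real (Suc j)" for j
  have b: "0 < b j" for j by (simp add: b_def)
  define err where "err j = (\<integral>\<^sup>+x. K x * (ennreal (b j) * green (b j) p x) \<partial>m) + (\<integral>\<^sup>+x. K x * (ennreal (b j) * green (b j) q x) \<partial>m)" for j
  have "err \<longlonglongrightarrow> 0 + 0"
    unfolding err_def[abs_def] b_def p_def q_def using k1 k2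
    by (intro tendsto_add killed_green_pot_tendsto_zero \<nu>1 \<nu>2) (simp_all add: K_def)
  then have err_lim: "err \<longlonglongrightarrow> 0" by simp
  have step: "(\<integral>\<^sup>+x. min (\<rho> x) (green (b j) K x) * h x \<partial>m) \<le> C + err j" for j
  proof -
    define \<beta> where "\<beta> = b j"
    have \<beta>: "0 < \<beta>" using b by (simp add: \<beta>_def)
    have gK[measurable]: "green \<beta> K \<in> borel_measurable borel" using \<beta> by (intro green_measurable) auto
    have [measurable]: "green \<beta> p \<in> borel_measurable borel" "green \<beta> q \<in> borel_measurable borel"
      using \<beta> by (auto intro!: green_measurable)
    define e where "e x = enn2real (min (\<rho> x) (green \<beta> K x))" for x
    have "\<exists>v\<in>D. (\<forall>x. 0 \<le> v x) \<and> (AE x in m. green \<beta> K x = ennreal (v x))"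
      unfolding K_def by (rule green_L2[OF \<beta> k]) (intro bexI conjI allI)
    then obtain v where v: "v \<in> D" "\<And>x. 0 \<le> v x" "AE x in m. green \<beta> K x = ennreal (v x)"
      by auto
    have e_eq: "AE x in m. ennreal (e x) = min (\<rho> x) (green \<beta> K x)"
      using v(3) unfolding e_def by eventually_elim (simp add: min_less_iff_disj)
    have e_le: "ennreal (e x) \<le> min (\<rho> x) (green \<beta> K x)" for x
      unfolding e_def by (cases "min (\<rho> x) (green \<beta> K x)") (auto simp: top_unique)
    have e0: "0 \<le> e x" for x by (simp add: e_def)
    have e_b[measurable]: "e \<in> borel_measurable borel" unfolding e_def by measurable
    have e_L2: "e \<in> L2 m"
    proof (rule L2_AE_bound[OF _ e_b])
      show "v \<in> L2 m" using v(1) domain_L2 by auto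
      show "AE x in m. \<bar>e x\<bar> \<le> \<bar>v x\<bar>"
        using v(3)
      proof eventually_elim
        case (elim x)
        have "ennreal (e x) \<le> ennreal (v x)" using e_le[of x] elim by simp
        then show ?case using v(2)[of x] e0[of x] by simp
      qed
    qed
    have dom: "ennreal a * green (\<beta> + a) (\<lambda>x. ennreal (e x)) y \<le> \<rho> y" if a: "0 < a" for a y
    proof -
      have "green (\<beta> + a) (\<lambda>x. ennreal (e x)) y \<le> green (\<beta> + a) \<rho> y"
        using e_le by (intro green_mono) auto
      also have "\<dots> \<le> green a \<rho> y" using a \<beta> by (intro green_antimono) auto
      finally have "ennreal a * green (\<beta> + a) (\<lambda>x. ennreal (e x)) y \<le> ennreal a * green a \<rho> y"
        by (rule mult_left_mono) simp
      also have "\<dots> \<le> \<rho> y" by (rule excessive_green_le[OF \<rho> a])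
      finally show ?thesis .
    qed
    have med: "AE x in m. ennreal a * green (\<beta> + a) (\<lambda>x. ennreal (e x)) x \<le> ennreal (e x)" if a: "0 < a" for a
    proof -
      have "AE x in m. green \<beta> K x = green (\<beta> + a) K x + ennreal a * green (\<beta> + a) (green \<beta> K) x"
        using resolvent_equation_pos[OF \<beta>, of "\<beta> + a" K] a by simp
      then show ?thesis using e_eq
      proof eventually_elim
        case (elim x)
        have "ennreal a * green (\<beta> + a) (\<lambda>x. ennreal (e x)) x \<le> ennreal a * green (\<beta> + a) (green \<beta> K) x"
          using e_le by (intro mult_left_mono green_mono) auto
        also have "\<dots> \<le> green \<beta> K x" by (subst elim(1)) simp
        finally show ?case using dom[OF a, of x] elim(2) by simp
      qed
    qed
    have e_fin: "(\<integral>\<^sup>+x. ennreal (e x) * g x \<partial>m) < \<infinity>"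
      if [measurable]: "g \<in> borel_measurable borel" and le: "\<And>x. green \<beta> g x \<le> s x"
        and fin: "(\<integral>\<^sup>+x. K x * s x \<partial>m) < \<infinity>" for g s
    proof -
      have "(\<integral>\<^sup>+x. ennreal (e x) * g x \<partial>m) \<le> (\<integral>\<^sup>+x. green \<beta> K x * g x \<partial>m)"
        using e_le by (intro nn_integral_mono mult_right_mono) auto
      also have "\<dots> = (\<integral>\<^sup>+x. K x * green \<beta> g x \<partial>m)"
        using \<beta> by (intro green_symmetric[symmetric]) auto
      also have "\<dots> \<le> (\<integral>\<^sup>+x. K x * s x \<partial>m)"
        using le by (intro nn_integral_mono mult_left_mono) auto
      finally show ?thesis using fin by (rule le_less_trans)
    qed
    have eg: "(\<integral>\<^sup>+x. ennreal (e x) * g1 x \<partial>m) < \<infinity>" "(\<integral>\<^sup>+x. ennreal (e x) * g2 x \<partial>m) < \<infinity>"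
      using e_fin[OF g1(1) g_le(1)[OF less_imp_le[OF \<beta>]]] e_fin[OF g2(1) g_le(2)[OF less_imp_le[OF \<beta>]]] k1 k2
      by (simp_all add: K_def p_def q_def)
    define d where "d x = (p x - q x) + (q x - p x)" for x
    have [measurable]: "d \<in> borel_measurable borel" unfolding d_def by measurable
    have d_le: "d x \<le> p x + q x" for x
      unfolding d_def by (intro add_mono diff_le_self_ennreal)
    have "(\<integral>\<^sup>+x. ennreal (e x) * d x \<partial>m) \<le> (\<integral>\<^sup>+x. green \<beta> K x * (p x + q x) \<partial>m)"
      using e_le d_le by (intro nn_integral_mono mult_mono) auto
    also have "\<dots> = (\<integral>\<^sup>+x. K x * green \<beta> (\<lambda>x. p x + q x) x \<partial>m)"
      using \<beta> by (intro green_symmetric[symmetric]) auto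
    finally have "ennreal \<beta> * (\<integral>\<^sup>+x. ennreal (e x) * d x \<partial>m)
        \<le> ennreal \<beta> * (\<integral>\<^sup>+x. K x * green \<beta> (\<lambda>x. p x + q x) x \<partial>m)"
      by (rule mult_left_mono) simp
    also have "\<dots> = (\<integral>\<^sup>+x. K x * (ennreal \<beta> * green \<beta> p x) + K x * (ennreal \<beta> * green \<beta> q x) \<partial>m)"
      using \<beta> by (subst nn_integral_cmult[symmetric])
        (auto simp: green_add borel_measurable_m distrib_left mult_ac intro!: nn_integral_cong)
    also have "\<dots> = err j"
      unfolding err_def \<beta>_def[symmetric] by (intro nn_integral_add) (simp_all add: borel_measurable_m)
    finally have d_err: "ennreal \<beta> * (\<integral>\<^sup>+x. ennreal (e x) * d x \<partial>m) \<le> err j" .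
    have "err j \<le> (\<integral>\<^sup>+x. K x * p x \<partial>m) + (\<integral>\<^sup>+x. K x * q x \<partial>m)"
      unfolding err_def p_def q_def
    proof (intro add_mono nn_integral_mono_AE)
      show "AE x in m. K x * (ennreal (b j) * green (b j) (pot 0 \<nu>1) x) \<le> K x * pot 0 \<nu>1 x"
        using killed_green_pot_le[OF b \<nu>1, of j] by eventually_elim (simp add: mult_left_mono)
      show "AE x in m. K x * (ennreal (b j) * green (b j) (pot 0 \<nu>2) x) \<le> K x * pot 0 \<nu>2 x"
        using killed_green_pot_le[OF b \<nu>2, of j] by eventually_elim (simp add: mult_left_mono)
    qed
    also have "\<dots> < \<infinity>" using k1 k2 by (simp add: K_def p_def q_def)
    finally have "ennreal \<beta> * (\<integral>\<^sup>+x. ennreal (e x) * d x \<partial>m) < \<infinity>"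
      using d_err by (rule le_less_trans[rotated])
    then have d_fin: "(\<integral>\<^sup>+x. ennreal (e x) * d x \<partial>m) < \<infinity>"
      using \<beta> by (auto simp: ennreal_mult_less_top)
    have "(\<integral>\<^sup>+x. min (\<rho> x) (green \<beta> K x) * h x \<partial>m) = (\<integral>\<^sup>+x. ennreal (e x) * h x \<partial>m)"
      using e_eq by (intro nn_integral_cong_AE) (auto elim!: eventually_mono)
    also have "\<dots> = (\<integral>\<^sup>+x. ennreal (e x) * indicator A x * g2 x \<partial>m) + (\<integral>\<^sup>+x. ennreal (e x) * indicator B x * g1 x \<partial>m)"
      unfolding h_def by (subst nn_integral_add[symmetric]) (simp_all add: borel_measurable_m distrib_left mult.assoc)
    also have "\<dots> \<le> (\<integral>\<^sup>+x. ennreal (e x) * indicator A x * g1 x \<partial>m) + (\<integral>\<^sup>+x. ennreal (e x) * indicator B x * g2 x \<partial>m)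
      + ((\<integral>\<^sup>+x. \<rho> x \<partial>\<mu>1) + (\<integral>\<^sup>+x. \<rho> x \<partial>\<mu>2)) + ennreal \<beta> * (\<integral>\<^sup>+x. ennreal (e x) * d x \<partial>m)"
      unfolding A_def B_def \<nu>1_def \<nu>2_def d_def p_def q_def
      by (rule kato_limit[OF less_imp_le[OF \<beta>] g1 g2 \<mu>1 \<mu>2 e_L2 e0 med dom eg])
        (use fin1 fin2 d_fin in \<open>simp_all add: d_def p_def q_def \<nu>1_def \<nu>2_def\<close>)
    also have "\<dots> \<le> (\<integral>\<^sup>+x. \<rho> x * H x \<partial>m) + ((\<integral>\<^sup>+x. \<rho> x \<partial>\<mu>1) + (\<integral>\<^sup>+x. \<rho> x \<partial>\<mu>2)) + err j"
    proof (intro add_mono order_refl d_err)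
      have "(\<integral>\<^sup>+x. ennreal (e x) * indicator A x * g1 x \<partial>m) + (\<integral>\<^sup>+x. ennreal (e x) * indicator B x * g2 x \<partial>m)
          = (\<integral>\<^sup>+x. ennreal (e x) * (indicator A x * g1 x + indicator B x * g2 x) \<partial>m)"
        by (subst nn_integral_add[symmetric]) (simp_all add: borel_measurable_m distrib_left mult.assoc)
      also have "\<dots> \<le> (\<integral>\<^sup>+x. \<rho> x * H x \<partial>m)"
        using bound
      proof (intro nn_integral_mono_AE, elim eventually_mono)
        fix x assume "indicator A x * g1 x + indicator B x * g2 x \<le> H x"
        then show "ennreal (e x) * (indicator A x * g1 x + indicator B x * g2 x) \<le> \<rho> x * H x"
          using e_le[of x] by (intro mult_mono) auto
      qed
      finally show "(\<integral>\<^sup>+x. ennreal (e x) * indicator A x * g1 x \<partial>m) + (\<integral>\<^sup>+x. ennreal (e x) * indicator B x * g2 x \<partial>m)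
          \<le> (\<integral>\<^sup>+x. \<rho> x * H x \<partial>m)" .
    qed
    finally show ?thesis unfolding C_def \<beta>_def .
  qed
  have "(\<integral>\<^sup>+x. min (\<rho> x) (green 0 K x) * h x \<partial>m) \<le> C + 0"
  proof (rule LIMSEQ_le)
    show "(\<lambda>j. C + err j) \<longlonglongrightarrow> C + 0" by (intro tendsto_add tendsto_const err_lim)
    have "b n \<le> b k" if "k \<le> n" for k n unfolding b_def using that by (intro divide_left_mono) auto
    then have inc: "green (b k) K x \<le> green (b n) K x" if "k \<le> n" for k n x
      using that b[of n] by (intro green_antimono) auto
    show "(\<lambda>j. \<integral>\<^sup>+x. min (\<rho> x) (green (b j) K x) * h x \<partial>m) \<longlonglongrightarrow> (\<integral>\<^sup>+x. min (\<rho> x) (green 0 K x) * h x \<partial>m)"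
    proof (rule nn_integral_LIMSEQ)
      show mono: "incseq (\<lambda>j x. min (\<rho> x) (green (b j) K x) * h x)"
        by (intro incseq_SucI le_funI mult_right_mono min.mono inc) simp_all
      have [measurable]: "green (b j) K \<in> borel_measurable borel" for j
        using b[of j] by (intro green_measurable) auto
      show "(\<lambda>x. min (\<rho> x) (green (b j) K x) * h x) \<in> borel_measurable m" for j
        unfolding borel_measurable_m by measurable
      fix x
      have i: "incseq (\<lambda>j. min (\<rho> x) (green (b j) K x))"
        by (intro incseq_SucI min.mono inc) simp_all
      have "(\<lambda>j. min (\<rho> x) (green (b j) K x)) \<longlonglongrightarrow> min (\<rho> x) (green 0 K x)"
        unfolding b_def by (intro tendsto_min tendsto_const green_zero_LIMSEQ) measurable
      then have sup: "(SUP j. min (\<rho> x) (green (b j) K x)) = min (\<rho> x) (green 0 K x)"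
        by (rule LIMSEQ_unique[OF LIMSEQ_SUP[OF i]])
      have "(\<lambda>j. min (\<rho> x) (green (b j) K x) * h x) \<longlonglongrightarrow> (SUP j. min (\<rho> x) (green (b j) K x) * h x)"
        using mono by (intro LIMSEQ_SUP) (auto simp: incseq_def le_fun_def)
      then show "(\<lambda>j. min (\<rho> x) (green (b j) K x) * h x) \<longlonglongrightarrow> min (\<rho> x) (green 0 K x) * h x"
        by (simp add: SUP_mult_right_ennreal[symmetric] sup)
    qed
  qed (use step in blast)
  then show ?thesis by (simp add: C_def h_def K_def[abs_def])
qed

lemma ex_L2_weight:
  assumes w[measurable]: "w \<in> borel_measurable borel" and fin: "AE x in m. w x < \<infinity>"
  obtains k where "k \<in> L2 m" "\<And>x. 0 < k x" "(\<integral>\<^sup>+x. ennreal (k x) * w x \<partial>m) < \<infinity>"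
proof -
  have sp: "space m = UNIV" using sets_eq_imp_space_eq[OF sets_m] by simp
  obtain h where h: "h \<in> borel_measurable borel" "integral\<^sup>N m h \<noteq> \<infinity>" "\<And>x. 0 < h x \<and> h x < \<infinity>"
    using sigma_finite_measure.Ex_finite_integrable_function[OF sigma_finite_m] sp
    by (auto simp: borel_measurable_m)
  note [measurable] = h(1)
  define k where "k x = enn2real (min 1 (h x)) / (1 + enn2real (w x))" for x
  have k_b[measurable]: "k \<in> borel_measurable borel" unfolding k_def by measurable
  have m1: "0 < enn2real (min 1 (h x))" "enn2real (min 1 (h x)) \<le> 1" "ennreal (enn2real (min 1 (h x))) \<le> h x" for x
    using h(3)[of x] by (auto simp: enn2real_positive_iff min_less_iff_disj enn2real_leI)
  have k_pos: "0 < k x" for x using m1(1)[of x] by (simp add: k_def add_pos_nonneg)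
  have k_le: "k x \<le> enn2real (min 1 (h x))" for x
    unfolding k_def using m1(1)[of x] by (intro divide_le_eq[THEN iffD2]) (auto simp: add_pos_nonneg mult_le_cancel_left1)
  have "integrable m (\<lambda>x. (k x)\<^sup>2)"
  proof (rule integrableI_bounded)
    have "(k x)\<^sup>2 \<le> enn2real (min 1 (h x))" for x
    proof -
      have "k x * k x \<le> k x * 1" using k_le[of x] m1(2)[of x] k_pos[of x] by (intro mult_left_mono) auto
      then show ?thesis using k_le[of x] by (simp add: power2_eq_square)
    qed
    then have "(\<integral>\<^sup>+x. ennreal (norm ((k x)\<^sup>2)) \<partial>m) \<le> integral\<^sup>N m h"
      using m1(3) by (intro nn_integral_mono) (auto intro: order_trans[OF ennreal_leI])
    then show "(\<integral>\<^sup>+x. ennreal (norm ((k x)\<^sup>2)) \<partial>m) < \<infinity>"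
      using h(2) by (auto simp: less_top[symmetric] top_unique)
  qed (simp add: borel_measurable_m)
  then have "k \<in> L2 m" by (simp add: L2_def borel_measurable_m)
  moreover have "(\<integral>\<^sup>+x. ennreal (k x) * w x \<partial>m) < \<infinity>"
  proof -
    have "(\<integral>\<^sup>+x. ennreal (k x) * w x \<partial>m) \<le> integral\<^sup>N m h"
      using fin
    proof (intro nn_integral_mono_AE, elim eventually_mono)
      fix x assume "w x < \<infinity>"
      then have wx: "w x = ennreal (enn2real (w x))" by simp
      have "ennreal (k x) * w x = ennreal (k x * enn2real (w x))"
        using k_pos[of x] by (subst wx) (simp add: ennreal_mult less_imp_le)
      also have "k x * enn2real (w x) \<le> enn2real (min 1 (h x))"
      proof -
        have "k x * enn2real (w x) \<le> k x * (1 + enn2real (w x))" using k_pos[of x] by (intro mult_left_mono) auto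
        also have "\<dots> = enn2real (min 1 (h x))"
          unfolding k_def using enn2real_nonneg[of "w x"] by (simp add: add_nonneg_eq_0_iff)
        finally show ?thesis .
      qed
      finally show "ennreal (k x) * w x \<le> h x" using m1(3)[of x] by (meson ennreal_leI order_trans)
    qed
    then show ?thesis using h(2) by (auto simp: less_top[symmetric] top_unique)
  qed
  ultimately show ?thesis using that k_pos by blast
qed

lemma green_zero_positive:
  assumes k: "k \<in> L2 m" "\<And>x. 0 < k x"
  shows "AE x in m. 0 < green 0 (\<lambda>y. ennreal (k y)) x"
proof -
  obtain a :: "nat \<Rightarrow> real" where a: "\<And>n. 0 < a n"
    "AE x in m. (\<lambda>n. ennreal (a n) * green (0 + a n) (\<lambda>y. ennreal (k y)) x) \<longlonglongrightarrow> ennreal (k x)"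
    using green_AE_approximation[OF k(1) _ k(1), of 0] k(2) by (auto simp: less_imp_le)
  have b: "(\<lambda>y. ennreal (k y)) \<in> borel_measurable borel"
    using k(1) by (auto simp: L2_def borel_measurable_m)
  from a(2) show ?thesis
  proof eventually_elim
    case (elim x)
    show ?case
    proof (rule ccontr)
      assume "\<not> 0 < green 0 (\<lambda>y. ennreal (k y)) x"
      then have "green (a n) (\<lambda>y. ennreal (k y)) x = 0" for n
        using green_antimono[OF order_refl less_imp_le[OF a(1)] b, of n x] by simp
      with elim have "(\<lambda>n::nat. 0) \<longlonglongrightarrow> ennreal (k x)" by simp
      then have "ennreal (k x) = 0" by (simp add: LIMSEQ_const_iff)
      then show False using k(2)[of x] by simp
    qed
  qed
qed

lemma weighted_estimate:
  assumes \<rho>: "excessive X P 0 \<rho>"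
    and g1: "g1 \<in> borel_measurable borel" "AE x in m. g1 x < \<infinity>"
    and g2: "g2 \<in> borel_measurable borel" "AE x in m. g2 x < \<infinity>"
    and \<mu>1: "sigma_finite_measure \<mu>1" "sets \<mu>1 = sets borel"
    and \<mu>2: "sigma_finite_measure \<mu>2" "sets \<mu>2 = sets borel"
  defines "\<nu>1 \<equiv> total_variation (density m g1, \<mu>1)" and "\<nu>2 \<equiv> total_variation (density m g2, \<mu>2)"
  defines "A \<equiv> {x. pot 0 \<nu>2 x < pot 0 \<nu>1 x}" and "B \<equiv> {x. pot 0 \<nu>1 x < pot 0 \<nu>2 x}"
  assumes fin1: "AE x in m. pot 0 \<nu>1 x < \<infinity>" and fin2: "AE x in m. pot 0 \<nu>2 x < \<infinity>"
    and bound: "AE x in m. indicator A x * g1 x + indicator B x * g2 x \<le> H x"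
  shows "(\<integral>\<^sup>+x. \<rho> x * (indicator A x * g2 x + indicator B x * g1 x) \<partial>m)
    \<le> (\<integral>\<^sup>+x. \<rho> x * H x \<partial>m) + ((\<integral>\<^sup>+x. \<rho> x \<partial>\<mu>1) + (\<integral>\<^sup>+x. \<rho> x \<partial>\<mu>2))"
proof -
  note [measurable] = g1(1) g2(1) excessive_borel[OF \<rho>]
  note \<nu>1 = total_variation_density[OF g1 \<mu>1, folded \<nu>1_def]
    and \<nu>2 = total_variation_density[OF g2 \<mu>2, folded \<nu>2_def]
  have [measurable]: "pot 0 \<nu>1 \<in> borel_measurable borel" "pot 0 \<nu>2 \<in> borel_measurable borel"
    by (auto intro!: pot_measurable \<nu>1 \<nu>2)
  have [measurable]: "A \<in> sets borel" "B \<in> sets borel"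
    unfolding A_def B_def by measurable
  define h where "h x = indicator A x * g2 x + indicator B x * g1 x" for x
  have [measurable]: "h \<in> borel_measurable borel" unfolding h_def by measurable
  define C where "C = (\<integral>\<^sup>+x. \<rho> x * H x \<partial>m) + ((\<integral>\<^sup>+x. \<rho> x \<partial>\<mu>1) + (\<integral>\<^sup>+x. \<rho> x \<partial>\<mu>2))"
  have "AE x in m. pot 0 \<nu>1 x + pot 0 \<nu>2 x < \<infinity>"
    using fin1 fin2 by eventually_elim simp
  then obtain k where k: "k \<in> L2 m" "\<And>x. 0 < k x"
      "(\<integral>\<^sup>+x. ennreal (k x) * (pot 0 \<nu>1 x + pot 0 \<nu>2 x) \<partial>m) < \<infinity>"
    by (rule ex_L2_weight[rotated]) measurable
  have k_b[measurable]: "k \<in> borel_measurable borel" using k(1) by (simp add: L2_def borel_measurable_m)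
  define R where "R = green 0 (\<lambda>y. ennreal (k y))"
  have [measurable]: "R \<in> borel_measurable borel" unfolding R_def by (rule green_measurable) auto
  have kfin: "(\<integral>\<^sup>+x. ennreal (k x) * pot 0 \<nu> x \<partial>m) < \<infinity>" if "\<nu> = \<nu>1 \<or> \<nu> = \<nu>2" for \<nu>
    using that by (intro le_less_trans[OF nn_integral_mono k(3)] mult_left_mono) auto
  have step: "(\<integral>\<^sup>+x. min (\<rho> x) (of_nat n * R x) * h x \<partial>m) \<le> C" for n
  proof -
    have kn: "(\<lambda>x. real n * k x) \<in> L2 m" using k(1) by (auto simp: L2_def power_mult_distrib)
    have kn0: "0 \<le> real n * k x" for x using k(2)[of x] by simp
    have split: "ennreal (real n * k x) = of_nat n * ennreal (k x)" for x
      using k(2)[of x] by (simp add: ennreal_mult less_imp_le ennreal_of_nat_eq_real_of_nat)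
    have knfin: "(\<integral>\<^sup>+x. ennreal (real n * k x) * pot 0 \<nu> x \<partial>m) < \<infinity>" if \<nu>: "\<nu> = \<nu>1 \<or> \<nu> = \<nu>2" for \<nu>
    proof -
      have "(\<lambda>x. ennreal (k x) * pot 0 \<nu> x) \<in> borel_measurable m"
        unfolding borel_measurable_m using \<nu> by (elim disjE) (simp_all add: measurable)
      then have "(\<integral>\<^sup>+x. ennreal (real n * k x) * pot 0 \<nu> x \<partial>m) = of_nat n * (\<integral>\<^sup>+x. ennreal (k x) * pot 0 \<nu> x \<partial>m)"
        unfolding split mult.assoc by (rule nn_integral_cmult)
      then show ?thesis using kfin[OF \<nu>] by (simp add: ennreal_mult_less_top of_nat_less_top)
    qed
    have green_n: "green 0 (\<lambda>y. ennreal (real n * k y)) x = of_nat n * R x" for x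
      unfolding split R_def by (rule green_cmult) auto
    show ?thesis
      using weighted_estimate_potential[OF \<rho> g1 g2 \<mu>1 \<mu>2 fin1[unfolded \<nu>1_def] fin2[unfolded \<nu>2_def]
          bound[unfolded A_def B_def \<nu>1_def \<nu>2_def] kn kn0
          knfin[unfolded \<nu>1_def \<nu>2_def, OF disjI1[OF refl]] knfin[unfolded \<nu>1_def \<nu>2_def, OF disjI2[OF refl]]]
      unfolding green_n C_def h_def A_def B_def \<nu>1_def \<nu>2_def .
  qed
  define L where "L x = (if R x = 0 then 0 else \<rho> x)" for x
  have mono_n: "min (\<rho> x) (of_nat i * R x) \<le> min (\<rho> x) (of_nat j * R x)" if "i \<le> j" for i j x
    using that by (intro min.mono order_refl mult_right_mono) simp_all
  have "(\<lambda>n. \<integral>\<^sup>+x. min (\<rho> x) (of_nat n * R x) * h x \<partial>m) \<longlonglongrightarrow> (\<integral>\<^sup>+x. L x * h x \<partial>m)"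
  proof (rule nn_integral_LIMSEQ)
    show mono: "incseq (\<lambda>n x. min (\<rho> x) (of_nat n * R x) * h x)"
      by (intro incseq_SucI le_funI mult_right_mono mono_n) simp_all
    show "(\<lambda>x. min (\<rho> x) (of_nat n * R x) * h x) \<in> borel_measurable m" for n
      unfolding borel_measurable_m by measurable
    fix x
    have i: "incseq (\<lambda>n. min (\<rho> x) (of_nat n * R x))"
      by (intro incseq_SucI mono_n) simp
    have "(\<lambda>n. min (\<rho> x) (of_nat n * R x)) \<longlonglongrightarrow> L x"
    proof (cases "R x = 0")
      case False
      then have "(\<lambda>n. of_nat n * R x) \<longlonglongrightarrow> top * R x"
        by (intro tendsto_mult_ennreal tendsto_const of_nat_tendsto_top_ennreal) auto
      then have "(\<lambda>n. min (\<rho> x) (of_nat n * R x)) \<longlonglongrightarrow> min (\<rho> x) (top * R x)"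
        by (intro tendsto_min tendsto_const)
      then show ?thesis using False by (simp add: L_def ennreal_top_mult)
    qed (simp add: L_def)
    then have sup: "(SUP n. min (\<rho> x) (of_nat n * R x)) = L x"
      by (rule LIMSEQ_unique[OF LIMSEQ_SUP[OF i]])
    have "(\<lambda>n. min (\<rho> x) (of_nat n * R x) * h x) \<longlonglongrightarrow> (SUP n. min (\<rho> x) (of_nat n * R x) * h x)"
      using mono by (intro LIMSEQ_SUP) (auto simp: incseq_def le_fun_def)
    then show "(\<lambda>n. min (\<rho> x) (of_nat n * R x) * h x) \<longlonglongrightarrow> L x * h x"
      by (simp add: SUP_mult_right_ennreal[symmetric] sup)
  qed
  then have "(\<integral>\<^sup>+x. L x * h x \<partial>m) \<le> C"
    by (rule LIMSEQ_le_const2) (use step in blast)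
  moreover have "(\<integral>\<^sup>+x. L x * h x \<partial>m) = (\<integral>\<^sup>+x. \<rho> x * h x \<partial>m)"
    using green_zero_positive[OF k(1,2)]
    by (intro nn_integral_cong_AE) (auto elim!: eventually_mono simp: L_def R_def)
  ultimately show ?thesis by (simp add: C_def h_def)
qed

end

lemma (in dirichlet_hunt_setting) solution_estimate:
  assumes \<rho>: "excessive X P 0 \<rho>" and \<rho>_pos: "\<And>x. 0 < \<rho> x"
    and \<mu>: "\<mu> \<in> weighted_class m D \<E> r \<rho>"
    and f: "caratheodory f" and f_mono: "\<And>x. antimono (f x)"
    and u: "is_solution m D \<E> X P r f \<mu> u"
  shows "weighted_L1_norm m \<rho> (composed f u)
    \<le> 2 * weighted_L1_norm m \<rho> (\<lambda>x. f x 0) + weighted_tv_norm \<rho> \<mu>"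
proof -
  obtain \<mu>1 \<mu>2 where \<mu>_eq: "\<mu> = (\<mu>1, \<mu>2)" by (cases \<mu>)
  have \<mu>12: "sets \<mu>1 = sets borel" "sets \<mu>2 = sets borel"
    and \<mu>_fin: "AE x in m. pot 0 (total_variation (\<mu>1, \<mu>2)) x < \<infinity>"
    and \<rho>\<mu>: "(\<integral>\<^sup>+x. \<rho> x \<partial>total_variation (\<mu>1, \<mu>2)) < \<infinity>"
    using \<mu> quasi_everywhere_imp_AE
    by (auto simp: \<mu>_eq weighted_class_def weighted_tv_norm_def potential_class_def signed_borel_measure_def pot_def)
  note \<rho>_b[measurable] = excessive_borel[OF \<rho>]
  have tv: "weighted_tv_norm \<rho> \<mu> = (\<integral>\<^sup>+x. \<rho> x \<partial>\<mu>1) + (\<integral>\<^sup>+x. \<rho> x \<partial>\<mu>2)"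
    unfolding weighted_tv_norm_def \<mu>_eq by (rule nn_integral_total_variation[OF \<mu>12 \<rho>_b])
  have \<rho>_fin: "(\<integral>\<^sup>+x. \<rho> x \<partial>\<mu>1) < \<infinity>" "(\<integral>\<^sup>+x. \<rho> x \<partial>\<mu>2) < \<infinity>"
    using \<rho>\<mu> unfolding nn_integral_total_variation[OF \<mu>12 \<rho>_b] by auto
  have \<rho>_m: "\<rho> \<in> borel_measurable \<mu>1" "\<rho> \<in> borel_measurable \<mu>2"
    using \<rho>_b by (simp_all add: measurable_cong_sets[OF \<mu>12(1) refl] measurable_cong_sets[OF \<mu>12(2) refl])
  have \<mu>_sf: "sigma_finite_measure \<mu>1" "sigma_finite_measure \<mu>2"
    by (rule sigma_finite_measure_if_positive_integrable[OF \<rho>_m(1) \<rho>_pos \<rho>_fin(1)],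
      rule sigma_finite_measure_if_positive_integrable[OF \<rho>_m(2) \<rho>_pos \<rho>_fin(2)])
  define g where "g = composed f u"
  have u_b[measurable]: "u \<in> borel_measurable universal_borel" using u by (simp add: is_solution_def)
  have g_u: "g \<in> borel_measurable universal_borel"
    unfolding g_def composed_def[abs_def]
  proof (rule caratheodory_comp_measurable[where f=f])
    show "(\<lambda>x. real_of_ereal (u x)) \<in> borel_measurable universal_borel" by measurable
  qed (use f in \<open>auto simp: caratheodory_def\<close>)
  have gp_u: "(\<lambda>x. ennreal (g x)) \<in> borel_measurable universal_borel"
    and gm_u: "(\<lambda>x. ennreal (- g x)) \<in> borel_measurable universal_borel"
    and f0_u: "(\<lambda>x. ennreal \<bar>f x 0\<bar>) \<in> borel_measurable universal_borel"
  proof -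
    note [measurable] = g_u
    have [measurable]: "(\<lambda>x. f x 0) \<in> borel_measurable universal_borel"
      using f by (simp add: caratheodory_def)
    show "(\<lambda>x. ennreal (g x)) \<in> borel_measurable universal_borel"
      "(\<lambda>x. ennreal (- g x)) \<in> borel_measurable universal_borel"
      "(\<lambda>x. ennreal \<bar>f x 0\<bar>) \<in> borel_measurable universal_borel"
      by measurable
  qed
  obtain g1 where g1: "g1 \<in> borel_measurable borel" "AE x in m. ennreal (g x) = g1 x"
    by (rule universal_borel_AE_eq[OF gp_u])
  obtain g2 where g2: "g2 \<in> borel_measurable borel" "AE x in m. ennreal (- g x) = g2 x"
    by (rule universal_borel_AE_eq[OF gm_u])
  obtain H where H: "H \<in> borel_measurable borel" "AE x in m. ennreal \<bar>f x 0\<bar> = H x"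
    by (rule universal_borel_AE_eq[OF f0_u])
  note [measurable] = g1(1) g2(1) H(1)
  have g_fin: "AE x in m. g1 x < \<infinity>" "AE x in m. g2 x < \<infinity>"
    using g1(2) by (eventually_elim, metis ennreal_less_top infinity_ennreal_def)
      (use g2(2) in \<open>eventually_elim, metis ennreal_less_top infinity_ennreal_def\<close>)
  have dens_eq: "density m (\<lambda>x. ennreal (g x)) = density m g1" "density m (\<lambda>x. ennreal (- g x)) = density m g2"
    by (rule density_cong_AE[OF g1(2)], rule density_cong_AE[OF g2(2)])
  have dens: "sets (density m g1) = sets borel" "sets (density m g2) = sets borel"
    by (simp_all add: sets_m)
  have s: "(\<lambda>y. r 0 x y) \<in> borel_measurable borel" for x
    by (rule kernel_section_measurable) simp
  have pot_tv: "pot 0 (total_variation (a, b)) x = pot 0 a x + pot 0 b x"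
    if "sets a = sets borel" "sets b = sets borel" for a b x
    unfolding pot_def by (rule nn_integral_total_variation[OF that s])
  have "AE x in m. pot 0 (total_variation (density m g1, density m g2)) x < \<infinity>"
    using u quasi_everywhere_imp_AE
    by (auto simp: is_solution_def potential_class_def signed_density_def g_def[symmetric] dens_eq pot_def)
  then have fin: "AE x in m. pot 0 (density m g1) x < \<infinity> \<and> pot 0 (density m g2) x < \<infinity>
      \<and> pot 0 \<mu>1 x < \<infinity> \<and> pot 0 \<mu>2 x < \<infinity>"
    using \<mu>_fin by eventually_elim (simp add: pot_tv[OF dens] pot_tv[OF \<mu>12])
  define \<nu>1 where "\<nu>1 = total_variation (density m g1, \<mu>1)"
  define \<nu>2 where "\<nu>2 = total_variation (density m g2, \<mu>2)"
  have \<nu>_pot: "pot 0 \<nu>1 x = pot 0 (density m g1) x + pot 0 \<mu>1 x"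
    "pot 0 \<nu>2 x = pot 0 (density m g2) x + pot 0 \<mu>2 x" for x
    unfolding \<nu>1_def \<nu>2_def by (intro pot_tv dens \<mu>12)+
  have fin1: "AE x in m. pot 0 \<nu>1 x < \<infinity>" and fin2: "AE x in m. pot 0 \<nu>2 x < \<infinity>"
    using fin by (auto simp: \<nu>_pot elim!: eventually_mono)
  have sol: "AE x in m. u x = signed_resolvent X P 0 g x + potential r \<mu> x"
    using u quasi_everywhere_imp_AE by (simp add: is_solution_def g_def)
  have sr: "signed_resolvent X P 0 g x = integral_diff (pot 0 (density m g1) x) (pot 0 (density m g2) x)" for x
    unfolding signed_resolvent_def
    by (simp add: resolvent_eq_green[OF order_refl gp_u] resolvent_eq_green[OF order_refl gm_u]
      green_eq_pot_density g1(1) g2(1) green_cong_AE[OF g1(2)] green_cong_AE[OF g2(2)])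
  have u_eq: "AE x in m. real_of_ereal (u x) = enn2real (pot 0 \<nu>1 x) - enn2real (pot 0 \<nu>2 x)"
    using sol fin
  proof eventually_elim
    case (elim x)
    have ex: "\<exists>a. t = ennreal a \<and> 0 \<le> a" if "t < \<infinity>" for t
      using that by (cases t) auto
    obtain a b c d where abcd: "pot 0 (density m g1) x = ennreal a" "pot 0 (density m g2) x = ennreal b"
        "pot 0 \<mu>1 x = ennreal c" "pot 0 \<mu>2 x = ennreal d" "0 \<le> a" "0 \<le> b" "0 \<le> c" "0 \<le> d"
      using elim(2) ex[of "pot 0 (density m g1) x"] ex[of "pot 0 (density m g2) x"] ex[of "pot 0 \<mu>1 x"] ex[of "pot 0 \<mu>2 x"]
      by blast
    have "potential r \<mu> x = integral_diff (pot 0 \<mu>1 x) (pot 0 \<mu>2 x)"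
      by (simp add: potential_def \<mu>_eq pot_def)
    then have "u x = ereal ((a - b) + (c - d))"
      using elim(1) unfolding sr abcd by (simp add: integral_diff_def abcd)
    moreover have "enn2real (pot 0 \<nu>1 x) = a + c" "enn2real (pot 0 \<nu>2 x) = b + d"
      unfolding \<nu>_pot abcd using abcd(5-8) by (simp_all flip: ennreal_plus)
    ultimately show ?case by simp
  qed
  define A where "A = {x. pot 0 \<nu>2 x < pot 0 \<nu>1 x}"
  define B where "B = {x. pot 0 \<nu>1 x < pot 0 \<nu>2 x}"
  have pointwise: "AE x in m. indicator A x * g1 x + indicator B x * g2 x \<le> H x \<and>
      ennreal \<bar>g x\<bar> \<le> (indicator A x * g2 x + indicator B x * g1 x) + H x"
    using u_eq fin1 fin2 g1(2) g2(2) H(2)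
  proof eventually_elim
    case (elim x)
    define U where "U = real_of_ereal (u x)"
    have gU: "g x = f x U" by (simp add: g_def composed_def U_def)
    have iff: "pot 0 \<nu>2 x < pot 0 \<nu>1 x \<longleftrightarrow> 0 < U" "pot 0 \<nu>1 x < pot 0 \<nu>2 x \<longleftrightarrow> U < 0"
      using elim(1-3) unfolding U_def
      by (cases "pot 0 \<nu>1 x"; cases "pot 0 \<nu>2 x"; simp add: ennreal_less_iff)+
    have abs_split: "ennreal \<bar>g x\<bar> = g1 x + g2 x"
      unfolding elim(4,5)[symmetric] by (cases "0 \<le> g x") (auto simp: ennreal_neg)
    consider "0 < U" | "U < 0" | "U = 0" by linarith
    then show ?case
    proof cases
      case 1
      then have "x \<in> A" "x \<notin> B" using iff by (auto simp: A_def B_def)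
      moreover have "g x \<le> f x 0" unfolding gU by (rule antimonoD[OF f_mono]) (use 1 in simp)
      then have "g1 x \<le> H x" unfolding elim(4,6)[symmetric] by (intro ennreal_leI) simp
      ultimately show ?thesis by (simp add: abs_split add.commute[of "g1 x"] add_left_mono)
    next
      case 2
      then have "x \<notin> A" "x \<in> B" using iff by (auto simp: A_def B_def)
      moreover have "f x 0 \<le> g x" unfolding gU by (rule antimonoD[OF f_mono]) (use 2 in simp)
      then have "g2 x \<le> H x" unfolding elim(5,6)[symmetric] by (intro ennreal_leI) simp
      ultimately show ?thesis by (simp add: abs_split add_left_mono)
    next
      case 3
      then have "x \<notin> A" "x \<notin> B" using iff by (auto simp: A_def B_def)
      then show ?thesis using 3 gU elim(6) by simp
    qed
  qed
  have [measurable]: "pot 0 \<nu>1 \<in> borel_measurable borel" "pot 0 \<nu>2 \<in> borel_measurable borel"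
    unfolding \<nu>1_def \<nu>2_def
    by (intro pot_measurable order_refl total_variation_density g1(1) g2(1) g_fin \<mu>_sf \<mu>12)+
  have [measurable]: "A \<in> sets borel" "B \<in> sets borel"
    unfolding A_def B_def by measurable
  have bound: "AE x in m. indicator A x * g1 x + indicator B x * g2 x \<le> H x"
    using pointwise by eventually_elim simp
  have "weighted_L1_norm m \<rho> g \<le> (\<integral>\<^sup>+x. \<rho> x * (indicator A x * g2 x + indicator B x * g1 x) + \<rho> x * H x \<partial>m)"
    unfolding weighted_L1_norm_def distrib_left[symmetric]
  proof (rule nn_integral_mono_AE)
    show "AE x in m. \<rho> x * ennreal \<bar>g x\<bar> \<le> \<rho> x * ((indicator A x * g2 x + indicator B x * g1 x) + H x)"
      using pointwise by eventually_elim (intro mult_left_mono, simp_all)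
  qed
  also have "\<dots> = (\<integral>\<^sup>+x. \<rho> x * (indicator A x * g2 x + indicator B x * g1 x) \<partial>m) + (\<integral>\<^sup>+x. \<rho> x * H x \<partial>m)"
    by (rule nn_integral_add) (simp_all add: borel_measurable_m)
  also have "\<dots> \<le> ((\<integral>\<^sup>+x. \<rho> x * H x \<partial>m) + weighted_tv_norm \<rho> \<mu>) + (\<integral>\<^sup>+x. \<rho> x * H x \<partial>m)"
    unfolding tv A_def B_def \<nu>1_def \<nu>2_def
    by (intro add_right_mono weighted_estimate[OF \<rho> g1(1) g_fin(1) g2(1) g_fin(2) \<mu>_sf(1) \<mu>12(1) \<mu>_sf(2) \<mu>12(2)
      fin1[unfolded \<nu>1_def] fin2[unfolded \<nu>2_def] bound[unfolded A_def B_def \<nu>1_def \<nu>2_def]])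
  also have "(\<integral>\<^sup>+x. \<rho> x * H x \<partial>m) = weighted_L1_norm m \<rho> (\<lambda>x. f x 0)"
    unfolding weighted_L1_norm_def using H(2)
    by (intro nn_integral_cong_AE) (auto elim!: eventually_mono)
  finally show ?thesis unfolding g_def by (simp add: mult_2 ac_simps)
qed

theorem proposition4p8:
  fixes m :: "'a::{metric_space, second_countable_topology} measure"
    and D :: "('a \<Rightarrow> real) set"
    and \<E> :: "('a \<Rightarrow> real) \<Rightarrow> ('a \<Rightarrow> real) \<Rightarrow> real"
    and M :: "'w measure"
    and F :: "ennreal \<Rightarrow> 'w measure"
    and X :: "ennreal \<Rightarrow> 'w \<Rightarrow> 'a option"
    and P :: "'a option \<Rightarrow> 'w measure"
    and r :: "real \<Rightarrow> 'a \<Rightarrow> 'a \<Rightarrow> ennreal"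
    and \<rho> :: "'a \<Rightarrow> ennreal"
    and \<mu> :: "'a smeasure"
    and f :: "'a \<Rightarrow> real \<Rightarrow> real"
    and u :: "'a \<Rightarrow> ereal"
  assumes "dirichlet_hunt_setting m D \<E> M F X P r"
    and "excessive X P 0 \<rho>" and "\<forall>x. 0 < \<rho> x"
    and "\<mu> \<in> weighted_class m D \<E> r \<rho>"
    and "caratheodory f"
    and "\<forall>x. antimono (f x)"
    and "(\<lambda>x. f x 0) \<in> weighted_L1 m \<rho>"
    and "is_solution m D \<E> X P r f \<mu> u"
  shows "weighted_L1_norm m \<rho> (composed f u)
    \<le> 2 * weighted_L1_norm m \<rho> (\<lambda>x. f x 0) + weighted_tv_norm \<rho> \<mu>"
  using assms by (intro dirichlet_hunt_setting.solution_estimate[OF assms(1)]) auto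

end
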